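(* Let $G\subset \mathrm{Diff}^\omega_+(\mathbf{S}^1)$ be a finitely generated subgroup such that the action of $G$ on $\mathbf{S}^1$ is minimal, has property $(\star)$ and has a non-expandable point $x_0\in\mathbf{S}^1$. Then $G$ has infinitely many ends.
   Context: $\mathrm{Diff}^\omega_+(\mathbf{S}^1)$ is the group of orientation-preserving real-analytic diffeomorphisms of the circle $\mathbf{S}^1=\mathbb{R}/\mathbb{Z}$. The action is minimal if every orbit is dense. A point $x\in\mathbf{S}^1$ is non-expandable if $g'(x)\le 1$ for every $g\in G$; the set of these is $\mathrm{NE}$. Property $(\star)$ (real-analytic case): let $G\subset \mathrm{Diff}^\omega_+(\mathbf{S}^1)$ have no finite orbit, with minimal invariant closed set $\Lambda$ (here $\Lambda=\mathbf{S}^1$). $G$ has property $(\star)$ if for every $x\in\mathrm{NE}\cap\Lambda$ there is $g\in G\setminus\{id\}$ such that $g(x)=x$. The number of ends of a finitely generated group is the number of ends of its Cayley graph with respect to a finite generating set (independent of that set); the number of ends of a connected graph is the supremum, over compact subsets $K$, of the number of unbounded connected components of the complement of $K$. *)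

theory Defs
  imports
    "HOL-Complex_Analysis.Complex_Analysis"
    "HOL-Algebra.Generated_Groups"
begin

section \<open>The circle\<close>

quotient_type circle = real / "\<lambda>x y. x - y \<in> \<int>"
proof (rule equivpI)
  show "reflp (\<lambda>x y::real. x - y \<in> \<int>)" by (rule reflpI) simp
  show "symp (\<lambda>x y::real. x - y \<in> \<int>)"
    by (rule sympI) (metis Ints_minus minus_diff_eq)
  show "transp (\<lambda>x y::real. x - y \<in> \<int>)"
    by (rule transpI) (metis Ints_add add_diff_eq diff_add_cancel)
qed

definition proj :: "real \<Rightarrow> circle"
  where "proj = abs_circle"

lemma proj_eq_iff: "proj x = proj y \<longleftrightarrow> x - y \<in> \<int>"
  by (simp add: proj_def circle.abs_eq_iff)

lemma proj_surj: "\<exists>t. proj t = x"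
  unfolding proj_def by (rule exI[of _ "rep_circle x"], rule Quotient_abs_rep[OF Quotient_circle])

instantiation circle :: topological_space
begin

definition open_circle :: "circle set \<Rightarrow> bool"
  where "open_circle U \<longleftrightarrow> open (proj -` U)"

instance
proof
  show "open (UNIV :: circle set)" by (simp add: open_circle_def)
next
  fix S T :: "circle set" assume "open S" "open T"
  then show "open (S \<inter> T)" by (simp add: open_circle_def open_Int)
next
  fix K :: "circle set set" assume "\<forall>S\<in>K. open S"
  then show "open (\<Union>K)" by (auto simp: open_circle_def vimage_Union)
qed

end

section \<open>Real-analytic diffeomorphisms of the circle\<close>

definition real_analytic :: "(real \<Rightarrow> real) \<Rightarrow> bool"
  where "real_analytic f \<longleftrightarrow> (\<forall>x. \<exists>A. (\<lambda>h. f (x + h)) has_fps_expansion A)"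

definition circle_lift :: "(real \<Rightarrow> real) \<Rightarrow> (circle \<Rightarrow> circle) \<Rightarrow> bool"
  where "circle_lift F g \<longleftrightarrow> continuous_on UNIV F \<and> (\<forall>t. proj (F t) = g (proj t))"

definition circle_analytic :: "(circle \<Rightarrow> circle) \<Rightarrow> bool"
  where "circle_analytic g \<longleftrightarrow> (\<exists>F. circle_lift F g \<and> real_analytic F)"

definition orientation_preserving :: "(circle \<Rightarrow> circle) \<Rightarrow> bool"
  where "orientation_preserving g \<longleftrightarrow> (\<exists>F. circle_lift F g \<and> strict_mono F)"

definition Diff_omega :: "(circle \<Rightarrow> circle) monoid"
  where "Diff_omega =
    \<lparr>carrier = {g. bij g \<and> circle_analytic g \<and> circle_analytic (inv_into UNIV g)
                   \<and> orientation_preserving g},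
     mult = (\<circ>), one = id\<rparr>"

text \<open>The derivative is read off from an arbitrary lift at an arbitrary preimage of the point;
  \<open>circle_deriv_eq\<close> below shows that the choice does not matter.\<close>

definition circle_deriv :: "(circle \<Rightarrow> circle) \<Rightarrow> circle \<Rightarrow> real"
  where "circle_deriv g x =
    (THE d. \<exists>F t. circle_lift F g \<and> proj t = x \<and> (F has_real_derivative d) (at t))"

lemma circle_lift_diff_const:
  assumes "circle_lift F g" "circle_lift H g"
  shows "\<exists>c\<in>\<int>. \<forall>t. H t = F t + c"
proof -
  have int: "H t - F t \<in> \<int>" for t
    using assms by (simp add: circle_lift_def flip: proj_eq_iff)
  have "(\<lambda>t. H t - F t) constant_on UNIV"
  proof (rule continuous_discrete_range_constant)
    show "connected (UNIV :: real set)" by simp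
    show "continuous_on UNIV (\<lambda>t. H t - F t)"
      using assms unfolding circle_lift_def by (intro continuous_on_diff) auto
    fix x :: real
    have "1 \<le> norm ((H y - F y) - (H x - F x))" if "H y - F y \<noteq> H x - F x" for y
    proof -
      have "(H y - F y) - (H x - F x) \<in> \<int>" by (intro Ints_diff[OF int int])
      then show ?thesis using that Ints_nonzero_abs_ge1[of "(H y - F y) - (H x - F x)"] by simp
    qed
    then show "\<exists>e>0. \<forall>y. y \<in> UNIV \<and> H y - F y \<noteq> H x - F x
        \<longrightarrow> e \<le> norm ((H y - F y) - (H x - F x))"
      by (intro exI[of _ 1]) simp
  qed
  then obtain c where "\<And>t. H t - F t = c" unfolding constant_on_def by blast
  moreover from this have "c \<in> \<int>" using int[of 0] by simp
  ultimately show ?thesis by (intro bexI[of _ c]) (simp_all add: diff_eq_eq add.commute)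
qed

lemma circle_lift_shift:
  assumes "circle_lift F g" "c \<in> \<int>"
  shows "circle_lift (\<lambda>t. F (t + c)) g"
  unfolding circle_lift_def
proof (intro conjI allI)
  show "continuous_on UNIV (\<lambda>t. F (t + c))"
    using assms(1) unfolding circle_lift_def
    by (intro continuous_on_compose2[of UNIV F UNIV "\<lambda>t. t + c"] continuous_on_add
        continuous_on_id continuous_on_const) simp_all
  have "proj (t + c) = proj t" for t using assms(2) by (simp add: proj_eq_iff)
  then show "proj (F (t + c)) = g (proj t)" for t
    using assms(1) by (simp add: circle_lift_def)
qed

lemma circle_deriv_eq:
  assumes "circle_lift F g" "(F has_real_derivative d) (at t)"
  shows "circle_deriv g (proj t) = d"
  unfolding circle_deriv_def
proof (rule the_equality)
  show "\<exists>F s. circle_lift F g \<and> proj s = proj t \<and> (F has_real_derivative d) (at s)"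
    using assms by blast
  fix e assume "\<exists>F s. circle_lift F g \<and> proj s = proj t \<and> (F has_real_derivative e) (at s)"
  then obtain H s where H: "circle_lift H g" "proj s = proj t" "(H has_real_derivative e) (at s)"
    by blast
  define c where "c = s - t"
  have c: "c \<in> \<int>" "s = t + c" using H(2) by (simp_all add: proj_eq_iff c_def)
  obtain b where b: "\<And>u. H (u + c) = F u + b"
    using circle_lift_diff_const[OF assms(1) circle_lift_shift[OF H(1) c(1)]] by blast
  have "((\<lambda>u. H (u + c)) has_real_derivative e) (at t)"
    using H(3) unfolding c(2) DERIV_shift .
  moreover have "((\<lambda>u. H (u + c)) has_real_derivative d) (at t)"
    unfolding b using DERIV_add[OF assms(2) DERIV_const[of b]] by simp
  ultimately show "e = d" by (rule DERIV_unique)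
qed

lemma real_analyticD_complex:
  assumes "(\<lambda>h. f (x + h)) has_fps_expansion (A :: real fps)"
  shows "\<exists>k. k analytic_on {0} \<and> (\<forall>\<^sub>F h in nhds 0. k (of_real h) = (of_real (f (x + h)) :: complex))"
proof -
  define B :: "complex fps" where "B = Abs_fps (\<lambda>n. of_real (fps_nth A n))"
  have cr: "fps_conv_radius B = fps_conv_radius A"
    by (simp add: fps_conv_radius_def B_def conv_radius_def)
  have pos: "fps_conv_radius B > 0" using assms cr by (simp add: has_fps_expansion_def)
  have "eval_fps B has_fps_expansion B" using pos by (rule eval_fps_has_fps_expansion)
  then have an: "eval_fps B analytic_on {0}" by (rule has_fps_expansion_imp_analytic_0)
  have "\<forall>\<^sub>F h in nhds (0::real). h \<in> eball 0 (fps_conv_radius A)"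
    using pos cr by (intro eventually_nhds_in_open) (auto simp: zero_ereal_def)
  moreover have "\<forall>\<^sub>F h in nhds 0. eval_fps A h = f (x + h)"
    using assms by (simp add: has_fps_expansion_def)
  ultimately have "\<forall>\<^sub>F h in nhds 0. eval_fps B (of_real h) = of_real (f (x + h))"
  proof eventually_elim
    case (elim h)
    have "(\<lambda>n. fps_nth A n * h ^ n) sums eval_fps A h"
      using elim(1) by (intro sums_eval_fps) (auto simp: eball_def)
    then have "(\<lambda>n. of_real (fps_nth A n * h ^ n) :: complex) sums of_real (eval_fps A h)"
      by (rule sums_of_real)
    then have "eval_fps B (of_real h) = of_real (eval_fps A h)"
      by (simp add: eval_fps_def B_def sums_iff)
    then show ?case using elim(2) by simp
  qed
  with an show ?thesis by blast
qed

lemma complex_analytic_imp_real_fps: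
  assumes "k analytic_on {0}" "\<forall>\<^sub>F h in nhds 0. k (of_real h) = (of_real (f h) :: complex)"
  shows "\<exists>A. f has_fps_expansion A"
proof -
  obtain B where B: "k has_fps_expansion B"
    using assms(1) analytic_at_imp_has_fps_expansion_0 by blast
  define A where "A = Abs_fps (\<lambda>n. Re (fps_nth B n))"
  have "fps_conv_radius A \<ge> fps_conv_radius B"
    unfolding fps_conv_radius_def
  proof (rule conv_radius_geI_ex')
    fix r :: real assume "0 < r" "ereal r < conv_radius (fps_nth B)"
    then have "summable (\<lambda>n. fps_nth B n * of_real r ^ n)"
      by (intro summable_in_conv_radius) simp
    then show "summable (\<lambda>n. fps_nth A n * of_real r ^ n)"
      by (rule summable_Re[THEN back_subst[of summable]])
        (simp add: A_def flip: of_real_power)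
  qed
  then have pos: "fps_conv_radius A > 0" using B by (auto simp: has_fps_expansion_def)
  have "\<forall>\<^sub>F h in nhds (0::real). h \<in> eball 0 (fps_conv_radius B)"
    using B by (intro eventually_nhds_in_open) (auto simp: zero_ereal_def has_fps_expansion_def)
  moreover have "\<forall>\<^sub>F z in nhds 0. eval_fps B z = k z"
    using B by (simp add: has_fps_expansion_def)
  then have "\<forall>\<^sub>F h in nhds 0. eval_fps B (of_real h) = k (of_real h)"
    by (rule eventually_compose_filterlim) (auto intro!: tendsto_eq_intros filterlim_ident)
  moreover note assms(2)
  ultimately have "\<forall>\<^sub>F h in nhds 0. eval_fps A h = f h"
  proof eventually_elim
    case (elim h)
    have "(\<lambda>n. fps_nth B n * of_real h ^ n) sums eval_fps B (of_real h)"
      using elim(1) by (intro sums_eval_fps) (auto simp: eball_def)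
    then have "(\<lambda>n. Re (fps_nth B n * of_real h ^ n)) sums Re (eval_fps B (of_real h))"
      by (rule sums_Re)
    also have "(\<lambda>n. Re (fps_nth B n * of_real h ^ n)) = (\<lambda>n. fps_nth A n * h ^ n)"
      by (auto simp: A_def simp flip: of_real_power)
    finally show ?case using elim(2,3) by (simp add: eval_fps_def sums_iff)
  qed
  then show ?thesis using pos by (auto simp: has_fps_expansion_def)
qed

lemma real_analytic_compose:
  assumes "real_analytic f" "real_analytic g"
  shows "real_analytic (f \<circ> g)"
  unfolding real_analytic_def
proof
  fix x
  obtain A where A: "(\<lambda>h. g (x + h)) has_fps_expansion A"
    using assms(2) unfolding real_analytic_def by blast
  obtain k where k: "k analytic_on {0}"
      "\<forall>\<^sub>F h in nhds 0. k (of_real h) = (of_real (g (x + h)) :: complex)"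
    using real_analyticD_complex A by blast
  obtain l where l: "l analytic_on {0}"
      "\<forall>\<^sub>F h in nhds 0. l (of_real h) = (of_real (f (g x + h)) :: complex)"
    using real_analyticD_complex assms(1) unfolding real_analytic_def by blast
  have k0: "k 0 = of_real (g x)" using eventually_nhds_x_imp_x[OF k(2)] by simp
  define m where "m = l \<circ> (\<lambda>z. k z - of_real (g x))"
  have "m analytic_on {0}" unfolding m_def
    by (rule analytic_on_compose) (auto intro!: analytic_intros k l simp: k0)
  moreover have "isCont (\<lambda>h. g (x + h)) 0"
    using has_fps_expansion_imp_continuous[OF A] by simp
  then have "((\<lambda>h. g (x + h) - g x) \<longlongrightarrow> 0) (nhds 0)"
    using tendsto_at_iff_tendsto_nhds[of "\<lambda>h. g (x + h) - g x" 0]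
    by (simp add: isCont_def LIM_zero_iff)
  then have "\<forall>\<^sub>F h in nhds 0. l (of_real (g (x + h) - g x)) = of_real (f (g x + (g (x + h) - g x)))"
    by (rule eventually_compose_filterlim[OF l(2)])
  with k(2) have "\<forall>\<^sub>F h in nhds 0. m (of_real h) = of_real (f (g (x + h)))"
    by eventually_elim (simp add: m_def)
  ultimately show "\<exists>A. (\<lambda>h. (f \<circ> g) (x + h)) has_fps_expansion A"
    using complex_analytic_imp_real_fps[of m "\<lambda>h. f (g (x + h))"] by (simp add: o_def)
qed

lemma real_analytic_ident: "real_analytic (\<lambda>x. x)"
  unfolding real_analytic_def
  using has_fps_expansion_add[OF has_fps_expansion_const has_fps_expansion_fps_X] by blast

lemma circle_lift_compose:
  "circle_lift F f \<Longrightarrow> circle_lift H h \<Longrightarrow> circle_lift (F \<circ> H) (f \<circ> h)"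
  unfolding circle_lift_def by (simp add: continuous_on_compose2[of UNIV F UNIV H])

lemma circle_lift_id: "circle_lift (\<lambda>x. x) id"
  by (simp add: circle_lift_def)

lemma orientation_preserving_inv:
  assumes "bij g" "orientation_preserving g" "circle_analytic (inv_into UNIV g)"
  shows "orientation_preserving (inv_into UNIV g)"
proof -
  obtain F where F: "circle_lift F g" "strict_mono F"
    using assms(2) by (auto simp: orientation_preserving_def)
  obtain H where H: "circle_lift H (inv_into UNIV g)"
    using assms(3) by (auto simp: circle_analytic_def)
  have "circle_lift (F \<circ> H) id"
    using circle_lift_compose[OF F(1) H] surj_iff[THEN iffD1, OF bij_is_surj[OF assms(1)]] by simp
  then obtain c where c: "\<And>t. F (H t) = t + c"
    using circle_lift_diff_const[OF circle_lift_id] by fastforce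
  have "strict_mono H"
    by (rule strict_monoI, subst strict_mono_less[OF F(2), symmetric]) (simp add: c)
  with H show ?thesis by (auto simp: orientation_preserving_def)
qed

lemma circle_analytic_compose:
  "circle_analytic f \<Longrightarrow> circle_analytic g \<Longrightarrow> circle_analytic (f \<circ> g)"
  unfolding circle_analytic_def by (meson circle_lift_compose real_analytic_compose)

lemma orientation_preserving_compose:
  "orientation_preserving f \<Longrightarrow> orientation_preserving g \<Longrightarrow> orientation_preserving (f \<circ> g)"
  unfolding orientation_preserving_def by (meson circle_lift_compose strict_mono_o)

lemma group_Diff_omega: "group Diff_omega"
proof (rule groupI)
  have "circle_analytic id" "orientation_preserving id"
    unfolding circle_analytic_def orientation_preserving_def
    using circle_lift_id real_analytic_ident by (auto simp: strict_mono_def)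
  then show "\<one>\<^bsub>Diff_omega\<^esub> \<in> carrier Diff_omega"
    by (simp add: Diff_omega_def inv_id[unfolded id_def[symmetric]])
next
  fix f g assume "f \<in> carrier Diff_omega" "g \<in> carrier Diff_omega"
  then show "f \<otimes>\<^bsub>Diff_omega\<^esub> g \<in> carrier Diff_omega"
    by (auto simp: Diff_omega_def bij_comp o_inv_distrib circle_analytic_compose
        orientation_preserving_compose)
next
  fix f assume "f \<in> carrier Diff_omega"
  then show "\<exists>g\<in>carrier Diff_omega. g \<otimes>\<^bsub>Diff_omega\<^esub> f = \<one>\<^bsub>Diff_omega\<^esub>"
    by (intro bexI[of _ "inv_into UNIV f"])
      (auto simp: Diff_omega_def bij_imp_bij_inv inv_inv_eq orientation_preserving_inv bij_is_inj)
qed (auto simp: Diff_omega_def)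

section \<open>Groups acting on the circle\<close>

definition orbit :: "(circle \<Rightarrow> circle) set \<Rightarrow> circle \<Rightarrow> circle set"
  where "orbit G x = (\<lambda>g. g x) ` G"

definition minimal_action :: "(circle \<Rightarrow> circle) set \<Rightarrow> bool"
  where "minimal_action G \<longleftrightarrow> (\<forall>x. closure (orbit G x) = UNIV)"

definition NE :: "(circle \<Rightarrow> circle) set \<Rightarrow> circle set"
  where "NE G = {x. \<forall>g\<in>G. circle_deriv g x \<le> 1}"

definition invariant :: "(circle \<Rightarrow> circle) set \<Rightarrow> circle set \<Rightarrow> bool"
  where "invariant G A \<longleftrightarrow> (\<forall>g\<in>G. g ` A \<subseteq> A)"

definition minimal_set :: "(circle \<Rightarrow> circle) set \<Rightarrow> circle set \<Rightarrow> bool"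
  where "minimal_set G \<Lambda> \<longleftrightarrow> closed \<Lambda> \<and> \<Lambda> \<noteq> {} \<and> invariant G \<Lambda> \<and>
    (\<forall>A. closed A \<and> A \<noteq> {} \<and> invariant G A \<and> A \<subseteq> \<Lambda> \<longrightarrow> A = \<Lambda>)"

text \<open>Only meant for groups without finite orbits; these have exactly one minimal set.
  For a minimal action it is the whole circle, see \<open>minimal_set_eq_UNIV\<close>.\<close>

definition property_star :: "(circle \<Rightarrow> circle) set \<Rightarrow> bool"
  where "property_star G \<longleftrightarrow>
    (\<forall>\<Lambda>. minimal_set G \<Lambda> \<longrightarrow> (\<forall>x\<in>NE G \<inter> \<Lambda>. \<exists>g\<in>G - {id}. g x = x))"

lemma minimal_set_eq_UNIV:
  assumes "minimal_action G"
  shows "minimal_set G \<Lambda> \<longleftrightarrow> \<Lambda> = UNIV"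
proof -
  have *: "A = UNIV" if "closed A" "A \<noteq> {}" "invariant G A" for A
  proof -
    obtain a where "a \<in> A" using \<open>A \<noteq> {}\<close> by blast
    then have "orbit G a \<subseteq> A" using that(3) by (auto simp: orbit_def invariant_def)
    then have "closure (orbit G a) \<subseteq> A" using that(1) by (rule closure_minimal)
    then show ?thesis using assms by (auto simp: minimal_action_def)
  qed
  have "minimal_set G UNIV"
    unfolding minimal_set_def using * by (simp add: invariant_def[of G UNIV])
  moreover have "\<Lambda> = UNIV" if "minimal_set G \<Lambda>"
    using that *[of \<Lambda>] by (simp add: minimal_set_def)
  ultimately show ?thesis by metis
qed

section \<open>Ends of graphs and groups\<close>

text \<open>A graph is given by a vertex set \<open>V\<close> and a relation \<open>E\<close>; orientations, loops and multiplicities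
  of edges are irrelevant. A point of its geometric realization is represented by its barycentric
  coordinates, a function on the vertices. The realization carries the subspace topology of the
  product topology on functions into the reals; on locally finite graphs, such as
  Cayley graphs of finite generating sets, this is the usual (CW and path metric) topology.\<close>

definition vertex_point :: "'a \<Rightarrow> 'a \<Rightarrow> real"
  where "vertex_point v = (\<lambda>w. if w = v then 1 else 0)"

definition edge_points :: "'a \<Rightarrow> 'a \<Rightarrow> ('a \<Rightarrow> real) set"
  where "edge_points u v =
    {\<lambda>w. (1 - t) * vertex_point u w + t * vertex_point v w | t. 0 \<le> t \<and> t \<le> 1}"

definition realization :: "'a set \<Rightarrow> ('a \<times> 'a) set \<Rightarrow> ('a \<Rightarrow> real) set"
  where "realization V E = vertex_point ` V \<union> (\<Union>(u, v)\<in>E. edge_points u v)"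

text \<open>A set of points is bounded iff the vertices of the edges it meets lie within some fixed
  combinatorial distance of a base vertex, i.e. iff it is bounded for the path metric.\<close>

definition graph_bounded :: "'a set \<Rightarrow> ('a \<times> 'a) set \<Rightarrow> ('a \<Rightarrow> real) set \<Rightarrow> bool"
  where "graph_bounded V E C \<longleftrightarrow>
    (\<exists>v\<in>V. \<exists>n::nat. \<forall>p\<in>C. \<forall>w. p w \<noteq> 0 \<longrightarrow> (\<exists>k\<le>n. (v, w) \<in> (E \<union> E\<inverse>) ^^ k))"

definition unbounded_components ::
    "'a set \<Rightarrow> ('a \<times> 'a) set \<Rightarrow> ('a \<Rightarrow> real) set \<Rightarrow> ('a \<Rightarrow> real) set set"
  where "unbounded_components V E K =
    {C \<in> components (realization V E - K). \<not> graph_bounded V E C}"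

definition ecard :: "'a set \<Rightarrow> enat"
  where "ecard A = (if finite A then enat (card A) else \<infinity>)"

definition graph_ends :: "'a set \<Rightarrow> ('a \<times> 'a) set \<Rightarrow> enat"
  where "graph_ends V E =
    (SUP K\<in>{K. compact K \<and> K \<subseteq> realization V E}. ecard (unbounded_components V E K))"

definition cayley_edges :: "('a, 'b) monoid_scheme \<Rightarrow> 'a set \<Rightarrow> ('a \<times> 'a) set"
  where "cayley_edges \<Gamma> S = {(g, g \<otimes>\<^bsub>\<Gamma>\<^esub> s) | g s. g \<in> carrier \<Gamma> \<and> s \<in> S}"

definition finite_generating_set :: "('a, 'b) monoid_scheme \<Rightarrow> 'a set \<Rightarrow> bool"
  where "finite_generating_set \<Gamma> S \<longleftrightarrow>
    finite S \<and> S \<subseteq> carrier \<Gamma> \<and> generate \<Gamma> S = carrier \<Gamma>"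

definition finitely_generated :: "('a, 'b) monoid_scheme \<Rightarrow> bool"
  where "finitely_generated \<Gamma> \<longleftrightarrow> (\<exists>S. finite_generating_set \<Gamma> S)"

text \<open>The number of ends of a finitely generated group does not depend on the generating set.
  Quantifying over all of them avoids both a choice and a proof of that invariance.\<close>

definition has_number_of_ends :: "('a, 'b) monoid_scheme \<Rightarrow> enat \<Rightarrow> bool"
  where "has_number_of_ends \<Gamma> n \<longleftrightarrow> finitely_generated \<Gamma> \<and>
    (\<forall>S. finite_generating_set \<Gamma> S \<longrightarrow> graph_ends (carrier \<Gamma>) (cayley_edges \<Gamma> S) = n)"

end

theory Submission
  imports Defs
begin

text \<open>Lift \<open>G\<close> to a group \<open>L\<close> of diffeomorphisms of the line, let \<open>t0\<close> be a lift of the non-expandable point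
  and \<open>X\<close> its orbit. As derivatives of stabilizing elements at \<open>t0\<close> are \<open>1\<close>, the function
  \<open>phi (F t0) = F' (t0) \<le> 1\<close> is well defined on \<open>X\<close>. Property \<open>(\<star>)\<close> and compactness give an expansion
  procedure that ends at non-expandable points with bounded distortion; together with the parabolic germ fixing
  \<open>t0\<close> it shows that the points of \<open>X\<close> are separated like rational numbers:
  \<open>c * phi y * phi z \<le> (y - z)\<^sup>2\<close> (disjointness of Ford circles).

  Choose \<open>t1 \<in> X\<close> close to \<open>t0\<close> such that only the identity fixes both points. The two-point Schwarzian
  \<open>schwarz F t0 t1\<close> is a cocycle which changes by \<open>O((F t1 - F t0)\<^sup>2)\<close> when \<open>F\<close> is multiplied on the left
  by a generator. Where it is bounded below, \<open>(F t1 - F t0)\<^sup>2\<close> is comparable to \<open>phi (F t0) * phi (F t1)\<close>,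
  which by the separation property is summable over \<open>L\<close> modulo integer translations. So for almost every \<open>t\<close>
  the set \<open>A = {F. t < schwarz F t0 t1}\<close> has finite boundary in the Cayley graph. For \<open>t\<close> small enough every coset of
  the stabilizer of \<open>t0\<close> meets \<open>A\<close>, but multiplying on the right by high powers of a stabilizing element \<open>E\<close>
  that pushes \<open>t1\<close> away from \<open>t0\<close> leaves \<open>A\<close>. Hence the right translates of \<open>A\<close> by powers of \<open>E\<close> pairwise
  differ by infinite sets, which is impossible with finitely many ends.\<close>

section \<open>Real-analytic functions\<close>

text \<open>The model is the modular group, where \<open>phi\<close> at a rational p/q corresponds
  to 1/q^2 and the separation property to |p/q - p'/q'| >= 1/(q q') for distinct rationals. The
  obstacle is that the squared lengths \<open>(F t1 - F t0)^2\<close> are not summable over all of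
  \<open>L\<close> modulo translations: the powers of \<open>E\<close> fix \<open>t0\<close> and
  push \<open>t1\<close> away, so on them the length stays bounded below. Summability can only be
  hoped for where the cocycle is bounded below. This is enough, because both ends of an edge that
  crosses a fixed level lie in such a region. The sum over group elements has to become a sum over
  pairs of orbit points, hence the need for a pair \<open>t0\<close>, \<open>t1\<close> with trivial
  stabilizer. It comes from a stabilizing element with the highest possible order of contact with
  the identity: commutators have higher contact, so this element commutes with the whole stabilizer
  of \<open>t0\<close>. That a highest order exists is again a consequence of the separation
  property.\<close>

lemma real_analytic_fps: "real_analytic f \<Longrightarrow> \<exists>A. (\<lambda>h. f (x + h)) has_fps_expansion A"
  by (simp add: real_analytic_def)

lemma deriv_shift: "deriv (\<lambda>h. f (x + h)) = (\<lambda>h. deriv f (x + h :: real))"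
  unfolding deriv_def using DERIV_shift[of f _ _ x] by (intro ext) (simp add: add.commute)

lemma real_analytic_deriv:
  assumes "real_analytic f"
  shows "(f has_real_derivative deriv f x) (at x)" and "real_analytic (deriv f)"
proof -
  have *: "(f has_real_derivative deriv f x) (at x) \<and> (\<exists>A. (\<lambda>h. deriv f (x + h)) has_fps_expansion A)" for x
  proof -
    obtain A where A: "(\<lambda>h. f (x + h)) has_fps_expansion A"
      using assms real_analytic_fps by blast
    then have r: "fps_conv_radius A > 0" and ev: "\<forall>\<^sub>F h in nhds 0. eval_fps A h = f (x + h)"
      by (auto simp: has_fps_expansion_def)
    have "(eval_fps A has_real_derivative eval_fps (fps_deriv A) 0) (at 0)"
      using r by (intro has_field_derivative_eval_fps) (auto simp: zero_ereal_def)
    then have "((\<lambda>h. f (x + h)) has_real_derivative eval_fps (fps_deriv A) 0) (at 0)"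
      using DERIV_cong_ev[OF refl ev refl] by simp
    then have d: "(f has_real_derivative eval_fps (fps_deriv A) 0) (at x)"
      using DERIV_shift[of f _ 0 x] by (simp add: add.commute)
    have "(\<lambda>h. deriv f (x + h)) has_fps_expansion fps_deriv A"
      using has_fps_expansion_deriv[OF A] by (simp add: deriv_shift)
    then show ?thesis using d DERIV_imp_deriv by metis
  qed
  show "(f has_real_derivative deriv f x) (at x)" using * by blast
  show "real_analytic (deriv f)" unfolding real_analytic_def using * by blast
qed

lemma real_analytic_diff:
  assumes "real_analytic f" "real_analytic g"
  shows "real_analytic (\<lambda>x. f x - g x)"
  unfolding real_analytic_def
proof
  fix x
  obtain A B where "(\<lambda>h. f (x + h)) has_fps_expansion A" "(\<lambda>h. g (x + h)) has_fps_expansion B"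
    using assms real_analytic_fps by blast
  then show "\<exists>A. (\<lambda>h. f (x + h) - g (x + h)) has_fps_expansion A"
    using has_fps_expansion_diff by blast
qed

text \<open>Cancelling \<open>h ^ k\<close> leaves a convergent series, whose sum is the cofactor
  \<open>w\<close>. The coefficient at \<open>k\<close> may vanish, so the same \<open>k\<close>
  serves for a function and for \<open>h\<close> times its derivative.\<close>

lemma fps_expansion_factor:
  fixes A :: "real fps"
  assumes g: "g has_fps_expansion A" and k: "\<And>n. n < k \<Longrightarrow> fps_nth A n = 0"
  shows "\<exists>w. isCont w 0 \<and> w 0 = fps_nth A k \<and> (\<forall>\<^sub>F h in nhds 0. g h = h ^ k * w h)"
proof (intro exI conjI)
  let ?w = "eval_fps (fps_shift k A)"
  have r: "fps_conv_radius A > 0" and ev: "\<forall>\<^sub>F h in nhds 0. eval_fps A h = g h"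
    using g by (auto simp: has_fps_expansion_def)
  have A: "fps_shift k A * fps_X ^ k = A"
    by (rule fps_ext) (simp add: fps_X_power_mult_right_nth k)
  show "isCont ?w 0" using r by (intro continuous_eval_fps) (auto simp: zero_ereal_def)
  show "?w 0 = fps_nth A k" by (simp add: eval_fps_at_0)
  have "\<forall>\<^sub>F h in nhds (0::real). h \<in> eball 0 (fps_conv_radius A)"
    using r by (intro eventually_nhds_in_open) (auto simp: zero_ereal_def)
  with ev show "\<forall>\<^sub>F h in nhds 0. g h = h ^ k * ?w h"
  proof eventually_elim
    case (elim h)
    have "eval_fps (fps_shift k A * fps_X ^ k) h = ?w h * h ^ k"
      using elim by (subst eval_fps_mult) auto
    then show ?case using elim A by simp
  qed
qed

text \<open>\<open>k\<close> is the order of vanishing at \<open>x\<close>, the subdegree of the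
  expansion. The derivative is bounded after multiplication by the distance to \<open>x\<close>,
  because \<open>h\<close> times the derivative vanishes at least to order \<open>k\<close>; this
  avoids an exponent \<open>k - 1\<close>, which makes no sense for \<open>k = 0\<close>.\<close>

lemma real_analytic_order:
  assumes f: "real_analytic f" and nz: "\<not> (\<forall>\<^sub>F h in nhds 0. f (x + h) = 0)"
  obtains k a b e where "0 < a" "0 < b" "0 < e"
    "\<And>y. \<bar>y - x\<bar> < e \<Longrightarrow> a * \<bar>y - x\<bar> ^ k \<le> \<bar>f y\<bar>"
    "\<And>y. \<bar>y - x\<bar> < e \<Longrightarrow> \<bar>f y\<bar> \<le> b * \<bar>y - x\<bar> ^ k"
    "\<And>y. \<bar>y - x\<bar> < e \<Longrightarrow> \<bar>y - x\<bar> * \<bar>deriv f y\<bar> \<le> b * \<bar>y - x\<bar> ^ k"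
proof -
  obtain A where A: "(\<lambda>h. f (x + h)) has_fps_expansion A" using f real_analytic_fps by blast
  have "A \<noteq> 0" using A nz has_fps_expansion_0_iff[of "\<lambda>h. f (x + h)"] by auto
  define k where "k = subdegree A"
  have low: "fps_nth A n = 0" if "n < k" for n using that unfolding k_def by (rule nth_less_subdegree_zero)
  have "\<exists>w. isCont w 0 \<and> w 0 = fps_nth A k \<and> (\<forall>\<^sub>F h in nhds 0. f (x + h) = h ^ k * w h)"
    using A low by (rule fps_expansion_factor)
  then obtain w where w: "isCont w 0" "w 0 = fps_nth A k" "\<forall>\<^sub>F h in nhds 0. f (x + h) = h ^ k * w h"
    by (elim exE conjE)
  have "(\<lambda>h. h * deriv f (x + h)) has_fps_expansion fps_X * fps_deriv A"
    using has_fps_expansion_mult[OF has_fps_expansion_fps_X has_fps_expansion_deriv[OF A]] by (simp add: deriv_shift)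
  moreover have "fps_nth (fps_X * fps_deriv A) n = 0" if "n < k" for n
    using low[OF that] by (cases n) auto
  ultimately have "\<exists>v. isCont v 0 \<and> v 0 = fps_nth (fps_X * fps_deriv A) k \<and>
      (\<forall>\<^sub>F h in nhds 0. h * deriv f (x + h) = h ^ k * v h)"
    by (rule fps_expansion_factor)
  then obtain v where v: "isCont v 0" "\<forall>\<^sub>F h in nhds 0. h * deriv f (x + h) = h ^ k * v h"
    by (elim exE conjE)
  define W where "W = \<bar>w 0\<bar>"
  have W: "W > 0" using \<open>A \<noteq> 0\<close> by (simp add: W_def w(2) k_def)
  define b where "b = max (W + 1) (\<bar>v 0\<bar> + 1)"
  have lim: "((\<lambda>h. \<bar>w h\<bar>) \<longlongrightarrow> W) (nhds 0)" "((\<lambda>h. \<bar>v h\<bar>) \<longlongrightarrow> \<bar>v 0\<bar>) (nhds 0)"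
    unfolding W_def using w(1) v(1) by (auto simp: isCont_def tendsto_at_iff_tendsto_nhds intro!: tendsto_rabs)
  have 1: "\<forall>\<^sub>F h in nhds 0. W / 2 < \<bar>w h\<bar>" by (rule order_tendstoD(1)[OF lim(1)]) (use W in simp)
  have 2: "\<forall>\<^sub>F h in nhds 0. \<bar>w h\<bar> < b" by (rule order_tendstoD(2)[OF lim(1)]) (simp add: b_def)
  have 3: "\<forall>\<^sub>F h in nhds 0. \<bar>v h\<bar> < b" by (rule order_tendstoD(2)[OF lim(2)]) (simp add: b_def)
  have "\<forall>\<^sub>F h in nhds 0. W / 2 * \<bar>h\<bar> ^ k \<le> \<bar>f (x + h)\<bar> \<and> \<bar>f (x + h)\<bar> \<le> b * \<bar>h\<bar> ^ k \<and>
     \<bar>h\<bar> * \<bar>deriv f (x + h)\<bar> \<le> b * \<bar>h\<bar> ^ k"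
    using w(3) v(2) 1 2 3
  proof eventually_elim
    case (elim h)
    have "\<bar>f (x + h)\<bar> = \<bar>w h\<bar> * \<bar>h\<bar> ^ k" using elim(1) by (simp add: abs_mult power_abs)
    moreover have "\<bar>h\<bar> * \<bar>deriv f (x + h)\<bar> = \<bar>v h\<bar> * \<bar>h\<bar> ^ k"
      using arg_cong[OF elim(2), of abs] by (simp add: abs_mult power_abs)
    moreover have "W / 2 * \<bar>h\<bar> ^ k \<le> \<bar>w h\<bar> * \<bar>h\<bar> ^ k" "\<bar>w h\<bar> * \<bar>h\<bar> ^ k \<le> b * \<bar>h\<bar> ^ k" "\<bar>v h\<bar> * \<bar>h\<bar> ^ k \<le> b * \<bar>h\<bar> ^ k"
      using elim by (intro mult_right_mono; simp)+
    ultimately show ?case by simp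
  qed
  then obtain e where "e > 0" and e: "\<And>h. \<bar>h\<bar> < e \<Longrightarrow> W / 2 * \<bar>h\<bar> ^ k \<le> \<bar>f (x + h)\<bar> \<and> \<bar>f (x + h)\<bar> \<le> b * \<bar>h\<bar> ^ k \<and>
     \<bar>h\<bar> * \<bar>deriv f (x + h)\<bar> \<le> b * \<bar>h\<bar> ^ k"
    unfolding eventually_nhds_metric dist_real_def by auto
  have "W / 2 * \<bar>y - x\<bar> ^ k \<le> \<bar>f y\<bar> \<and> \<bar>f y\<bar> \<le> b * \<bar>y - x\<bar> ^ k \<and> \<bar>y - x\<bar> * \<bar>deriv f y\<bar> \<le> b * \<bar>y - x\<bar> ^ k"
    if "\<bar>y - x\<bar> < e" for y using e[OF that] by simp
  moreover have "0 < b" using W by (simp add: b_def)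
  ultimately show thesis using that[of "W / 2" b e k] W \<open>e > 0\<close> by simp
qed

lemma real_analytic_isolated_zero:
  assumes "real_analytic f" "\<not> (\<forall>\<^sub>F h in nhds 0. f (x + h) = 0)"
  shows "\<exists>e>0. \<forall>y. y \<noteq> x \<and> \<bar>y - x\<bar> < e \<longrightarrow> f y \<noteq> 0"
proof (rule real_analytic_order[OF assms])
  fix k :: nat and a b e :: real
  assume a: "0 < a" "0 < e" "\<And>y. \<bar>y - x\<bar> < e \<Longrightarrow> a * \<bar>y - x\<bar> ^ k \<le> \<bar>f y\<bar>"
  have "f y \<noteq> 0" if "y \<noteq> x" "\<bar>y - x\<bar> < e" for y
  proof -
    have "0 < a * \<bar>y - x\<bar> ^ k" using a(1) that(1) by simp
    then show ?thesis using a(3)[OF that(2)] by auto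
  qed
  then show ?thesis using a(2) by blast
qed

text \<open>The set \<open>Z\<close> of points near which \<open>f\<close> vanishes identically is
  open by its form, and closed because the zeros near a point outside \<open>Z\<close> are isolated.
  Connectedness of the line does the rest.\<close>

lemma real_analytic_continuation:
  assumes f: "real_analytic f" and z: "\<forall>\<^sub>F h in nhds 0. f (x + h) = 0"
  shows "f y = 0"
proof -
  define Z where "Z = {x. \<forall>\<^sub>F h in nhds 0. f (x + h) = 0}"
  have Zalt: "Z = {x. \<forall>\<^sub>F y in nhds x. f y = 0}"
  proof -
    have "(\<forall>\<^sub>F h in nhds 0. f (x + h) = 0) \<longleftrightarrow> (\<forall>\<^sub>F y in nhds x. f y = 0)" for x
      using filtermap_nhds_shift[of x x, symmetric] by (simp add: eventually_filtermap)
    then show ?thesis by (simp add: Z_def)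
  qed
  have "open Z"
  proof (subst open_subopen, intro ballI)
    fix x assume "x \<in> Z"
    then have "\<forall>\<^sub>F y in nhds x. y \<in> Z" by (simp add: Zalt eventually_eventually)
    then show "\<exists>T. open T \<and> x \<in> T \<and> T \<subseteq> Z" by (auto simp: eventually_nhds)
  qed
  moreover have "closed Z"
    unfolding closed_limpt
  proof (intro allI impI)
    fix a assume a: "a islimpt Z"
    show "a \<in> Z"
    proof (rule ccontr)
      assume "a \<notin> Z"
      then obtain e where "e > 0" and e: "\<And>y. y \<noteq> a \<Longrightarrow> \<bar>y - a\<bar> < e \<Longrightarrow> f y \<noteq> 0"
        using real_analytic_isolated_zero[OF f, of a] by (auto simp: Z_def)
      obtain b where "b \<in> Z" "b \<noteq> a" "dist b a < e"
        using a \<open>e > 0\<close> by (auto simp: islimpt_approachable)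
      then have "f b \<noteq> 0" "f b = 0"
        using e[of b] eventually_nhds_x_imp_x[of "\<lambda>h. f (b + h) = 0" 0] by (auto simp: dist_real_def Z_def)
      then show False by simp
    qed
  qed
  moreover have "x \<in> Z" using z by (simp add: Z_def)
  ultimately have "Z = UNIV" using clopen by blast
  then have "y \<in> Z" by simp
  then show "f y = 0"
    using eventually_nhds_x_imp_x[of "\<lambda>h. f (y + h) = 0" 0] by (auto simp: Z_def)
qed

lemma real_analytic_continuous: "real_analytic f \<Longrightarrow> continuous_on A f"
  by (rule DERIV_continuous_on, rule has_field_derivative_at_within, erule real_analytic_deriv(1))



section \<open>Almost invariant sets and ends\<close>

lemma continuous_on_apply_const: "continuous_on A (\<lambda>p::'a \<Rightarrow> real. p w)"
  by (rule continuous_on_subset[OF continuous_on_product_coordinates subset_UNIV])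

lemma open_coord_neq: "open {p::'a \<Rightarrow> real. p w \<noteq> 0}"
  by (intro open_Collect_neq continuous_on_apply_const continuous_on_const)

lemma vertex_point_eq_iff [simp]: "vertex_point u = vertex_point v \<longleftrightarrow> u = v"
  by (metis vertex_point_def zero_neq_one)

lemma vertex_point_nonzero [simp]: "vertex_point u w \<noteq> 0 \<longleftrightarrow> w = u"
  by (simp add: vertex_point_def)

text \<open>The nonzero barycentric coordinates recover the vertex or the open edge that carries a
  point. Loops and the end parameters of an edge fall under the vertex case.\<close>

lemma realization_cases:
  assumes "p \<in> realization V E"
  obtains (vertex) w where "w \<in> V \<union> fst ` E \<union> snd ` E" "p = vertex_point w"
    | (edge) u v where "(u, v) \<in> E" "u \<noteq> v" "p u \<noteq> 0" "p v \<noteq> 0" "\<And>w. p w \<noteq> 0 \<Longrightarrow> w \<in> {u, v}"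
proof -
  consider "p \<in> vertex_point ` V" | u v where "(u, v) \<in> E" "p \<in> edge_points u v"
    using assms unfolding realization_def by blast
  then show thesis
  proof cases
    case 1
    then show ?thesis using vertex by blast
  next
    case 2
    then obtain t where p: "p = (\<lambda>w. (1 - t) * vertex_point u w + t * vertex_point v w)" and t: "0 \<le> t" "t \<le> 1"
      unfolding edge_points_def by blast
    have uv: "u \<in> V \<union> fst ` E \<union> snd ` E" "v \<in> V \<union> fst ` E \<union> snd ` E" using 2(1) by force+
    show ?thesis
    proof (cases "t = 0 \<or> t = 1 \<or> u = v")
      case True
      then have "p = vertex_point u \<or> p = vertex_point v" unfolding p by (auto simp: algebra_simps)
      then show ?thesis using vertex uv by blast
    next
      case False
      show ?thesis
        by (rule edge[OF 2(1)]) (use False in \<open>auto simp: p vertex_point_def split: if_splits\<close>)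
    qed
  qed
qed

lemma edge_points_connected: "connected (edge_points u v)"
proof -
  have "edge_points u v = (\<lambda>t w. (1 - t) * vertex_point u w + t * vertex_point v w) ` {0..1::real}"
    unfolding edge_points_def by auto
  moreover have "continuous_on {0..1::real} (\<lambda>t w. (1 - t) * vertex_point u w + t * vertex_point v w)"
    by (intro continuous_on_coordinatewise_then_product continuous_intros)
  ultimately show ?thesis by (simp only: connected_continuous_image[OF _ connected_Icc])
qed

lemma vertex_point_in_edge_points: "vertex_point u \<in> edge_points u v" "vertex_point v \<in> edge_points u v"
  unfolding edge_points_def by (rule CollectI, rule exI[of _ 0], simp) (rule CollectI, rule exI[of _ 1], simp)

lemma finite_graph_ball:
  assumes "\<And>u. finite (E `` {u})" "\<And>u. finite (E\<inverse> `` {u})"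
  shows "finite {w. \<exists>k\<le>n::nat. (v, w) \<in> (E \<union> E\<inverse>) ^^ k}"
proof -
  have "finite (((E \<union> E\<inverse>) ^^ k) `` {v})" for k
  proof (induction k)
    case (Suc k)
    have "((E \<union> E\<inverse>) ^^ Suc k) `` {v} = (\<Union>u\<in>((E \<union> E\<inverse>) ^^ k) `` {v}. E `` {u} \<union> E\<inverse> `` {u})"
      by auto
    then show ?case using Suc assms by simp
  qed auto
  then have "finite (\<Union>k\<le>n. ((E \<union> E\<inverse>) ^^ k) `` {v})" by blast
  moreover have "{w. \<exists>k\<le>n. (v, w) \<in> (E \<union> E\<inverse>) ^^ k} = (\<Union>k\<le>n. ((E \<union> E\<inverse>) ^^ k) `` {v})" by auto
  ultimately show ?thesis by simp
qed

lemma ecard_ge_iff: "enat m \<le> ecard A \<longleftrightarrow> infinite A \<or> m \<le> card A"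
  by (simp add: ecard_def)

text \<open>Remove the boundary vertices of \<open>2 ^ m + 1\<close> of the sets. Then the surviving
  vertices of a component lie all in \<open>B i\<close> or all outside, so \<open>B i\<close>
  selects a set of unbounded components. If there were fewer than \<open>m\<close> of these, two
  selections would agree for some \<open>i < j\<close>, and up to removed vertices the infinite set
  \<open>B i - B j\<close> would lie in bounded components. But only finitely many components
  contain vertices, and a bounded one contains finitely many.\<close>

lemma graph_ends_infinite_if_almost_invariant_sets:
  fixes \<Gamma> :: "('a, 'b) monoid_scheme" and B :: "nat \<Rightarrow> 'a set"
  assumes \<Gamma>: "group \<Gamma>" and S: "finite_generating_set \<Gamma> S"
    and BV: "\<And>i. B i \<subseteq> carrier \<Gamma>"
    and bd: "\<And>i s. s \<in> S \<Longrightarrow> finite {g \<in> carrier \<Gamma>. (g \<in> B i) \<noteq> (g \<otimes>\<^bsub>\<Gamma>\<^esub> s \<in> B i)}"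
    and inf: "\<And>i j. i < j \<Longrightarrow> infinite (B i - B j)"
  shows "graph_ends (carrier \<Gamma>) (cayley_edges \<Gamma> S) = \<infinity>"
proof -
  interpret group \<Gamma> by (rule \<Gamma>)
  define V where "V = carrier \<Gamma>"
  define E where "E = cayley_edges \<Gamma> S"
  define R where "R = realization V E"
  have finS: "finite S" and SV: "S \<subseteq> V" and gen: "generate \<Gamma> S = V"
    using S by (auto simp: finite_generating_set_def V_def)
  have E_iff: "(u, v) \<in> E \<longleftrightarrow> (\<exists>s\<in>S. u \<in> V \<and> v = u \<otimes>\<^bsub>\<Gamma>\<^esub> s)" for u v
    by (auto simp: E_def cayley_edges_def V_def)
  have EV: "u \<in> V \<and> v \<in> V" if "(u, v) \<in> E" for u v
    using that SV by (auto simp: E_iff V_def)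
  have Esub: "V \<union> fst ` E \<union> snd ` E = V" using EV by force
  have "enat m \<le> graph_ends V E" for m :: nat
  proof -
    define M :: nat where "M = 2 ^ m"
    define Bd where "Bd i s = {g \<in> V. (g \<in> B i) \<noteq> (g \<otimes>\<^bsub>\<Gamma>\<^esub> s \<in> B i)}" for i s
    \<comment> \<open>The unit is included as the starting point of the walks that prove
      \<open>all_good\<close>.\<close>
    define \<Delta> where "\<Delta> = insert \<one>\<^bsub>\<Gamma>\<^esub> (\<Union>i\<le>M. \<Union>s\<in>S. Bd i s)"
    have fin\<Delta>: "finite \<Delta>" unfolding \<Delta>_def Bd_def V_def using bd finS by auto
    have \<Delta>V: "\<Delta> \<subseteq> V" by (auto simp: \<Delta>_def Bd_def V_def)
    define K where "K = vertex_point ` \<Delta>"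
    have vpR: "vertex_point w \<in> R" if "w \<in> V" for w using that by (auto simp: R_def realization_def)
    have K: "compact K" "K \<subseteq> R"
      using fin\<Delta> \<Delta>V vpR by (auto simp: K_def intro!: finite_imp_compact)
    define UC where "UC = unbounded_components V E K"
    have vpRK: "vertex_point w \<in> R - K" if "w \<in> V - \<Delta>" for w
      using that vpR by (auto simp: K_def)
    define comp where "comp w = connected_component_set (R - K) (vertex_point w)" for w
    have comp_in: "comp w \<in> components (R - K)" if "w \<in> V - \<Delta>" for w
      unfolding comp_def using vpRK[OF that] by (rule componentsI)
    have self_comp: "vertex_point w \<in> comp w" if "w \<in> V - \<Delta>" for w
      unfolding comp_def using connected_component_refl[OF vpRK[OF that]] by simp
    define conn where "conn u v \<longleftrightarrow> connected_component (R - K) (vertex_point u) (vertex_point v)" for u v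
    have conn_sym: "conn v u" if "conn u v" for u v
      using that unfolding conn_def by (rule connected_component_sym)
    have conn_trans: "conn u w" if "conn u v" "conn v w" for u v w
      using that unfolding conn_def by (rule connected_component_trans)
    have conn_refl: "conn v v" if "v \<in> V - \<Delta>" for v
      using vpRK[OF that] unfolding conn_def by (rule connected_component_refl)
    have edge: "conn u v"
      if "(u, v) \<in> E" "u \<notin> \<Delta>" "v \<notin> \<Delta>" for u v
    proof -
      have "edge_points u v \<subseteq> R" using that by (auto simp: R_def realization_def)
      moreover have "p \<notin> K" if "p \<in> edge_points u v" for p
      proof
        assume "p \<in> K"
        then obtain d where d: "d \<in> \<Delta>" "p = vertex_point d" by (auto simp: K_def)
        then have "p d = 1" by (simp add: vertex_point_def)
        moreover have "vertex_point u d = 0" "vertex_point v d = 0"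
          using d(1) \<open>u \<notin> \<Delta>\<close> \<open>v \<notin> \<Delta>\<close> by (auto simp: vertex_point_def)
        then have "p d = 0" using \<open>p \<in> edge_points u v\<close> by (auto simp: edge_points_def)
        ultimately show False by simp
      qed
      ultimately show ?thesis
        unfolding conn_def connected_component_def
        by (intro exI[of _ "edge_points u v"])
          (auto simp: edge_points_connected vertex_point_in_edge_points)
    qed
    \<comment> \<open>The neighbours of removed vertices. A walk from the unit enters a component of
      the complement through one of them, so finitely many components contain all surviving
      vertices.\<close>
    define N where "N = (\<Union>s\<in>S. (\<lambda>d. d \<otimes>\<^bsub>\<Gamma>\<^esub> s) ` \<Delta> \<union> (\<lambda>d. d \<otimes>\<^bsub>\<Gamma>\<^esub> inv\<^bsub>\<Gamma>\<^esub> s) ` \<Delta>)"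
    have finN: "finite N" using fin\<Delta> finS by (auto simp: N_def)
    define good where "good w \<longleftrightarrow> w \<in> \<Delta> \<or>
        (\<exists>v\<in>N - \<Delta>. v \<in> V \<and> conn v w)" for w
    have good_step: "good v" if gu: "good u" and uv: "u \<in> V" "v \<in> V" "v \<in> N \<or> u \<notin> \<Delta>" "(u, v) \<in> E \<or> (v, u) \<in> E" for u v
    proof (cases "v \<in> \<Delta>")
      case False
      show ?thesis
      proof (cases "u \<in> \<Delta>")
        case True
        then have "v \<in> N" using uv by blast
        then show ?thesis using conn_refl[of v] False uv unfolding good_def by blast
      next
        case u: False
        then obtain n where n: "n \<in> N - \<Delta>" "n \<in> V" "conn n u"
          using gu by (auto simp: good_def)
        have "conn u v" using uv(4) edge[OF _ u False] edge[OF _ False u] conn_sym by blast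
        then show ?thesis unfolding good_def using n conn_trans by blast
      qed
    qed (simp add: good_def)
    have good_gen: "\<forall>g\<in>V. good g \<longrightarrow> good (g \<otimes>\<^bsub>\<Gamma>\<^esub> h)" if "h \<in> generate \<Gamma> S" for h
      using that
    proof induction
      case one
      then show ?case by (simp add: V_def)
    next
      case (incl h)
      show ?case
      proof (intro ballI impI)
        fix g assume g: "g \<in> V" "good g"
        have "(g, g \<otimes>\<^bsub>\<Gamma>\<^esub> h) \<in> E" using g incl by (auto simp: E_iff)
        moreover have "g \<otimes>\<^bsub>\<Gamma>\<^esub> h \<in> N \<or> g \<notin> \<Delta>" using incl by (auto simp: N_def)
        ultimately show "good (g \<otimes>\<^bsub>\<Gamma>\<^esub> h)" using good_step g EV by blast
      qed
    next
      case (inv h)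
      show ?case
      proof (intro ballI impI)
        fix g assume g: "g \<in> V" "good g"
        have hV: "h \<in> carrier \<Gamma>" using inv SV by (auto simp: V_def)
        then have "g = (g \<otimes>\<^bsub>\<Gamma>\<^esub> inv\<^bsub>\<Gamma>\<^esub> h) \<otimes>\<^bsub>\<Gamma>\<^esub> h" using g by (simp add: m_assoc V_def)
        then have "(g \<otimes>\<^bsub>\<Gamma>\<^esub> inv\<^bsub>\<Gamma>\<^esub> h, g) \<in> E" using g inv hV by (auto simp: E_iff V_def)
        moreover have "g \<otimes>\<^bsub>\<Gamma>\<^esub> inv\<^bsub>\<Gamma>\<^esub> h \<in> N \<or> g \<notin> \<Delta>" using inv by (auto simp: N_def)
        ultimately show "good (g \<otimes>\<^bsub>\<Gamma>\<^esub> inv\<^bsub>\<Gamma>\<^esub> h)" using good_step g EV by blast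
      qed
    next
      case (eng h1 h2)
      have "h1 \<in> V" "h2 \<in> V" using eng gen by auto
      then show ?case using eng.IH m_assoc by (metis V_def m_closed)
    qed
    have all_good: "good w" if "w \<in> V" for w
    proof -
      have "good \<one>\<^bsub>\<Gamma>\<^esub>" by (simp add: good_def \<Delta>_def)
      then show ?thesis using good_gen[of w] that gen by (auto simp: V_def)
    qed
    define P where "P i = {C \<in> UC. \<exists>p\<in>C. \<exists>w\<in>B i - \<Delta>. p w \<noteq> 0}" for i
    define O1 where "O1 i = (\<Union>w\<in>B i - \<Delta>. {p::'a \<Rightarrow> real. p w \<noteq> 0})" for i
    \<comment> \<open>The second union covers the interiors of edges whose two ends are both
      removed: \<open>K\<close> consists of vertices only, so these interiors survive.\<close>
    define O2 where "O2 i = (\<Union>w\<in>V - B i - \<Delta>. {p::'a \<Rightarrow> real. p w \<noteq> 0}) \<union>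
       (\<Union>u\<in>\<Delta>. \<Union>v\<in>\<Delta> - {u}. {p. p u \<noteq> 0} \<inter> {p. p v \<noteq> 0})" for i
    have op: "open (O1 i)" "open (O2 i)" for i
      unfolding O1_def O2_def by (intro open_UN ballI open_Un open_Int open_coord_neq)+
    have cov: "R - K \<subseteq> O1 i \<union> O2 i" for i
    proof
      fix p assume p: "p \<in> R - K"
      then have "p \<in> realization V E" by (simp add: R_def)
      then show "p \<in> O1 i \<union> O2 i"
      proof (cases rule: realization_cases)
        case (vertex w)
        then have "w \<in> V" "w \<notin> \<Delta>" using p Esub by (auto simp: K_def)
        then show ?thesis using vertex by (cases "w \<in> B i") (auto simp: O1_def O2_def)
      next
        case (edge u v)
        then have "u \<in> V" "v \<in> V" using EV by auto
        then consider "u \<in> B i - \<Delta>" | "v \<in> B i - \<Delta>" | "u \<in> V - B i - \<Delta>" | "v \<in> V - B i - \<Delta>"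
          | "u \<in> \<Delta>" "v \<in> \<Delta>" by blast
        then show ?thesis using edge(2,3,4) unfolding O1_def O2_def by cases blast+
      qed
    qed
    \<comment> \<open>The main case is a point inside an edge that joins \<open>B i\<close> to its
      complement with both ends outside \<open>\<Delta>\<close>. The tail of such an edge is a
      boundary vertex and hence belongs to \<open>\<Delta>\<close>.\<close>
    have disj: "O1 i \<inter> O2 i \<inter> (R - K) = {}" if i: "i \<le> M" for i
    proof (rule ccontr)
      assume "\<not> ?thesis"
      then obtain p where p: "p \<in> O1 i" "p \<in> O2 i" "p \<in> realization V E" by (auto simp: R_def)
      obtain w where w: "w \<in> B i - \<Delta>" "p w \<noteq> 0" using p by (auto simp: O1_def)
      from p(3) show False
      proof (cases rule: realization_cases)
        case (vertex w')
        then have "w' = w" using w by auto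
        then show False using p(2) w vertex by (auto simp: O2_def)
      next
        case (edge u v)
        consider w' where "w' \<in> V - B i - \<Delta>" "p w' \<noteq> 0"
          | a b where "a \<in> \<Delta>" "b \<in> \<Delta>" "a \<noteq> b" "p a \<noteq> 0" "p b \<noteq> 0"
          using p(2) by (auto simp: O2_def)
        then show False
        proof cases
          case 1
          then have "{w, w'} = {u, v}" using edge(5)[of w] edge(5)[of w'] w by auto
          then have "(u \<in> B i) \<noteq> (v \<in> B i)" "u \<notin> \<Delta>" using 1 w by (auto simp: doubleton_eq_iff)
          moreover obtain s where "s \<in> S" "u \<in> V" "v = u \<otimes>\<^bsub>\<Gamma>\<^esub> s" using edge(1) by (auto simp: E_iff)
          ultimately have "u \<in> Bd i s" "s \<in> S" by (auto simp: Bd_def)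
          then show False using \<open>u \<notin> \<Delta>\<close> i by (auto simp: \<Delta>_def)
        next
          case 2
          then have "{a, b} = {u, v}" using edge(5)[of a] edge(5)[of b] by auto
          then show False using edge(5)[of w] w 2 by auto
        qed
      qed
    qed
    have comp_sub: "C \<subseteq> O1 i" if "C \<in> components (R - K)" "i \<le> M" "C \<inter> O1 i \<noteq> {}" for C i
    proof -
      have "connected C" "C \<subseteq> R - K"
        using that in_components_connected in_components_subset by blast+
      then have "O1 i \<inter> C = {} \<or> O2 i \<inter> C = {}"
        using connectedD[of C "O1 i" "O2 i"] op disj[OF that(2)] cov[of i] by blast
      then show ?thesis using that(3) cov[of i] \<open>C \<subseteq> R - K\<close> by blast
    qed
    have P_alt: "P i = {C \<in> UC. C \<inter> O1 i \<noteq> {}}" for i unfolding P_def O1_def by auto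
    have UCsub: "UC \<subseteq> components (R - K)" by (auto simp: UC_def unbounded_components_def R_def)
    have locfin: "finite (E `` {u})" "finite (E\<inverse> `` {u})" for u
    proof -
      have "E `` {u} \<subseteq> (\<lambda>s. u \<otimes>\<^bsub>\<Gamma>\<^esub> s) ` S" by (auto simp: E_iff)
      then show "finite (E `` {u})" using finS finite_surj by blast
      have "g = u \<otimes>\<^bsub>\<Gamma>\<^esub> inv\<^bsub>\<Gamma>\<^esub> s" if "g \<in> V" "s \<in> S" "u = g \<otimes>\<^bsub>\<Gamma>\<^esub> s" for g s
        using that SV m_assoc[of g s "inv\<^bsub>\<Gamma>\<^esub> s"] by (auto simp: V_def)
      then have "E\<inverse> `` {u} \<subseteq> (\<lambda>s. u \<otimes>\<^bsub>\<Gamma>\<^esub> inv\<^bsub>\<Gamma>\<^esub> s) ` S" by (clarsimp simp: E_iff image_iff) metis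
      then show "finite (E\<inverse> `` {u})" using finS finite_surj by blast
    qed
    have bounded_fin: "finite {w. vertex_point w \<in> C}" if "graph_bounded V E C" for C
    proof -
      obtain v n where vn: "\<And>p w. p \<in> C \<Longrightarrow> p w \<noteq> 0 \<Longrightarrow> \<exists>k\<le>n::nat. (v, w) \<in> (E \<union> E\<inverse>) ^^ k"
        using \<open>graph_bounded V E C\<close> unfolding graph_bounded_def by metis
      have "{w. vertex_point w \<in> C} \<subseteq> {w. \<exists>k\<le>n. (v, w) \<in> (E \<union> E\<inverse>) ^^ k}"
      proof (rule subsetI, rule CollectI)
        fix w assume "w \<in> {w. vertex_point w \<in> C}"
        then show "\<exists>k\<le>n. (v, w) \<in> (E \<union> E\<inverse>) ^^ k" by (intro vn[of "vertex_point w"]) auto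
      qed
      then show ?thesis using finite_graph_ball[OF locfin] finite_subset by blast
    qed
    have "enat m \<le> ecard UC"
    proof (rule ccontr)
      assume "\<not> ?thesis"
      then have finUC: "finite UC" and card: "card UC < m" by (auto simp: ecard_ge_iff)
      have "card (P ` {..M}) \<le> card (Pow UC)"
        using finUC by (intro card_mono) (auto simp: P_def)
      also have "\<dots> < 2 ^ m" using card finUC by (simp add: card_Pow)
      finally have "card (P ` {..M}) < card {..M}" by (simp add: M_def)
      then have "\<not> inj_on P {..M}" by (rule pigeonhole)
      then obtain i j where ij: "i \<le> M" "j \<le> M" "i < j" "P i = P j"
        using linorder_inj_onI'[of "{..M}" P] by (metis atMost_iff)
      define W where "W = B i - B j - \<Delta>"
      have "infinite W" using inf[OF ij(3)] fin\<Delta> by (simp add: W_def)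
      have WV: "W \<subseteq> V - \<Delta>" using BV by (auto simp: W_def V_def)
      have notUC: "comp w \<notin> UC" if "w \<in> W" for w
      proof
        assume *: "comp w \<in> UC"
        have "vertex_point w \<in> comp w" using self_comp that WV by blast
        moreover have "vertex_point w \<in> O1 i" using that by (auto simp: O1_def W_def)
        ultimately have "comp w \<in> P i" using * by (auto simp: P_alt)
        then have "comp w \<in> P j" using ij(4) by simp
        then have "comp w \<inter> O1 j \<noteq> {}" by (simp add: P_alt)
        then have "comp w \<subseteq> O1 j" using UCsub * ij(2) by (intro comp_sub) auto
        then have "vertex_point w \<in> O1 j" using \<open>vertex_point w \<in> comp w\<close> by blast
        then show False using that by (auto simp: O1_def W_def)
      qed
      have "W \<subseteq> (\<Union>v\<in>{v \<in> N. finite {w. vertex_point w \<in> comp v}}. {w. vertex_point w \<in> comp v})"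
      proof
        fix w assume w: "w \<in> W"
        then have "w \<in> V" "w \<notin> \<Delta>" using WV by auto
        then obtain v where v: "v \<in> N - \<Delta>" "v \<in> V" "conn v w"
          using all_good[of w] by (auto simp: good_def)
        have "comp v = comp w" unfolding comp_def using v(3) unfolding conn_def by (intro connected_component_eq[symmetric]) simp
        moreover have "finite {w'. vertex_point w' \<in> comp w}"
          using bounded_fin notUC[OF w] comp_in[of w] w WV
          by (auto simp: UC_def unbounded_components_def R_def)
        ultimately show "w \<in> (\<Union>v\<in>{v \<in> N. finite {w. vertex_point w \<in> comp v}}. {w. vertex_point w \<in> comp v})"
          using v(1) self_comp[of w] w WV by (intro UN_I[of v]) auto
      qed
      moreover have "finite (\<Union>v\<in>{v \<in> N. finite {w. vertex_point w \<in> comp v}}. {w. vertex_point w \<in> comp v})"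
        using finN by auto
      ultimately show False using \<open>infinite W\<close> finite_subset by blast
    qed
    also have "\<dots> \<le> graph_ends V E"
      unfolding graph_ends_def UC_def using K by (intro SUP_upper) (auto simp: R_def)
    finally show ?thesis .
  qed
  then have "\<exists>n. graph_ends V E = enat n \<Longrightarrow> False" using Suc_n_not_le_n enat_ord_simps(1) by metis
  then show ?thesis unfolding V_def E_def by (cases "graph_ends (carrier \<Gamma>) (cayley_edges \<Gamma> S)") auto
qed

section \<open>Distortion of iterates\<close>

definition incr_diff :: "(real \<Rightarrow> real) \<Rightarrow> bool"
  where "incr_diff f \<longleftrightarrow> (\<forall>t. (f has_real_derivative deriv f t) (at t) \<and> 0 < deriv f t)"

text \<open>The constant bounds the nonlinearity \<open>f'' / f'\<close> in integrated form.
  Logarithms turn the chain rule into a sum, which is how the distortion of long compositions is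
  controlled.\<close>

definition log_lipschitz :: "real \<Rightarrow> (real \<Rightarrow> real) \<Rightarrow> bool"
  where "log_lipschitz M f \<longleftrightarrow> incr_diff f \<and> 0 \<le> M \<and>
    (\<forall>s t. \<bar>ln (deriv f s) - ln (deriv f t)\<bar> \<le> M * \<bar>s - t\<bar>)"

lemma incr_diffD:
  assumes "incr_diff f"
  shows "(f has_real_derivative deriv f t) (at t)" "0 < deriv f t"
  using assms by (auto simp: incr_diff_def)

lemma incr_diffI:
  assumes "\<And>t. (f has_real_derivative f' t) (at t)" "\<And>t. 0 < f' t"
  shows "incr_diff f"
  unfolding incr_diff_def using assms DERIV_imp_deriv[OF assms(1)] by simp

lemma incr_diff_strict_mono: "incr_diff f \<Longrightarrow> strict_mono f"
  by (rule strict_monoI, rule DERIV_pos_imp_increasing) (auto simp: incr_diff_def)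

lemma incr_diff_less_iff: "incr_diff f \<Longrightarrow> f s < f t \<longleftrightarrow> s < t"
  using incr_diff_strict_mono strict_mono_less by blast

lemma incr_diff_le_iff: "incr_diff f \<Longrightarrow> f s \<le> f t \<longleftrightarrow> s \<le> t"
  using incr_diff_strict_mono strict_mono_less_eq by blast

lemma incr_diff_continuous: "incr_diff f \<Longrightarrow> continuous_on A f"
  by (rule DERIV_continuous_on, rule has_field_derivative_at_within, erule incr_diffD(1))

lemma incr_diff_id: "incr_diff id" "deriv id = (\<lambda>t::real. 1)"
proof -
  have "(id has_real_derivative 1) (at t)" for t :: real by (simp add: id_def)
  then show "incr_diff id" "deriv id = (\<lambda>t::real. 1)"
    by (auto intro!: incr_diffI ext DERIV_imp_deriv)
qed

lemma incr_diff_comp: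
  assumes "incr_diff f" "incr_diff g"
  shows "incr_diff (f \<circ> g)" "deriv (f \<circ> g) t = deriv f (g t) * deriv g t"
proof -
  have *: "((f \<circ> g) has_real_derivative deriv f (g t) * deriv g t) (at t)" for t
    using assms by (intro DERIV_chain incr_diffD)
  then show "deriv (f \<circ> g) t = deriv f (g t) * deriv g t" by (intro DERIV_imp_deriv)
  show "incr_diff (f \<circ> g)"
    by (rule incr_diffI[OF *]) (intro mult_pos_pos incr_diffD(2) assms)
qed

lemma incr_diff_funpow:
  assumes "incr_diff f"
  shows "incr_diff (f ^^ n)" "deriv (f ^^ Suc n) t = deriv f ((f ^^ n) t) * deriv (f ^^ n) t"
proof -
  show *: "incr_diff (f ^^ n)" for n
    by (induction n) (simp_all only: funpow.simps incr_diff_id incr_diff_comp assms)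
  show "deriv (f ^^ Suc n) t = deriv f ((f ^^ n) t) * deriv (f ^^ n) t"
    using incr_diff_comp(2)[OF assms *] by simp
qed

lemma incr_diff_mvt:
  assumes "incr_diff f" "s < t"
  obtains x where "s < x" "x < t" "f t - f s = (t - s) * deriv f x"
  using MVT2[OF assms(2), of f "deriv f"] incr_diffD(1)[OF assms(1)] by blast

lemma log_lipschitzD:
  assumes "log_lipschitz M f"
  shows "incr_diff f" "0 \<le> M" "\<bar>ln (deriv f s) - ln (deriv f t)\<bar> \<le> M * \<bar>s - t\<bar>"
  using assms by (auto simp: log_lipschitz_def)

lemma log_lipschitz_mono: "log_lipschitz M f \<Longrightarrow> M \<le> M' \<Longrightarrow> log_lipschitz M' f"
  unfolding log_lipschitz_def by (meson abs_ge_zero mult_right_mono order_trans)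

text \<open>The logarithmic derivative of an iterate is a sum along the orbit, so distortion is paid
  for by the distances between the two orbits.\<close>

lemma funpow_distortion:
  assumes "log_lipschitz M f"
  shows "\<bar>ln (deriv (f ^^ n) s) - ln (deriv (f ^^ n) t)\<bar> \<le> M * (\<Sum>i<n. \<bar>(f ^^ i) s - (f ^^ i) t\<bar>)"
proof (induction n)
  case 0
  show ?case by simp
next
  case (Suc n)
  note f = log_lipschitzD(1)[OF assms]
  have pos: "deriv f u > 0" "deriv (f ^^ n) u > 0" for u
    using f incr_diff_funpow(1)[OF f] incr_diffD(2) by blast+
  have "ln (deriv (f ^^ Suc n) u) = ln (deriv f ((f ^^ n) u)) + ln (deriv (f ^^ n) u)" for u
    unfolding incr_diff_funpow(2)[OF f] by (rule ln_mult_pos[OF pos])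
  then show ?case
    using Suc log_lipschitzD(3)[OF assms, of "(f ^^ n) s" "(f ^^ n) t"]
    by (simp only: sum.lessThan_Suc distrib_left)
qed

lemma funpow_shift: "(f ^^ i) (f a) = (f ^^ Suc i) a"
  by (simp add: funpow_swap1)

lemma orbit_sum:
  assumes f: "incr_diff f" and "a < f a"
  shows "(\<Sum>i<n. (f ^^ i) (f a) - (f ^^ i) a) = (f ^^ n) a - a"
    "(f ^^ i) a < (f ^^ Suc i) a" "i \<le> j \<Longrightarrow> (f ^^ i) a \<le> (f ^^ j) a"
proof -
  show "(\<Sum>i<n. (f ^^ i) (f a) - (f ^^ i) a) = (f ^^ n) a - a"
    unfolding funpow_shift by (induction n) (simp_all add: sum.lessThan_Suc)
  show lt: "(f ^^ i) a < (f ^^ Suc i) a" for i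
    using incr_diff_less_iff[OF incr_diff_funpow(1)[OF f], of i a "f a"] assms by (simp add: funpow_shift)
  show "(f ^^ i) a \<le> (f ^^ j) a" if "i \<le> j"
    using lift_Suc_mono_le[of "\<lambda>i. (f ^^ i) a", OF _ that] lt less_imp_le by blast
qed

text \<open>The images of the fundamental interval from \<open>a\<close> to \<open>f a\<close> are
  adjacent and have total length at most 1, so each iterate has distortion at most
  \<open>exp M\<close> on it. By the mean value theorem the ratio of lengths is the derivative at
  some point of that interval.\<close>

lemma iterate_deriv_bounds:
  assumes fM: "log_lipschitz M f" and a: "a < f a" and b: "(f ^^ n) a - a \<le> 1" and in': "i \<le> n"
  shows "exp (-M) * (((f ^^ Suc i) a - (f ^^ i) a) / (f a - a)) \<le> deriv (f ^^ i) a"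
    "deriv (f ^^ i) a \<le> exp M * (((f ^^ Suc i) a - (f ^^ i) a) / (f a - a))"
proof -
  note f = log_lipschitzD(1)[OF fM]
  note fi = incr_diff_funpow(1)[OF f]
  obtain x where x: "a < x" "x < f a" "(f ^^ i) (f a) - (f ^^ i) a = (f a - a) * deriv (f ^^ i) x"
    using incr_diff_mvt[OF fi a] by blast
  then have eq: "deriv (f ^^ i) x = ((f ^^ Suc i) a - (f ^^ i) a) / (f a - a)"
    using a by (simp only: funpow_shift) (simp add: field_simps)
  have "(\<Sum>j<i. \<bar>(f ^^ j) a - (f ^^ j) x\<bar>) \<le> (\<Sum>j<i. (f ^^ j) (f a) - (f ^^ j) a)"
  proof (rule sum_mono)
    fix j
    have "(f ^^ j) a \<le> (f ^^ j) x" "(f ^^ j) x \<le> (f ^^ j) (f a)"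
      using x incr_diff_le_iff[OF fi] by simp_all
    then show "\<bar>(f ^^ j) a - (f ^^ j) x\<bar> \<le> (f ^^ j) (f a) - (f ^^ j) a" by simp
  qed
  also have "\<dots> \<le> 1" using orbit_sum(1)[OF f a, of i] orbit_sum(3)[OF f a in'] b by simp
  finally have "M * (\<Sum>j<i. \<bar>(f ^^ j) a - (f ^^ j) x\<bar>) \<le> M"
    using log_lipschitzD(2)[OF fM] by (simp add: mult_left_le)
  then have d: "\<bar>ln (deriv (f ^^ i) a) - ln (deriv (f ^^ i) x)\<bar> \<le> M"
    using funpow_distortion[OF fM, of i a x] by linarith
  have pos: "deriv (f ^^ i) a > 0" "deriv (f ^^ i) x > 0" using fi incr_diffD(2) by blast+
  have "ln (exp (-M) * deriv (f ^^ i) x) \<le> ln (deriv (f ^^ i) a)"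
    "ln (deriv (f ^^ i) a) \<le> ln (exp M * deriv (f ^^ i) x)"
    using d pos by (simp_all add: ln_mult)
  then show "exp (-M) * (((f ^^ Suc i) a - (f ^^ i) a) / (f a - a)) \<le> deriv (f ^^ i) a"
    "deriv (f ^^ i) a \<le> exp M * (((f ^^ Suc i) a - (f ^^ i) a) / (f a - a))"
    using pos unfolding eq[symmetric] by simp_all
qed

section \<open>Escape from a parabolic fixed point\<close>

lemma orbit_tendsto_fixed_point:
  assumes f: "continuous_on UNIV f" and inc: "incseq (\<lambda>n. (f ^^ n) (a::real))" and le: "\<And>n. (f ^^ n) a \<le> B"
  obtains p where "(\<lambda>n. (f ^^ n) a) \<longlonglongrightarrow> p" "f p = p" "\<And>n. (f ^^ n) a \<le> p"
proof -
  obtain p where p: "(\<lambda>n. (f ^^ n) a) \<longlonglongrightarrow> p" "\<And>n. (f ^^ n) a \<le> p"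
    using incseq_convergent[OF inc] le by blast
  have "isCont f p" using f by (simp add: continuous_on_eq_continuous_at)
  then have "(\<lambda>n. f ((f ^^ n) a)) \<longlonglongrightarrow> f p" using p(1) isCont_tendsto_compose by blast
  moreover have "(\<lambda>n. f ((f ^^ n) a)) \<longlonglongrightarrow> p" using LIMSEQ_Suc[OF p(1)] by simp
  ultimately have "f p = p" using LIMSEQ_unique by blast
  then show thesis using that p by blast
qed

text \<open>\<open>r\<close> is the scale to be escaped: the iterate expands by at least
  \<open>1 / (C * r)\<close>. The second condition says that the derivatives collected on the way
  are dominated by the last one; it later bounds the distortion of the path run backwards.\<close>

definition exits :: "real \<Rightarrow> real \<Rightarrow> (real \<Rightarrow> real) \<Rightarrow> real \<Rightarrow> bool"
  where "exits C r f y \<longleftrightarrow> (\<exists>n\<ge>1. 1 \<le> C * r * deriv (f ^^ n) y \<and>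
    (\<Sum>i=1..n. deriv (f ^^ i) y) \<le> C * deriv (f ^^ n) y)"

lemma exits_mono:
  assumes "exits C r f y" "incr_diff f" "C \<le> C'" "C * r \<le> C' * r'"
  shows "exits C' r' f y"
proof -
  obtain n where n: "n \<ge> 1" "1 \<le> C * r * deriv (f ^^ n) y" "(\<Sum>i=1..n. deriv (f ^^ i) y) \<le> C * deriv (f ^^ n) y"
    using assms(1) unfolding exits_def by blast
  have "0 < deriv (f ^^ n) y" using incr_diffD(2) incr_diff_funpow(1) assms(2) by blast
  then have "C * r * deriv (f ^^ n) y \<le> C' * r' * deriv (f ^^ n) y" "C * deriv (f ^^ n) y \<le> C' * deriv (f ^^ n) y"
    using assms(3,4) by (auto intro!: mult_right_mono)
  then show ?thesis using n unfolding exits_def by (intro exI[of _ n]) auto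
qed

text \<open>The orbit of \<open>y\<close> moves away from \<open>z\<close> and cannot converge
  before \<open>w\<close>, since its limit would be a fixed point. At the first passage of
  \<open>w\<close> the fundamental interval has length at least \<open>c\<close>, having started
  with length \<open>f y - y\<close>, so the derivative there is at least of order
  \<open>c / (f y - y)\<close>. The intermediate derivatives are comparable to the lengths of
  adjacent intervals divided by \<open>f y - y\<close>, and these lengths add up to at most
  1.\<close>

lemma parabolic_exit_right:
  assumes fM: "log_lipschitz M f" and z: "f z = z" and w: "z < w" "f (f w) \<le> z + 1" and wf: "w < f w"
    and push: "\<And>t. z < t \<Longrightarrow> t \<le> f w \<Longrightarrow> t < f t"
  shows "\<exists>C\<ge>1. \<forall>y\<in>{z<..<w}. exits C \<bar>f y - y\<bar> f y"
proof -
  note f = log_lipschitzD(1)[OF fM] and M = log_lipschitzD(2)[OF fM]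
  note fi = incr_diff_funpow(1)[OF f]
  have "continuous_on {w..f w} (\<lambda>t. f t - t)"
    by (intro continuous_intros incr_diff_continuous f)
  \<comment> \<open>\<open>m\<close> minimises the displacement over a full fundamental interval,
    which an orbit cannot jump over.\<close>
  then obtain m where m: "m \<in> {w..f w}" "\<And>t. t \<in> {w..f w} \<Longrightarrow> f m - m \<le> f t - t"
    using continuous_attains_inf[of "{w..f w}" "\<lambda>t. f t - t"] wf by auto
  define c where "c = f m - m"
  have c: "c > 0" using push[of m] m w by (simp add: c_def)
  \<comment> \<open>One factor \<open>exp M\<close> is lost in the lower bound for the last
    derivative, the other in the upper bound for the sum.\<close>
  define C where "C = max 1 (exp (2 * M) / c)"
  have expM: "1 \<le> exp M" using M by simp
  have expMM: "exp (2 * M) = exp M * exp M" by (simp only: mult_2 exp_add)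
  have "exits C \<bar>f y - y\<bar> f y" if y: "z < y" "y < w" for y
  proof -
    have yf: "y < f y" using push[of y] y wf by simp
    have gt: "z < (f ^^ i) y" for i
      using orbit_sum(3)[OF f yf, of 0 i] y by simp
    have "\<exists>n. w \<le> (f ^^ n) y"
    proof (rule ccontr)
      assume "\<not> ?thesis"
      then have lt: "(f ^^ n) y < w" for n by (simp add: not_le)
      have "incseq (\<lambda>n. (f ^^ n) y)" using orbit_sum(3)[OF f yf] by (auto simp: incseq_def)
      then obtain p where p: "(\<lambda>n. (f ^^ n) y) \<longlonglongrightarrow> p" "f p = p" "\<And>n. (f ^^ n) y \<le> p"
        using orbit_tendsto_fixed_point[OF incr_diff_continuous[OF f], of y w] lt less_imp_le by blast
      have "p \<le> w" using p(1) lt by (intro LIMSEQ_le_const2[of _ p w]) (auto intro: less_imp_le)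
      moreover have "z < p" using p(3)[of 0] y by simp
      ultimately show False using push[of p] p(2) wf by simp
    qed
    then obtain n where n: "w \<le> (f ^^ n) y" "\<And>k. k < n \<Longrightarrow> (f ^^ k) y < w"
      using exists_least_iff[of "\<lambda>n. w \<le> (f ^^ n) y"] not_le by blast
    have "n \<ge> 1" using n y by (cases n) auto
    then obtain k where k: "n = Suc k" by (cases n) auto
    have up: "(f ^^ n) y < f w" using n(2)[of k] incr_diff_less_iff[OF f] by (simp add: k)
    have up2: "(f ^^ Suc n) y \<le> f (f w)" using up incr_diff_le_iff[OF f] by simp
    have le1: "(f ^^ Suc n) y - y \<le> 1" using up2 w y by linarith
    have le1': "(f ^^ n) y - y \<le> 1" using orbit_sum(2)[OF f yf, of n] le1 by linarith
    note bnd = iterate_deriv_bounds[OF fM yf le1']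
    have len: "c \<le> (f ^^ Suc n) y - (f ^^ n) y" unfolding c_def using m(2)[of "(f ^^ n) y"] n up by simp
    have dpos: "0 < deriv (f ^^ n) y" using fi incr_diffD(2) by blast
    have "exp (-M) * (c / (f y - y)) \<le> exp (-M) * (((f ^^ Suc n) y - (f ^^ n) y) / (f y - y))"
      using len yf by (intro mult_left_mono divide_right_mono) auto
    also have "\<dots> \<le> deriv (f ^^ n) y" using bnd(1)[of n] by simp
    finally have lower: "c \<le> exp M * (f y - y) * deriv (f ^^ n) y"
      using yf by (simp add: exp_minus field_simps)
    have eMC: "exp M / c \<le> C"
      using expM c by (simp add: C_def expMM le_max_iff_disj divide_right_mono)
    have "1 \<le> exp M / c * ((f y - y) * deriv (f ^^ n) y)"
      using lower c by (simp add: field_simps)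
    also have "\<dots> \<le> C * ((f y - y) * deriv (f ^^ n) y)"
      using eMC dpos yf by (intro mult_right_mono) auto
    finally have 1: "1 \<le> C * \<bar>f y - y\<bar> * deriv (f ^^ n) y" using yf by (simp add: mult.assoc)
    have "(\<Sum>i=1..n. deriv (f ^^ i) y) \<le> (\<Sum>i=1..n. exp M * (((f ^^ Suc i) y - (f ^^ i) y) / (f y - y)))"
      using bnd(2) by (intro sum_mono) auto
    also have "\<dots> = exp M / (f y - y) * (\<Sum>i=1..n. (f ^^ Suc i) y - (f ^^ i) y)"
      by (simp add: sum_distrib_left divide_inverse ac_simps)
    also have "(\<Sum>i=1..n. (f ^^ Suc i) y - (f ^^ i) y) = (f ^^ Suc n) y - (f ^^ 1) y"
      using \<open>n \<ge> 1\<close> by (subst sum_Suc_diff) auto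
    also have "exp M / (f y - y) * ((f ^^ Suc n) y - (f ^^ 1) y) \<le> exp M / (f y - y) * 1"
      using yf le1 by (intro mult_left_mono) auto
    also have "\<dots> = exp (2 * M) / c * (c / (exp M * (f y - y)))"
      using c unfolding expMM by (simp del: mult_exp_exp)
    also have "\<dots> \<le> exp (2 * M) / c * deriv (f ^^ n) y"
      using lower c yf by (intro mult_left_mono) (simp_all add: pos_divide_le_eq ac_simps)
    also have "\<dots> \<le> C * deriv (f ^^ n) y" using dpos by (intro mult_right_mono) (auto simp: C_def)
    finally show ?thesis using 1 \<open>n \<ge> 1\<close> unfolding exits_def by blast
  qed
  then show ?thesis by (intro exI[of _ C]) (auto simp: C_def)
qed

text \<open>Conjugation by the reflection at 0. It turns exits to the left into exits to the right
  and preserves \<open>log_lipschitz\<close> with the same constant.\<close>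

definition reflect :: "(real \<Rightarrow> real) \<Rightarrow> real \<Rightarrow> real"
  where "reflect f = (\<lambda>t. - f (- t))"

lemma reflect_funpow: "reflect f ^^ n = reflect (f ^^ n)"
  by (induction n) (auto simp: reflect_def)

lemma reflect_diff:
  assumes "incr_diff f"
  shows "incr_diff (reflect f)" "deriv (reflect f) t = deriv f (- t)"
proof -
  have *: "(reflect f has_real_derivative deriv f (- t)) (at t)" for t
    unfolding reflect_def using incr_diffD(1)[OF assms, of "-t"]
    by (auto intro!: derivative_eq_intros DERIV_chain'[of uminus "-1" t UNIV f])
  show "deriv (reflect f) t = deriv f (- t)" using * by (rule DERIV_imp_deriv)
  show "incr_diff (reflect f)" using * incr_diffD(2)[OF assms] by (rule incr_diffI)
qed

lemma log_lipschitz_reflect: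
  assumes "log_lipschitz M f"
  shows "log_lipschitz M (reflect f)"
  unfolding log_lipschitz_def
proof (intro conjI allI)
  note f = log_lipschitzD[OF assms]
  show "incr_diff (reflect f)" "0 \<le> M" using reflect_diff(1) f by blast+
  show "\<bar>ln (deriv (reflect f) s) - ln (deriv (reflect f) t)\<bar> \<le> M * \<bar>s - t\<bar>" for s t
    using f(3)[of "- s" "- t"] unfolding reflect_diff(2)[OF f(1)] by (simp add: abs_minus_commute)
qed

lemma parabolic_exit_left:
  assumes fM: "log_lipschitz M f" and z: "f z = z" and w: "w < z" "z - 1 \<le> f (f w)" and wf: "f w < w"
    and push: "\<And>t. t < z \<Longrightarrow> f w \<le> t \<Longrightarrow> f t < t"
  shows "\<exists>C\<ge>1. \<forall>y\<in>{w<..<z}. exits C \<bar>f y - y\<bar> f y"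
proof -
  note f = log_lipschitzD(1)[OF fM]
  have "\<exists>C\<ge>1. \<forall>y\<in>{- z<..<- w}. exits C \<bar>reflect f y - y\<bar> (reflect f) y"
  proof (rule parabolic_exit_right[OF log_lipschitz_reflect[OF fM]])
    show "t < reflect f t" if "- z < t" "t \<le> reflect f (- w)" for t
      using that push[of "- t"] by (simp add: reflect_def)
  qed (use z w wf in \<open>auto simp: reflect_def\<close>)
  then obtain C where C: "C \<ge> 1" "\<And>y. y \<in> {- z<..<- w} \<Longrightarrow> exits C \<bar>reflect f y - y\<bar> (reflect f) y" by blast
  have d: "deriv (reflect f ^^ i) (- y) = deriv (f ^^ i) y" for i y
    unfolding reflect_funpow using reflect_diff(2)[OF incr_diff_funpow(1)[OF f]] by simp
  have "exits C \<bar>f y - y\<bar> f y" if "w < y" "y < z" for y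
  proof -
    have "\<bar>reflect f (- y) - - y\<bar> = \<bar>f y - y\<bar>" by (simp add: reflect_def)
    then show ?thesis using C(2)[of "- y"] that unfolding exits_def d by simp
  qed
  with C(1) show ?thesis by auto
qed

section \<open>Groups of lifts\<close>

text \<open>\<open>d\<close> is the degree: 0 for periodic functions, 1 for elements of a lift
  group, and still unknown when the degree of a lift is being determined.\<close>

lemma periodic_int:
  assumes "\<And>t. g (t + 1) = (g t + d :: real)"
  shows "g (t + of_int n) = g t + of_int n * d"
proof -
  have nat: "g (t + of_nat n) = g t + of_nat n * d" for t and n :: nat
  proof (induction n)
    case (Suc n)
    have "g (t + of_nat (Suc n)) = g ((t + of_nat n) + 1)" by (simp add: ac_simps)
    also have "\<dots> = g t + of_nat (Suc n) * d" using assms[of "t + of_nat n"] Suc by (simp add: distrib_right)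
    finally show ?case .
  qed simp
  show ?thesis
  proof (cases "n \<ge> 0")
    case True
    then show ?thesis using nat[of t "nat n"] by simp
  next
    case False
    then show ?thesis using nat[of "t + of_int n" "nat (-n)"] by (simp add: algebra_simps)
  qed
qed

lemma periodic_bounded:
  assumes "continuous_on UNIV (g :: real \<Rightarrow> real)" "\<And>t. g (t + 1) = g t"
  shows "\<exists>M\<ge>0. \<forall>t. \<bar>g t\<bar> \<le> M"
proof -
  have "compact (g ` {0..1})" using assms(1) by (intro compact_continuous_image) (auto intro: continuous_on_subset)
  then obtain M where M: "\<And>x. x \<in> g ` {0..1} \<Longrightarrow> \<bar>x\<bar> \<le> M"
    using compact_imp_bounded bounded_real by metis
  have "\<bar>g t\<bar> \<le> M" for t
  proof -
    have "g t = g (frac t)"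
      using periodic_int[of g 0 "frac t" "\<lfloor>t\<rfloor>"] assms(2) by (simp add: frac_def)
    moreover have "frac t \<in> {0..1}" using frac_ge_0[of t] frac_lt_1[of t] by auto
    ultimately show ?thesis using M[of "g t"] by (metis image_eqI)
  qed
  moreover have "0 \<le> M" using calculation[of 0] by linarith
  ultimately show ?thesis by blast
qed

abbreviation finv :: "(real \<Rightarrow> real) \<Rightarrow> real \<Rightarrow> real"
  where "finv F \<equiv> inv_into UNIV F"

text \<open>The full preimage of the circle group on the line, that is, its extension by integer
  translations. Here derivatives are plain \<open>deriv\<close> and the order of the line is
  available. \<open>dense\<close> expresses minimality of the action; \<open>star\<close> is
  property (star) when the minimal set is the whole circle.\<close>

locale lift_group =
  fixes L :: "(real \<Rightarrow> real) set" and t0 :: real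
  assumes id_in: "id \<in> L"
    and comp_in: "F \<in> L \<Longrightarrow> H \<in> L \<Longrightarrow> F \<circ> H \<in> L"
    and inv_ex: "F \<in> L \<Longrightarrow> \<exists>H\<in>L. H \<circ> F = id \<and> F \<circ> H = id"
    and translation_in: "(\<lambda>t. t + 1) \<in> L"
    and analytic: "F \<in> L \<Longrightarrow> real_analytic F"
    and mono: "F \<in> L \<Longrightarrow> strict_mono F"
    and periodic: "F \<in> L \<Longrightarrow> F (t + 1) = F t + 1"
    and dense: "a < b \<Longrightarrow> \<exists>F\<in>L. a < F t \<and> F t < b"
    and nonexp: "F \<in> L \<Longrightarrow> deriv F t0 \<le> 1"
    and star: "(\<And>F. F \<in> L \<Longrightarrow> deriv F z \<le> 1) \<Longrightarrow> \<exists>F\<in>L. F \<noteq> id \<and> F z = z"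
begin

lemma inv_in:
  assumes "F \<in> L"
  shows "finv F \<in> L" "finv F (F t) = t" "F (finv F t) = t" "finv F \<circ> F = id" "F \<circ> finv F = id"
proof -
  obtain H where H: "H \<in> L" "H \<circ> F = id" "F \<circ> H = id" using inv_ex assms by blast
  have "finv F = H" using inv_unique_comp H by blast
  then show "finv F \<in> L" "finv F (F t) = t" "F (finv F t) = t" "finv F \<circ> F = id" "F \<circ> finv F = id"
    using H by (metis, metis comp_apply id_apply, metis comp_apply id_apply, simp_all)
qed

lemma has_deriv: "F \<in> L \<Longrightarrow> (F has_real_derivative deriv F t) (at t)"
  using real_analytic_deriv(1) analytic by blast

text \<open>Strict monotonicity alone would allow critical points; differentiability of the inverse
  excludes them.\<close>

lemma deriv_pos: "F \<in> L \<Longrightarrow> 0 < deriv F t"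
proof -
  assume F: "F \<in> L"
  have "(finv F \<circ> F has_real_derivative deriv (finv F) (F t) * deriv F t) (at t)"
    using F inv_in has_deriv by (intro DERIV_chain) auto
  moreover have "(finv F \<circ> F has_real_derivative 1) (at t)" using F by (simp add: inv_in id_def)
  ultimately have "deriv (finv F) (F t) * deriv F t = 1" using DERIV_unique by blast
  then have "deriv F t \<noteq> 0" by auto
  moreover have "deriv F t \<ge> 0"
    using mono_on_imp_deriv_nonneg[of UNIV F "deriv F t" t] has_deriv[OF F] strict_mono_mono[OF mono[OF F]]
    by simp
  ultimately show ?thesis by simp
qed

lemma incr_diff: "F \<in> L \<Longrightarrow> incr_diff F"
  using has_deriv deriv_pos by (auto simp: incr_diff_def)

lemma deriv_comp: "F \<in> L \<Longrightarrow> H \<in> L \<Longrightarrow> deriv (F \<circ> H) t = deriv F (H t) * deriv H t"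
  by (rule incr_diff_comp(2)) (auto simp: incr_diff)

lemma deriv_inv: "F \<in> L \<Longrightarrow> deriv (finv F) (F t) * deriv F t = 1"
  using deriv_comp[of "finv F" F t] inv_in[of F] incr_diff_id by simp

lemma funpow_in: "F \<in> L \<Longrightarrow> F ^^ n \<in> L"
  by (induction n) (simp_all only: funpow.simps id_in comp_in)

lemma periodic_of_int: "F \<in> L \<Longrightarrow> F (t + of_int n) = F t + of_int n"
  using periodic_int[of F 1 t n] periodic by simp

lemma shift_in: "(\<lambda>t. t + of_int n) \<in> L"
proof -
  have nat: "(\<lambda>t. t + of_nat n) \<in> L" for n :: nat
  proof (induction n)
    case 0
    then show ?case using id_in by (simp add: id_def)
  next
    case (Suc n)
    have "(\<lambda>t. t + of_nat (Suc n)) = (\<lambda>t::real. t + 1) \<circ> (\<lambda>t. t + of_nat n)" by auto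
    then show ?case using comp_in[OF translation_in Suc] by simp
  qed
  show ?thesis
  proof (cases "n \<ge> 0")
    case True
    then show ?thesis using nat[of "nat n"] by simp
  next
    case False
    define F where "F = (\<lambda>t::real. t + of_nat (nat (-n)))"
    have "F (finv F t) = t" for t using inv_in(3)[of F t] nat by (simp add: F_def)
    then have "finv F t + of_nat (nat (-n)) = t" for t unfolding F_def .
    then have "finv F = (\<lambda>t. t + of_int n)" using False by (auto simp: fun_eq_iff algebra_simps)
    then show ?thesis using inv_in(1)[of F] nat by (simp add: F_def)
  qed
qed

lemma deriv_periodic: "F \<in> L \<Longrightarrow> deriv F (t + of_int n) = deriv F t"
proof -
  assume F: "F \<in> L"
  have "((\<lambda>t. F (t + of_int n)) has_real_derivative deriv F (t + of_int n)) (at t)"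
    using has_deriv[OF F, of "t + of_int n"] by (simp add: DERIV_shift)
  then have "((\<lambda>t. F t + of_int n) has_real_derivative deriv F (t + of_int n)) (at t)"
    by (simp add: periodic_of_int[OF F])
  moreover have "((\<lambda>t. F t + of_int n) has_real_derivative deriv F t) (at t)"
    using DERIV_add[OF has_deriv[OF F, of t] DERIV_const[of "of_int n"]] by simp
  ultimately show ?thesis by (rule DERIV_unique)
qed

lemma deriv_shift_right: "F \<in> L \<Longrightarrow> deriv (\<lambda>t. F t + of_int n) t = deriv F t"
  using DERIV_add[OF has_deriv[of F t] DERIV_const[of "of_int n"]] by (auto intro!: DERIV_imp_deriv)

lemma higher_deriv_periodic:
  assumes "F \<in> L"
  shows "deriv (deriv F) (t + 1) = deriv (deriv F) t" "deriv (deriv (deriv F)) (t + 1) = deriv (deriv (deriv F)) t"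
proof -
  have *: "deriv g (t + 1) = deriv g t" if "\<And>t. g (t + 1) = g t" for g :: "real \<Rightarrow> real" and t
  proof -
    have "(\<lambda>t. g (t + 1)) = g" using that by auto
    then have "(g has_real_derivative D) (at (t + 1)) \<longleftrightarrow> (g has_real_derivative D) (at t)" for D
      using DERIV_shift[of g D t 1] by simp
    then show ?thesis unfolding deriv_def by simp
  qed
  have 1: "deriv F (t + 1) = deriv F t" for t
    using deriv_periodic[OF assms, of t 1] by simp
  have 2: "deriv (deriv F) (t + 1) = deriv (deriv F) t" for t by (rule *) (rule 1)
  show "deriv (deriv F) (t + 1) = deriv (deriv F) t" by (rule 2)
  show "deriv (deriv (deriv F)) (t + 1) = deriv (deriv (deriv F)) t" by (rule *) (rule 2)
qed

lemma analytic_derivs: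
  assumes "F \<in> L"
  shows "real_analytic (deriv F)" "real_analytic (deriv (deriv F))" "real_analytic (deriv (deriv (deriv F)))"
  using analytic[OF assms] real_analytic_deriv(2) by blast+

lemma deriv_lower_bound: "F \<in> L \<Longrightarrow> \<exists>m>0. \<forall>t. m \<le> deriv F t"
proof -
  assume F: "F \<in> L"
  have "continuous_on UNIV (deriv F)" using analytic_derivs[OF F] real_analytic_continuous by blast
  then have "continuous_on UNIV (\<lambda>t. 1 / deriv F t)"
    using deriv_pos[OF F] by (intro continuous_intros) (auto simp: less_imp_neq[symmetric])
  then obtain M where M: "M \<ge> 0" "\<And>t. \<bar>1 / deriv F t\<bar> \<le> M"
    using periodic_bounded[of "\<lambda>t. 1 / deriv F t"] deriv_periodic[OF F, of _ 1] by auto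
  have "1 / (M + 1) \<le> deriv F t" for t
    using M(1) M(2)[of t] deriv_pos[OF F, of t] by (simp add: field_simps)
  moreover have "1 / (M + 1) > 0" using M by simp
  ultimately show ?thesis by blast
qed

lemma log_lipschitz_ex: "F \<in> L \<Longrightarrow> \<exists>M. log_lipschitz M F"
proof -
  assume F: "F \<in> L"
  have dd: "(deriv F has_real_derivative deriv (deriv F) t) (at t)" for t
    using real_analytic_deriv(1)[OF analytic_derivs(1)[OF F]] .
  have ld: "((\<lambda>t. ln (deriv F t)) has_real_derivative deriv (deriv F) t / deriv F t) (at t)" for t
    using dd deriv_pos[OF F] by (auto intro!: derivative_eq_intros)
  have "continuous_on UNIV (\<lambda>t. deriv (deriv F) t / deriv F t)"
    using analytic_derivs[OF F] real_analytic_continuous deriv_pos[OF F]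
    by (intro continuous_on_divide) (auto simp: less_imp_neq[symmetric])
  then obtain M where M: "M \<ge> 0" "\<And>t. \<bar>deriv (deriv F) t / deriv F t\<bar> \<le> M"
    using periodic_bounded[of "\<lambda>t. deriv (deriv F) t / deriv F t"] deriv_periodic[OF F, of _ 1]
      higher_deriv_periodic[OF F] by auto
  have "\<bar>ln (deriv F s) - ln (deriv F t)\<bar> \<le> M * \<bar>s - t\<bar>" for s t
    using field_differentiable_bound[of UNIV "\<lambda>t. ln (deriv F t)" "\<lambda>t. deriv (deriv F) t / deriv F t" M s t] ld M
    by auto
  then have "log_lipschitz M F" using M(1) incr_diff[OF F] by (auto simp: log_lipschitz_def)
  then show ?thesis by blast
qed

lemma log_lipschitz_finite:
  assumes "finite S" "S \<subseteq> L"
  shows "\<exists>M>0. \<forall>F\<in>S. log_lipschitz M F"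
  using assms
proof (induction S)
  case empty
  then show ?case using zero_less_one by blast
next
  case (insert F S)
  then obtain M1 where "M1 > 0" "\<forall>F\<in>S. log_lipschitz M1 F" by auto
  moreover obtain M2 where "log_lipschitz M2 F" using log_lipschitz_ex insert.prems by auto
  ultimately show ?case by (intro exI[of _ "max M1 M2"]) (auto intro: log_lipschitz_mono)
qed

section \<open>Fixed points of elements of the lift group\<close>

lemma eq_id_if_fixed_points_accumulate:
  assumes F: "F \<in> L" and acc: "\<And>e. e > 0 \<Longrightarrow> \<exists>y. y \<noteq> z \<and> \<bar>y - z\<bar> < e \<and> F y = y"
  shows "F = id"
proof -
  have an: "real_analytic (\<lambda>x. F x - x)"
    by (rule real_analytic_diff[OF analytic[OF F] real_analytic_ident])
  have "\<forall>\<^sub>F h in nhds 0. F (z + h) - (z + h) = 0"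
  proof (rule ccontr)
    assume "\<not> ?thesis"
    then obtain e where "e > 0" "\<And>y. y \<noteq> z \<Longrightarrow> \<bar>y - z\<bar> < e \<Longrightarrow> F y - y \<noteq> 0"
      using real_analytic_isolated_zero[OF an, of z] by blast
    then show False using acc[of e] by auto
  qed
  then have "F y - y = 0" for y using real_analytic_continuation[OF an] by blast
  then show ?thesis by auto
qed

text \<open>Fixed points of a nontrivial element are isolated, so \<open>F - id\<close> has constant
  sign on each side of \<open>z\<close> nearby. \<open>F\<close> and its inverse move points in
  opposite directions, so one of them has the wanted sign; the choice may differ on the two
  sides.\<close>

lemma pushes_right:
  assumes F: "F \<in> L" "F \<noteq> id" "F z = z"
  shows "\<exists>e>0. \<exists>K\<in>{F, finv F}. \<forall>t. z < t \<and> t < z + e \<longrightarrow> t < K t"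
    and "\<exists>e>0. \<exists>K\<in>{F, finv F}. \<forall>t. z - e < t \<and> t < z \<longrightarrow> K t < t"
proof -
  obtain e where e: "e > 0" "\<And>y. y \<noteq> z \<Longrightarrow> \<bar>y - z\<bar> < e \<Longrightarrow> F y \<noteq> y"
    using eq_id_if_fixed_points_accumulate[OF F(1)] F(2) by metis
  have cont: "continuous_on A (\<lambda>t. F t - t)" for A
    by (intro continuous_intros incr_diff_continuous incr_diff F)
  have inv: "finv F t > t \<longleftrightarrow> F t < t" "finv F t < t \<longleftrightarrow> F t > t" for t
    using incr_diff_less_iff[OF incr_diff[OF F(1)]] inv_in(3)[OF F(1)] by metis+
  have sgn: "(\<forall>t\<in>A. t < F t) \<or> (\<forall>t\<in>A. F t < t)" if A: "connected A" "\<And>t. t \<in> A \<Longrightarrow> F t \<noteq> t" for A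
  proof (rule ccontr)
    assume "\<not> ?thesis"
    then obtain s t where st: "s \<in> A" "t \<in> A" "F s \<le> s" "t \<le> F t" by (auto simp: not_less)
    have "connected ((\<lambda>t. F t - t) ` A)" using cont A(1) by (intro connected_continuous_image)
    then have "0 \<in> (\<lambda>t. F t - t) ` A"
      using connectedD_interval[of "(\<lambda>t. F t - t) ` A" "F s - s" "F t - t" 0] st by auto
    then show False using A(2) by auto
  qed
  have "(\<forall>t\<in>{z<..<z+e}. t < F t) \<or> (\<forall>t\<in>{z<..<z+e}. F t < t)" using e by (intro sgn) auto
  then show "\<exists>e>0. \<exists>K\<in>{F, finv F}. \<forall>t. z < t \<and> t < z + e \<longrightarrow> t < K t"
    using e(1) inv by (intro exI[of _ e]) auto
  have "(\<forall>t\<in>{z-e<..<z}. t < F t) \<or> (\<forall>t\<in>{z-e<..<z}. F t < t)" using e by (intro sgn) auto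
  then show "\<exists>e>0. \<exists>K\<in>{F, finv F}. \<forall>t. z - e < t \<and> t < z \<longrightarrow> K t < t"
    using e(1) inv by (intro exI[of _ e]) auto
qed

text \<open>First and second order Taylor estimates; the second derivative is bounded because it is
  continuous and periodic.\<close>

lemma tangent_to_identity:
  assumes F: "F \<in> L" "F z = z" "deriv F z = 1"
  shows "\<exists>D>0. \<forall>y. \<bar>y - z\<bar> \<le> 1 \<longrightarrow> \<bar>F y - y\<bar> \<le> D * (y - z)\<^sup>2"
    and "\<exists>D>0. \<forall>y. \<bar>y - z\<bar> \<le> 1 \<longrightarrow> \<bar>deriv F y - 1\<bar> \<le> D * \<bar>y - z\<bar>"
proof -
  have "continuous_on UNIV (deriv (deriv F))" using analytic_derivs[OF F(1)] real_analytic_continuous by blast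
  then obtain D where D: "D \<ge> 0" "\<And>t. \<bar>deriv (deriv F) t\<bar> \<le> D"
    using periodic_bounded[of "deriv (deriv F)"] higher_deriv_periodic[OF F(1)] by blast
  have dd: "(deriv F has_real_derivative deriv (deriv F) t) (at t)" for t
    using real_analytic_deriv(1)[OF analytic_derivs(1)[OF F(1)]] .
  have 1: "\<bar>deriv F y - 1\<bar> \<le> D * \<bar>y - z\<bar>" for y
    using field_differentiable_bound[of UNIV "deriv F" "deriv (deriv F)" D y z] dd D F(3) by auto
  have 2: "\<bar>F y - y\<bar> \<le> D * (y - z)\<^sup>2" for y
  proof -
    have "\<bar>(F y - y) - (F z - z)\<bar> \<le> (D * \<bar>y - z\<bar>) * \<bar>y - z\<bar>"
    proof (rule field_differentiable_bound[of "closed_segment z y" "\<lambda>t. F t - t" "\<lambda>t. deriv F t - 1", unfolded real_norm_def])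
      show "((\<lambda>t. F t - t) has_real_derivative deriv F t - 1) (at t within closed_segment z y)" for t
        by (rule has_field_derivative_at_within, rule DERIV_diff[OF has_deriv[OF F(1)] DERIV_ident])
      show "\<bar>deriv F t - 1\<bar> \<le> D * \<bar>y - z\<bar>" if "t \<in> closed_segment z y" for t
      proof -
        have "\<bar>t - z\<bar> \<le> \<bar>y - z\<bar>" using that by (auto simp: closed_segment_eq_real_ivl split: if_splits)
        then show ?thesis using 1[of t] D(1) by (meson mult_left_mono order_trans)
      qed
    qed auto
    then show ?thesis using F(2) by (simp add: power2_eq_square mult.assoc)
  qed
  have 3: "D * w \<le> (D + 1) * w" if "w \<ge> 0" for w using that by (simp add: distrib_right)
  show "\<exists>D>0. \<forall>y. \<bar>y - z\<bar> \<le> 1 \<longrightarrow> \<bar>F y - y\<bar> \<le> D * (y - z)\<^sup>2"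
    using D(1) order_trans[OF 2 3] by (intro exI[of _ "D + 1"]) simp
  show "\<exists>D>0. \<forall>y. \<bar>y - z\<bar> \<le> 1 \<longrightarrow> \<bar>deriv F y - 1\<bar> \<le> D * \<bar>y - z\<bar>"
    using D(1) order_trans[OF 1 3] by (intro exI[of _ "D + 1"]) simp
qed

lemma continuous_near:
  assumes "K \<in> L" "K z = z" "e > 0"
  shows "\<exists>d>0. \<forall>t. \<bar>t - z\<bar> < d \<longrightarrow> \<bar>K t - z\<bar> < e"
proof -
  have "isCont K z" using has_deriv[OF assms(1)] DERIV_isCont by blast
  then show ?thesis using assms(2,3) unfolding continuous_at_eps_delta by (auto simp: dist_real_def)
qed

text \<open>By tangency the displacement \<open>K y - y\<close> is at most a multiple of
  \<open>(y - z)^2\<close>, which replaces it as the scale of the one-sided exits. This quadratic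
  scale is the source of the squares in \<open>phi_near_t0\<close> and
  \<open>separation\<close>.\<close>

lemma parabolic_exit:
  assumes F: "F \<in> L" "F \<noteq> id" "F z = z" "deriv F z = 1"
  shows "\<exists>e>0. \<exists>C\<ge>1. \<forall>y. 0 < \<bar>y - z\<bar> \<and> \<bar>y - z\<bar> < e \<longrightarrow> (\<exists>K\<in>{F, finv F}. exits C ((y - z)\<^sup>2) K y)"
proof -
  have KL: "K \<in> L" "K z = z" "deriv K z = 1" if "K \<in> {F, finv F}" for K
  proof -
    have "finv F z = z" using inv_in(2)[OF F(1), of z] F(3) by simp
    moreover have "deriv (finv F) z = 1" using deriv_inv[OF F(1), of z] F(3,4) by simp
    ultimately show "K \<in> L" "K z = z" "deriv K z = 1" using that F inv_in(1)[OF F(1)] by auto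
  qed
  have near: "\<exists>d>0. \<forall>t. \<bar>t - z\<bar> < d \<longrightarrow> \<bar>K (K t) - z\<bar> < \<epsilon>" if "K \<in> {F, finv F}" "\<epsilon> > 0" for K \<epsilon>
    using continuous_near[of "K \<circ> K" z \<epsilon>] comp_in KL[OF that(1)] that(2) by simp
  have square: "\<exists>C\<ge>1. \<forall>y\<in>A \<inter> cball z 1. exits C ((y - z)\<^sup>2) K y"
    if K: "K \<in> {F, finv F}" and ex: "\<exists>C\<ge>1. \<forall>y\<in>A. exits C \<bar>K y - y\<bar> K y" for K and A :: "real set"
  proof -
    obtain C where C: "C \<ge> 1" "\<forall>y\<in>A. exits C \<bar>K y - y\<bar> K y" using ex by blast
    obtain D where D: "D > 0" "\<And>y. \<bar>y - z\<bar> \<le> 1 \<Longrightarrow> \<bar>K y - y\<bar> \<le> D * (y - z)\<^sup>2"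
      using tangent_to_identity(1)[OF KL[OF K]] by blast
    have "exits (C * max 1 D) ((y - z)\<^sup>2) K y" if y: "y \<in> A" "\<bar>y - z\<bar> \<le> 1" for y
    proof (rule exits_mono[OF bspec[OF C(2) y(1)] incr_diff[OF KL(1)[OF K]]])
      have "C * 1 \<le> C * max 1 D" using C(1) by (intro mult_left_mono) auto
      then show "C \<le> C * max 1 D" by simp
      have "D * (y - z)\<^sup>2 \<le> max 1 D * (y - z)\<^sup>2" by (intro mult_right_mono) auto
      then have "C * \<bar>K y - y\<bar> \<le> C * (max 1 D * (y - z)\<^sup>2)" using C(1) D(2)[OF y(2)] by (intro mult_left_mono) auto
      then show "C * \<bar>K y - y\<bar> \<le> C * max 1 D * (y - z)\<^sup>2" by (simp only: mult.assoc)
    qed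
    moreover have "1 * 1 \<le> C * max 1 D" using C(1) by (intro mult_mono) auto
    ultimately show ?thesis by (intro exI[of _ "C * max 1 D"]) (auto simp: dist_real_def abs_minus_commute)
  qed
  obtain w1 K1 where 1: "z < w1" "K1 \<in> {F, finv F}" "\<exists>C\<ge>1. \<forall>y\<in>{z<..<w1}. exits C \<bar>K1 y - y\<bar> K1 y"
  proof -
    obtain e K where e: "e > 0" and K: "K \<in> {F, finv F}" and push: "\<And>t. z < t \<Longrightarrow> t < z + e \<Longrightarrow> t < K t"
      using pushes_right(1)[OF F(1,2,3)] by blast
    obtain M where M: "log_lipschitz M K" using log_lipschitz_ex KL(1)[OF K] by blast
    \<comment> \<open>Two applications of \<open>K\<close> must stay in the region where
      \<open>K\<close> pushes to the right and within distance 1 of \<open>z\<close>, as the right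
      exit requires.\<close>
    obtain d where d: "d > 0" "\<And>t. \<bar>t - z\<bar> < d \<Longrightarrow> \<bar>K (K t) - z\<bar> < min e 1"
      using near[OF K, of "min e 1"] e by auto
    define w where "w = z + min d e / 2"
    have w: "z < w" "\<bar>w - z\<bar> < d" "w < z + e" using d e by (auto simp: w_def)
    have KK: "K (K w) < z + e" "K (K w) \<le> z + 1" using d(2)[OF w(2)] by auto
    have wK: "w < K w" using push w by blast
    then have "K w < K (K w)" using incr_diff_less_iff[OF incr_diff[OF KL(1)[OF K]]] by blast
    then have "\<exists>C\<ge>1. \<forall>y\<in>{z<..<w}. exits C \<bar>K y - y\<bar> K y"
      using w KK wK push KL[OF K] by (intro parabolic_exit_right[OF M]) auto
    then show thesis using that w(1) K by blast
  qed
  obtain w2 K2 where 2: "w2 < z" "K2 \<in> {F, finv F}" "\<exists>C\<ge>1. \<forall>y\<in>{w2<..<z}. exits C \<bar>K2 y - y\<bar> K2 y"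
  proof -
    obtain e K where e: "e > 0" and K: "K \<in> {F, finv F}" and push: "\<And>t. z - e < t \<Longrightarrow> t < z \<Longrightarrow> K t < t"
      using pushes_right(2)[OF F(1,2,3)] by blast
    obtain M where M: "log_lipschitz M K" using log_lipschitz_ex KL(1)[OF K] by blast
    obtain d where d: "d > 0" "\<And>t. \<bar>t - z\<bar> < d \<Longrightarrow> \<bar>K (K t) - z\<bar> < min e 1"
      using near[OF K, of "min e 1"] e by auto
    define w where "w = z - min d e / 2"
    have w: "w < z" "\<bar>w - z\<bar> < d" "z - e < w" using d e by (auto simp: w_def)
    have KK: "z - e < K (K w)" "z - 1 \<le> K (K w)" using d(2)[OF w(2)] by auto
    have wK: "K w < w" using push w by blast
    then have "K (K w) < K w" using incr_diff_less_iff[OF incr_diff[OF KL(1)[OF K]]] by blast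
    then have "\<exists>C\<ge>1. \<forall>y\<in>{w<..<z}. exits C \<bar>K y - y\<bar> K y"
      using w KK wK push KL[OF K] by (intro parabolic_exit_left[OF M]) auto
    then show thesis using that w(1) K by blast
  qed
  obtain C1 where C1: "C1 \<ge> 1" "\<forall>y\<in>{z<..<w1} \<inter> cball z 1. exits C1 ((y - z)\<^sup>2) K1 y" using square[OF 1(2,3)] by blast
  obtain C2 where C2: "C2 \<ge> 1" "\<forall>y\<in>{w2<..<z} \<inter> cball z 1. exits C2 ((y - z)\<^sup>2) K2 y" using square[OF 2(2,3)] by blast
  have up: "exits (max C1 C2) ((y - z)\<^sup>2) K y" if "exits C ((y - z)\<^sup>2) K y" "K \<in> {F, finv F}" "C \<le> max C1 C2" for C K y
    using exits_mono[OF that(1) incr_diff[OF KL(1)[OF that(2)]] that(3)] that(3) by (simp add: mult_right_mono)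
  have "\<exists>K\<in>{F, finv F}. exits (max C1 C2) ((y - z)\<^sup>2) K y"
    if y: "0 < \<bar>y - z\<bar>" "\<bar>y - z\<bar> < min 1 (min (w1 - z) (z - w2))" for y
  proof (cases "z < y")
    case True
    then have "y \<in> {z<..<w1} \<inter> cball z 1" using y by (auto simp: dist_real_def)
    then show ?thesis using up C1(2) 1(2) by (meson max.cobounded1)
  next
    case False
    then have "y \<in> {w2<..<z} \<inter> cball z 1" using y by (auto simp: dist_real_def)
    then show ?thesis using up C2(2) 2(2) by (meson max.cobounded2)
  qed
  then show ?thesis using 1(1) 2(1) C1(1)
    by (intro exI[of _ "min 1 (min (w1 - z) (z - w2))"] conjI exI[of _ "max C1 C2"]) auto
qed

end

section \<open>Expansion with bounded distortion\<close>

text \<open>The cost adds up the derivatives at \<open>x\<close> of the proper prefixes of the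
  composition, starting with \<open>id\<close> and leaving out the complete word. Up to distortion
  it is the total length of the intermediate images of a short interval around \<open>x\<close>, in
  units of its length.\<close>

inductive word_with_cost :: "(real \<Rightarrow> real) set \<Rightarrow> real \<Rightarrow> (real \<Rightarrow> real) \<Rightarrow> real \<Rightarrow> bool"
  for S x where
  empty: "word_with_cost S x id 0"
| extend: "word_with_cost S x F \<sigma> \<Longrightarrow> K \<in> S \<Longrightarrow> word_with_cost S x (K \<circ> F) (\<sigma> + deriv F x)"

text \<open>A bootstrap: as long as \<open>M * exp 1 * \<sigma> * \<bar>t - x\<bar>\<close> is at
  most 1, the logarithmic distortion is at most 1. Hence the current image of the interval from
  \<open>x\<close> to \<open>t\<close> has length at most
  \<open>exp 1 * deriv F x * \<bar>t - x\<bar>\<close>, and the next letter \<open>K\<close> adds at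
  most \<open>M\<close> times this length.\<close>

lemma word_distortion:
  assumes "word_with_cost S x F \<sigma>" and S: "\<And>K. K \<in> S \<Longrightarrow> log_lipschitz M K"
  shows "incr_diff F \<and> 0 \<le> \<sigma> \<and> (\<forall>t. M * exp 1 * \<sigma> * \<bar>t - x\<bar> \<le> 1 \<longrightarrow>
    \<bar>ln (deriv F t) - ln (deriv F x)\<bar> \<le> M * exp 1 * \<sigma> * \<bar>t - x\<bar>)"
  using assms(1)
proof induction
  case empty
  show ?case by (intro conjI incr_diff_id(1)) simp_all
next
  case (extend F \<sigma> K)
  then have F: "incr_diff F" and \<sigma>: "0 \<le> \<sigma>" and
    IH: "\<And>t. M * exp 1 * \<sigma> * \<bar>t - x\<bar> \<le> 1 \<Longrightarrow> \<bar>ln (deriv F t) - ln (deriv F x)\<bar> \<le> M * exp 1 * \<sigma> * \<bar>t - x\<bar>"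
    by blast+
  have K: "log_lipschitz M K" using S extend by blast
  then have Kd: "incr_diff K" and M: "0 \<le> M" by (auto dest: log_lipschitzD)
  have pos: "0 < deriv F s" "0 < deriv K s" for s using F Kd incr_diffD(2) by blast+
  show ?case
  proof (intro conjI allI impI)
    show "incr_diff (K \<circ> F)" using incr_diff_comp F Kd by blast
    show "0 \<le> \<sigma> + deriv F x" using \<sigma> pos(1)[of x] by simp
    fix t assume t: "M * exp 1 * (\<sigma> + deriv F x) * \<bar>t - x\<bar> \<le> 1"
    have small: "M * exp 1 * \<sigma> * \<bar>s - x\<bar> \<le> 1" if "\<bar>s - x\<bar> \<le> \<bar>t - x\<bar>" for s
    proof -
      have "M * exp 1 * \<sigma> * \<bar>s - x\<bar> \<le> M * exp 1 * (\<sigma> + deriv F x) * \<bar>t - x\<bar>"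
        using M \<sigma> pos[of x] that by (intro mult_mono) auto
      then show ?thesis using t by linarith
    qed
    have F_le: "\<bar>F t - F x\<bar> \<le> exp 1 * deriv F x * \<bar>t - x\<bar>"
    proof (rule field_differentiable_bound[of "closed_segment x t" F "deriv F", unfolded real_norm_def])
      show "(F has_real_derivative deriv F s) (at s within closed_segment x t)" for s
        by (rule has_field_derivative_at_within, rule incr_diffD(1)[OF F])
      fix s assume "s \<in> closed_segment x t"
      then have "\<bar>s - x\<bar> \<le> \<bar>t - x\<bar>" by (auto simp: closed_segment_eq_real_ivl split: if_splits)
      then have "\<bar>ln (deriv F s) - ln (deriv F x)\<bar> \<le> 1" using IH small by (meson order_trans)
      then have "ln (deriv F s) \<le> ln (exp 1 * deriv F x)" using pos by (simp add: ln_mult_pos)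
      then show "\<bar>deriv F s\<bar> \<le> exp 1 * deriv F x" using pos[of s] pos[of x] by simp
    qed auto
    have "\<bar>ln (deriv K (F t)) - ln (deriv K (F x))\<bar> \<le> M * \<bar>F t - F x\<bar>"
      using log_lipschitzD(3)[OF K] .
    also have "\<dots> \<le> M * (exp 1 * deriv F x * \<bar>t - x\<bar>)" using F_le M by (intro mult_left_mono)
    finally have 1: "\<bar>ln (deriv K (F t)) - ln (deriv K (F x))\<bar> \<le> M * exp 1 * deriv F x * \<bar>t - x\<bar>"
      by (simp only: mult.assoc)
    have 2: "\<bar>ln (deriv F t) - ln (deriv F x)\<bar> \<le> M * exp 1 * \<sigma> * \<bar>t - x\<bar>"
      using IH small by blast
    have 3: "ln (deriv (K \<circ> F) s) = ln (deriv K (F s)) + ln (deriv F s)" for s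
      unfolding incr_diff_comp(2)[OF Kd F] using pos by (intro ln_mult_pos)
    show "\<bar>ln (deriv (K \<circ> F) t) - ln (deriv (K \<circ> F) x)\<bar> \<le> M * exp 1 * (\<sigma> + deriv F x) * \<bar>t - x\<bar>"
      using 1 2 unfolding 3 by (simp only: distrib_left distrib_right)
  qed
qed

section \<open>The weight of orbit points and their separation\<close>

context lift_group
begin

definition X :: "real set"
  where "X = (\<lambda>F. F t0) ` L"

definition phi :: "real \<Rightarrow> real"
  where "phi y = deriv (SOME F. F \<in> L \<and> F t0 = y) t0"

text \<open>\<open>F\<close> and its inverse both fix \<open>t0\<close>, so both derivatives are at
  most 1, while their product is 1.\<close>

lemma stab_deriv:
  assumes "F \<in> L" "F t0 = t0"
  shows "deriv F t0 = 1"
proof -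
  have "deriv (finv F) t0 * deriv F t0 = 1" using deriv_inv[OF assms(1), of t0] assms(2) by simp
  moreover have "deriv (finv F) t0 \<le> 1" "deriv F t0 \<le> 1" "0 < deriv F t0"
    using nonexp inv_in(1) assms(1) deriv_pos by blast+
  ultimately show ?thesis by (smt (verit, best) mult_left_le_one_le mult_le_cancel_right1)
qed

lemma phi_eq:
  assumes F: "F \<in> L"
  shows "phi (F t0) = deriv F t0"
proof -
  define H where "H = (SOME H. H \<in> L \<and> H t0 = F t0)"
  have H: "H \<in> L" "H t0 = F t0"
    unfolding H_def using someI_ex[of "\<lambda>H. H \<in> L \<and> H t0 = F t0"] F by blast+
  have "finv F \<circ> H \<in> L" "(finv F \<circ> H) t0 = t0" using H F inv_in comp_in by auto
  then have "deriv (finv F) (F t0) * deriv H t0 = 1"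
    using stab_deriv deriv_comp[of "finv F" H t0] inv_in(1)[OF F] H by simp
  moreover have "deriv (finv F) (F t0) * deriv F t0 = 1" using deriv_inv[OF F] .
  ultimately have "deriv (finv F) (F t0) * (deriv H t0 - deriv F t0) = 0"
    by (simp add: right_diff_distrib)
  then show ?thesis
    using deriv_pos[OF inv_in(1)[OF F]] unfolding phi_def H_def[symmetric] by (auto simp: less_le)
qed

lemma XI: "F \<in> L \<Longrightarrow> F t0 \<in> X"
  by (simp add: X_def)

lemma XE:
  assumes "y \<in> X"
  obtains F where "F \<in> L" "F t0 = y"
  using assms by (auto simp: X_def)

lemma phi_image:
  assumes "F \<in> L" "y \<in> X"
  shows "F y \<in> X" "phi (F y) = deriv F y * phi y"
proof -
  obtain H where H: "H \<in> L" "H t0 = y" using XE assms(2) by blast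
  then show "F y \<in> X" "phi (F y) = deriv F y * phi y"
    using XI[OF comp_in[OF assms(1) H(1)]] phi_eq[OF comp_in[OF assms(1) H(1)]] phi_eq[OF H(1)]
      deriv_comp[OF assms(1) H(1)] by simp_all
qed

lemma phi_bounds: "y \<in> X \<Longrightarrow> 0 < phi y" "y \<in> X \<Longrightarrow> phi y \<le> 1"
  using phi_eq deriv_pos nonexp by (auto elim!: XE)

lemma X_shift: "y \<in> X \<Longrightarrow> y + of_int n \<in> X" "y \<in> X \<Longrightarrow> phi (y + of_int n) = phi y"
  using phi_image[OF shift_in[of n], of y] deriv_shift_right[OF id_in, of n y] incr_diff_id by (simp_all add: id_def)

text \<open>At an expandable \<open>z\<close> one map expands a neighbourhood by continuity.
  Otherwise property (star) gives a nontrivial element fixing \<open>z\<close>, with derivative 1 as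
  in \<open>stab_deriv\<close>, and the exit from \<open>z\<close> expands by at least
  \<open>1 / (C * (y - z)^2)\<close>, which is large near \<open>z\<close>. The point
  \<open>z\<close> itself is the exception.\<close>

lemma local_expansion:
  "\<exists>e>0. \<exists>l>1. \<exists>C\<ge>1. \<exists>S. finite S \<and> S \<subseteq> L \<and> (\<forall>y. \<bar>y - z\<bar> < e \<longrightarrow> y = z \<or>
    (\<exists>K\<in>S. \<exists>n\<ge>1. l \<le> deriv (K ^^ n) y \<and> (\<Sum>i=1..n. deriv (K ^^ i) y) \<le> C * deriv (K ^^ n) y))"
proof (cases "\<forall>F\<in>L. deriv F z \<le> 1")
  case False
  then obtain F where F: "F \<in> L" "1 < deriv F z" by (auto simp: not_le)
  define l where "l = (1 + deriv F z) / 2"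
  have l: "1 < l" "l < deriv F z" using F by (auto simp: l_def)
  have "isCont (deriv F) z"
    using real_analytic_continuous[OF analytic_derivs(1)[OF F(1)], of UNIV]
    by (simp add: continuous_on_eq_continuous_at)
  then obtain e where e: "e > 0" "\<And>y. \<bar>y - z\<bar> < e \<Longrightarrow> \<bar>deriv F y - deriv F z\<bar> < deriv F z - l"
    unfolding continuous_at_eps_delta dist_real_def using l by (metis diff_gt_0_iff_gt)
  have "l \<le> deriv (F ^^ 1) y \<and> (\<Sum>i=1..1::nat. deriv (F ^^ i) y) \<le> 1 * deriv (F ^^ 1) y" if "\<bar>y - z\<bar> < e" for y
    using e(2)[OF that] by auto
  then have "\<exists>n\<ge>1. l \<le> deriv (F ^^ n) y \<and> (\<Sum>i=1..n. deriv (F ^^ i) y) \<le> 1 * deriv (F ^^ n) y"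
    if "\<bar>y - z\<bar> < e" for y using that by blast
  then show ?thesis using e(1) l(1) F(1)
    by (intro exI[of _ e] conjI exI[of _ l] exI[of _ 1] exI[of _ "{F}"]) auto
next
  case True
  then obtain F where F: "F \<in> L" "F \<noteq> id" "F z = z" using star by blast
  have "deriv (finv F) z * deriv F z = 1" using deriv_inv[OF F(1), of z] F(3) by simp
  moreover have "deriv (finv F) z \<le> 1" "deriv F z \<le> 1" "0 < deriv F z"
    using True inv_in(1) F(1) deriv_pos by blast+
  ultimately have d: "deriv F z = 1" by (smt (verit, best) mult_left_le_one_le mult_le_cancel_right1)
  obtain e C where e: "e > 0" "C \<ge> 1" and ex: "\<And>y. 0 < \<bar>y - z\<bar> \<Longrightarrow> \<bar>y - z\<bar> < e \<Longrightarrow>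
    \<exists>K\<in>{F, finv F}. \<exists>n\<ge>1. 1 \<le> C * (y - z)\<^sup>2 * deriv (K ^^ n) y \<and>
      (\<Sum>i=1..n. deriv (K ^^ i) y) \<le> C * deriv (K ^^ n) y"
    using parabolic_exit[OF F d] unfolding exits_def by blast
  \<comment> \<open>With this radius \<open>C * (y - z)^2\<close> is at most 1/2, so the exit
    expands at least by the factor 2.\<close>
  define e' where "e' = min e (1 / (2 * C))"
  have e': "e' > 0" "e' \<le> e" "e' \<le> 1 / (2 * C)" using e by (auto simp: e'_def)
  have "\<exists>K\<in>{F, finv F}. \<exists>n\<ge>1. 2 \<le> deriv (K ^^ n) y \<and> (\<Sum>i=1..n. deriv (K ^^ i) y) \<le> C * deriv (K ^^ n) y"
    if y: "\<bar>y - z\<bar> < e'" "y \<noteq> z" for y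
  proof -
    obtain K n where K: "K \<in> {F, finv F}" "n \<ge> 1" "1 \<le> C * (y - z)\<^sup>2 * deriv (K ^^ n) y"
      "(\<Sum>i=1..n. deriv (K ^^ i) y) \<le> C * deriv (K ^^ n) y" using ex[of y] y e' by auto
    have "K ^^ n \<in> L" using K(1) funpow_in F(1) inv_in(1)[OF F(1)] by blast
    then have pos: "0 < deriv (K ^^ n) y" using deriv_pos by blast
    have a: "\<bar>y - z\<bar> \<le> 1 / (2 * C)" using y e' by linarith
    have "C * (y - z)\<^sup>2 \<le> C * (1 / (2 * C))\<^sup>2"
      using e a power_mono[OF a, of 2] by (intro mult_left_mono) auto
    also have "\<dots> \<le> 1 / 2" using e by (simp add: power2_eq_square field_simps)
    finally have "C * (y - z)\<^sup>2 * deriv (K ^^ n) y \<le> 1 / 2 * deriv (K ^^ n) y"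
      using pos by (intro mult_right_mono) auto
    then have "2 \<le> deriv (K ^^ n) y" using K(3) by simp
    then show ?thesis using K by blast
  qed
  then have all: "\<forall>y. \<bar>y - z\<bar> < e' \<longrightarrow> y = z \<or> (\<exists>K\<in>{F, finv F}. \<exists>n\<ge>1. 2 \<le> deriv (K ^^ n) y \<and>
      (\<Sum>i=1..n. deriv (K ^^ i) y) \<le> C * deriv (K ^^ n) y)" by blast
  have fin: "finite {F, finv F}" "{F, finv F} \<subseteq> L" using F(1) inv_in(1) by auto
  show ?thesis
    by (intro exI[of _ e'] conjI e'(1) exI[of _ "2::real"] exI[of _ C] e(2) exI[of _ "{F, finv F}"] fin all) simp
qed

text \<open>Compactness of one period makes the rates uniform: \<open>l\<close> is the smallest and
  \<open>C\<close> the largest of finitely many local constants. The exceptional set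
  \<open>Z\<close> consists of the centres of the covering intervals.\<close>

lemma global_expansion:
  "\<exists>Z S l C. finite Z \<and> finite S \<and> S \<subseteq> L \<and> 1 < l \<and> 1 \<le> C \<and>
    (\<forall>y. (\<exists>m. y + of_int m \<in> Z) \<or>
    (\<exists>K\<in>S. \<exists>n\<ge>1. l \<le> deriv (K ^^ n) y \<and> (\<Sum>i=1..n. deriv (K ^^ i) y) \<le> C * deriv (K ^^ n) y))"
proof -
  \<comment> \<open>Radius, rate, constant and finite set are packed into one tuple, so that a
    single choice function of \<open>z\<close> suffices.\<close>
  have "\<exists>q. fst q > 0 \<and> fst (snd q) > 1 \<and> fst (snd (snd q)) \<ge> 1 \<and> finite (snd (snd (snd q))) \<and> snd (snd (snd q)) \<subseteq> L \<and>
    (\<forall>y. \<bar>y - z\<bar> < fst q \<longrightarrow> y = z \<or>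
    (\<exists>K\<in>snd (snd (snd q)). \<exists>n\<ge>1. fst (snd q) \<le> deriv (K ^^ n) y \<and>
      (\<Sum>i=1..n. deriv (K ^^ i) y) \<le> fst (snd (snd q)) * deriv (K ^^ n) y))" for z
    using local_expansion[of z] by simp
  then obtain q where q: "\<And>z. fst (q z) > 0 \<and> fst (snd (q z)) > 1 \<and> fst (snd (snd (q z))) \<ge> 1 \<and>
    finite (snd (snd (snd (q z)))) \<and> snd (snd (snd (q z))) \<subseteq> L \<and>
    (\<forall>y. \<bar>y - z\<bar> < fst (q z) \<longrightarrow> y = z \<or>
    (\<exists>K\<in>snd (snd (snd (q z))). \<exists>n\<ge>1. fst (snd (q z)) \<le> deriv (K ^^ n) y \<and>
      (\<Sum>i=1..n. deriv (K ^^ i) y) \<le> fst (snd (snd (q z))) * deriv (K ^^ n) y))" by metis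
  define e l C S where "e z = fst (q z)" and "l z = fst (snd (q z))" and "C z = fst (snd (snd (q z)))"
    and "S z = snd (snd (snd (q z)))" for z
  have e: "e z > 0" and l: "l z > 1" and C: "C z \<ge> 1" and S: "finite (S z)" "S z \<subseteq> L"
    and ex: "\<And>y. \<bar>y - z\<bar> < e z \<Longrightarrow> y \<noteq> z \<Longrightarrow> \<exists>K\<in>S z. \<exists>n\<ge>1. l z \<le> deriv (K ^^ n) y \<and>
      (\<Sum>i=1..n. deriv (K ^^ i) y) \<le> C z * deriv (K ^^ n) y" for z
    using q[of z] unfolding e_def l_def C_def S_def by blast+
  have "{0..1::real} \<subseteq> (\<Union>z\<in>{0..1}. ball z (e z))" using e by auto
  then obtain Z where Z: "Z \<subseteq> {0..1}" "finite Z" "{0..1} \<subseteq> (\<Union>z\<in>Z. ball z (e z))"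
    using compactE_image[of "{0..1::real}" "{0..1}" "\<lambda>z. ball z (e z)"] by auto
  have "0 \<in> {0..1::real}" by simp
  then have ne: "Z \<noteq> {}" using Z(3) by blast
  define l0 C0 S0 where "l0 = Min (l ` Z)" and "C0 = Max (C ` Z)" and "S0 = (\<Union>z\<in>Z. S z)"
  have l0: "1 < l0" "\<And>z. z \<in> Z \<Longrightarrow> l0 \<le> l z" using Z(2) ne l by (auto simp: l0_def)
  have C0: "1 \<le> C0" "\<And>z. z \<in> Z \<Longrightarrow> C z \<le> C0"
    using Z(2) ne C by (auto simp: C0_def) (meson C Max_ge finite_imageI imageI order_trans ex_in_conv)
  have S0: "finite S0" "S0 \<subseteq> L" using Z(2) S by (auto simp: S0_def)
  have "(\<exists>m. y + of_int m \<in> Z) \<or>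
    (\<exists>K\<in>S0. \<exists>n\<ge>1. l0 \<le> deriv (K ^^ n) y \<and> (\<Sum>i=1..n. deriv (K ^^ i) y) \<le> C0 * deriv (K ^^ n) y)" for y
  proof -
    have fy: "frac y = y + of_int (- \<lfloor>y\<rfloor>)" by (simp add: frac_def)
    have "frac y \<in> {0..1}" using frac_ge_0[of y] frac_lt_1[of y] by simp
    then have "frac y \<in> (\<Union>z\<in>Z. ball z (e z))" using Z(3) by blast
    then obtain z where z: "z \<in> Z" "\<bar>frac y - z\<bar> < e z" by (auto simp: dist_real_def abs_minus_commute)
    show ?thesis
    proof (cases "frac y = z")
      case True
      then show ?thesis using z(1) fy by metis
    next
      case False
      then obtain K n where K: "K \<in> S z" "n \<ge> 1" "l z \<le> deriv (K ^^ n) (frac y)"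
        "(\<Sum>i=1..n. deriv (K ^^ i) (frac y)) \<le> C z * deriv (K ^^ n) (frac y)"
        using ex[OF z(2)] by blast
      have "K \<in> L" using K(1) S by blast
      then have eq: "deriv (K ^^ i) (frac y) = deriv (K ^^ i) y" for i
        unfolding fy by (intro deriv_periodic funpow_in)
      have "0 < deriv (K ^^ n) y" using deriv_pos funpow_in \<open>K \<in> L\<close> by blast
      then have "C z * deriv (K ^^ n) y \<le> C0 * deriv (K ^^ n) y" using C0(2)[OF z(1)] by (intro mult_right_mono) auto
      then show ?thesis using K l0(2)[OF z(1)] z(1) unfolding eq
        by (intro disjI2 bexI[of _ K] exI[of _ n]) (auto simp: S0_def)
    qed
  qed
  then show ?thesis using Z(2) S0 l0(1) C0(1) by blast
qed

lemma finv_funpow: "F \<in> L \<Longrightarrow> j \<le> n \<Longrightarrow> (finv F ^^ j) ((F ^^ n) y) = (F ^^ (n - j)) y"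
proof (induction j)
  case (Suc j)
  then have "(F ^^ (n - j)) y = F ((F ^^ (n - Suc j)) y)"
    by (metis Suc_diff_Suc Suc_le_lessD comp_apply funpow.simps(2))
  then show ?case using Suc inv_in(2) by simp
qed simp

text \<open>Expand \<open>y\<close> again and again. Each round multiplies \<open>phi\<close> by at
  least \<open>l\<close>, but \<open>phi\<close> stays at most 1, so a translate of a point of
  \<open>Z\<close> is reached after finitely many rounds. Running the path backwards from
  \<open>t0\<close> gives a word whose prefixes have as derivatives at \<open>t0\<close> the values
  of \<open>phi\<close> along the path. Their sum is bounded independently of \<open>y\<close>, so
  \<open>word_distortion\<close> yields one neighbourhood for all \<open>y\<close>.\<close>

lemma normalization:
  "\<exists>d>0. \<forall>y\<in>X. \<exists>F\<in>L. F t0 = y \<and> (\<forall>t. \<bar>t - t0\<bar> \<le> d \<longrightarrow> phi y \<le> exp 1 * deriv F t \<and> deriv F t \<le> exp 1 * phi y)"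
proof -
  obtain Z S l C where Z: "finite Z" and S: "finite S" "S \<subseteq> L" and l: "1 < l" and C: "1 \<le> C" and
    ex: "\<And>y. (\<exists>m. y + of_int m \<in> Z) \<or>
    (\<exists>K\<in>S. \<exists>n\<ge>1. l \<le> deriv (K ^^ n) y \<and> (\<Sum>i=1..n. deriv (K ^^ i) y) \<le> C * deriv (K ^^ n) y)"
    using global_expansion by blast
  define conn where "conn z = (SOME F. F \<in> L \<and> F t0 = z)" for z
  have conn: "conn z \<in> L" "conn z t0 = z" if "z \<in> X" for z
    unfolding conn_def using someI_ex[of "\<lambda>F. F \<in> L \<and> F t0 = z"] that by (auto elim!: XE)
  define T where "T = finv ` S \<union> conn ` (Z \<inter> X)"
  have T: "finite T" "T \<subseteq> L" using Z S inv_in(1) conn by (auto simp: T_def)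
  obtain M where M: "M > 0" "\<And>K. K \<in> T \<Longrightarrow> log_lipschitz M K" using log_lipschitz_finite[OF T] by blast
  \<comment> \<open>A round from \<open>y\<close> to \<open>w\<close> costs at most
    \<open>C * phi w\<close>. Since \<open>phi y \<le> phi w / l\<close>, this is at most
    \<open>M0 * (phi w - phi y)\<close>, so the costs telescope.\<close>
  define M0 where "M0 = max 1 (C / (1 - 1 / l))"
  have M0: "M0 \<ge> 1" "C \<le> M0 * (1 - 1 / l)"
  proof -
    show "M0 \<ge> 1" by (simp add: M0_def)
    have "C / (1 - 1 / l) * (1 - 1 / l) \<le> M0 * (1 - 1 / l)" using l by (intro mult_right_mono) (auto simp: M0_def)
    then show "C \<le> M0 * (1 - 1 / l)" using l by simp
  qed
  have word_in: "F \<in> L" if "word_with_cost T t0 F \<sigma>" for F \<sigma>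
    using that
  proof induction
    case empty
    show ?case by (rule id_in)
  next
    case (extend F \<sigma> K)
    then show ?case using T comp_in by blast
  qed
  have connect: "\<exists>F \<sigma> m. word_with_cost T t0 F \<sigma> \<and> F t0 = y + of_int m \<and> \<sigma> \<le> M0 * (2 - phi y)"
    if y: "y \<in> X" and m: "\<exists>m. y + of_int m \<in> Z" for y
  proof -
    obtain m where m: "y + of_int m \<in> Z" using m by blast
    then have "conn (y + of_int m) \<in> T" using X_shift(1) y by (auto simp: T_def)
    from word_with_cost.extend[OF word_with_cost.empty this]
    have "word_with_cost T t0 (conn (y + of_int m)) 1" by (simp add: incr_diff_id)
    moreover have "1 * 1 \<le> M0 * (2 - phi y)" using M0 phi_bounds[OF y] by (intro mult_mono) auto
    ultimately show ?thesis using conn(2)[OF X_shift(1)[OF y, of m]] by auto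
  qed
  \<comment> \<open>The 2 in the bound leaves room for the cost 1 of the connecting map, because
    \<open>phi y \<le> 1\<close>. The number \<open>j\<close> bounds the rounds that are still
    possible; for \<open>j = 0\<close> an expansion would make \<open>phi\<close> exceed 1.\<close>
  have reach: "\<exists>F \<sigma> m. word_with_cost T t0 F \<sigma> \<and> F t0 = y + of_int m \<and> \<sigma> \<le> M0 * (2 - phi y)"
    if "y \<in> X" "1 \<le> l ^ j * phi y" for y and j :: nat
    using that
  proof (induction j arbitrary: y)
    case j: (0 y)
    have y1: "1 \<le> phi y" using j by simp
    show ?case
    proof (cases "\<exists>m. y + of_int m \<in> Z")
      case True
      then show ?thesis using connect j(1) by blast
    next
      case False
      then obtain K n where K: "K \<in> S" "l \<le> deriv (K ^^ n) y" using ex by blast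
      have KL: "K ^^ n \<in> L" using K S funpow_in by blast
      have "l * 1 \<le> deriv (K ^^ n) y * phi y" using K(2) y1 l by (intro mult_mono) auto
      also have "\<dots> \<le> 1" using phi_image[OF KL j(1)] phi_bounds(2) by metis
      finally show ?thesis using l by simp
    qed
  next
    case j: (Suc j y)
    show ?case
    proof (cases "\<exists>m. y + of_int m \<in> Z")
      case True
      then show ?thesis using connect j(2) by blast
    next
      case False
      then obtain K n where K: "K \<in> S" "n \<ge> 1" "l \<le> deriv (K ^^ n) y"
        "(\<Sum>i=1..n. deriv (K ^^ i) y) \<le> C * deriv (K ^^ n) y" using ex by blast
      have KL: "K \<in> L" "K ^^ i \<in> L" for i using K S funpow_in by blast+
      define w where "w = (K ^^ n) y"
      have w: "w \<in> X" "phi w = deriv (K ^^ n) y * phi y"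
        using phi_image[OF KL(2) j(2)] by (auto simp: w_def)
      have lw: "l * phi y \<le> phi w" using K(3) phi_bounds[OF j(2)] w by (simp add: mult_right_mono)
      have "1 \<le> l ^ j * (l * phi y)" using j(3) by (simp add: mult.assoc mult.left_commute)
      also have "\<dots> \<le> l ^ j * phi w" using lw l by (intro mult_left_mono) auto
      finally obtain F \<sigma> m where F: "word_with_cost T t0 F \<sigma>" "F t0 = w + of_int m" "\<sigma> \<le> M0 * (2 - phi w)"
        using j(1)[OF w(1)] by blast
      have FL: "F \<in> L" using word_in F by blast
      \<comment> \<open>\<open>H i\<close> undoes the last \<open>i\<close> steps of the round. The
        prefixes charged are \<open>H 0\<close> to \<open>H (n - 1)\<close>, whose derivatives
        involve \<open>K ^^ n\<close> down to \<open>K ^^ 1\<close>; this matches the sum from 1 to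
        \<open>n\<close> in \<open>exits\<close>.\<close>
      define H where "H i = (finv K ^^ i) \<circ> F" for i
      have iL: "finv K \<in> L" "finv K ^^ i \<in> L" for i using inv_in(1) KL funpow_in by blast+
      have HL: "H i \<in> L" for i using iL FL comp_in by (simp add: H_def)
      have H_t0: "H i t0 = (K ^^ (n - i)) y + of_int m" if "i \<le> n" for i
        using periodic_of_int[OF iL(2)] finv_funpow[OF KL(1) that] by (simp add: H_def F(2) w_def)
      have dH: "deriv (H i) t0 = deriv (K ^^ (n - i)) y * phi y" if "i \<le> n" for i
        using phi_eq[OF HL, of i] phi_image[OF KL(2) j(2)] X_shift(2) unfolding H_t0[OF that] by metis
      have "word_with_cost T t0 (H i) (\<sigma> + (\<Sum>k<i. deriv (H k) t0))" for i
      proof (induction i)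
        case 0
        then show ?case using F(1) by (simp add: H_def)
      next
        case (Suc i)
        have "finv K \<in> T" using K(1) by (simp add: T_def)
        from word_with_cost.extend[OF Suc this]
        moreover have "finv K \<circ> H i = H (Suc i)" by (simp only: H_def funpow.simps comp_assoc)
        ultimately show ?case by (simp only: sum.lessThan_Suc add.assoc)
      qed
      then have "word_with_cost T t0 (H n) (\<sigma> + (\<Sum>k<n. deriv (H k) t0))" .
      moreover have "(\<Sum>k<n. deriv (H k) t0) = (\<Sum>k<n. deriv (K ^^ (n - k)) y * phi y)"
        using dH by (intro sum.cong) auto
      moreover have "(\<Sum>k<n. deriv (K ^^ (n - k)) y * phi y) = (\<Sum>i=1..n. deriv (K ^^ i) y) * phi y"
        unfolding sum_distrib_right
        by (rule sum.reindex_bij_witness[of _ "\<lambda>i. n - i" "\<lambda>k. n - k"]) auto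
      ultimately have word: "word_with_cost T t0 (H n) (\<sigma> + (\<Sum>i=1..n. deriv (K ^^ i) y) * phi y)" by simp
      have "(\<Sum>i=1..n. deriv (K ^^ i) y) * phi y \<le> C * phi w"
        using mult_right_mono[OF K(4), of "phi y"] phi_bounds[OF j(2)] w(2) by (simp add: mult.assoc)
      also have "\<dots> \<le> M0 * (1 - 1 / l) * phi w" using M0 phi_bounds[OF w(1)] by (intro mult_right_mono) auto
      also have "\<dots> = M0 * (phi w - phi w / l)" by (simp add: algebra_simps)
      also have "\<dots> \<le> M0 * (phi w - phi y)" using lw l M0 by (intro mult_left_mono diff_left_mono) (auto simp: field_simps)
      finally have "\<sigma> + (\<Sum>i=1..n. deriv (K ^^ i) y) * phi y \<le> M0 * (2 - phi w) + M0 * (phi w - phi y)"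
        using F(3) by linarith
      also have "\<dots> = M0 * (2 - phi y)" by (simp add: algebra_simps)
      finally show ?thesis using word H_t0[of n] by auto
    qed
  qed
  \<comment> \<open>Every cost is at most \<open>2 * M0\<close>, so this radius meets the smallness
    condition of \<open>word_distortion\<close>.\<close>
  define d where "d = 1 / (M * exp 1 * (2 * M0))"
  have d: "d > 0" using M M0 by (simp add: d_def)
  have "\<exists>F\<in>L. F t0 = y \<and> (\<forall>t. \<bar>t - t0\<bar> \<le> d \<longrightarrow> phi y \<le> exp 1 * deriv F t \<and> deriv F t \<le> exp 1 * phi y)"
    if y: "y \<in> X" for y
  proof -
    obtain j where "(1 / l) ^ j < phi y" using real_arch_pow_inv[of "phi y" "1 / l"] phi_bounds[OF y] l by auto
    then have "1 \<le> l ^ j * phi y" using l by (simp add: power_one_over field_simps)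
    then obtain F \<sigma> m where F: "word_with_cost T t0 F \<sigma>" "F t0 = y + of_int m" "\<sigma> \<le> M0 * (2 - phi y)"
      using reach[OF y] by blast
    have FL: "F \<in> L" using word_in F by blast
    have \<sigma>: "0 \<le> \<sigma>" and dist: "\<And>t. M * exp 1 * \<sigma> * \<bar>t - t0\<bar> \<le> 1 \<Longrightarrow>
        \<bar>ln (deriv F t) - ln (deriv F t0)\<bar> \<le> M * exp 1 * \<sigma> * \<bar>t - t0\<bar>"
      using word_distortion[OF F(1) M(2)] by auto
    have "M0 * (2 - phi y) \<le> M0 * 2" using M0 phi_bounds[OF y] by (intro mult_left_mono) auto
    then have "\<sigma> \<le> M0 * 2" using F(3) by linarith
    define G where "G = (\<lambda>t. F t + of_int (- m))"
    have GL: "G \<in> L" using comp_in[OF shift_in[of "- m"] FL] by (simp add: G_def comp_def)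
    have dG: "deriv G t = deriv F t" for t unfolding G_def using deriv_shift_right[OF FL] .
    have Gt0: "G t0 = y" using F(2) by (simp add: G_def)
    have F0: "deriv F t0 = phi y" using phi_eq[OF GL] dG Gt0 by simp
    have "phi y \<le> exp 1 * deriv G t \<and> deriv G t \<le> exp 1 * phi y" if t: "\<bar>t - t0\<bar> \<le> d" for t
    proof -
      have "M * exp 1 * \<sigma> * \<bar>t - t0\<bar> \<le> M * exp 1 * (M0 * 2) * d"
        using \<open>\<sigma> \<le> M0 * 2\<close> M \<sigma> t M0 by (intro mult_mono) auto
      also have "\<dots> = 1" using M M0 by (simp add: d_def)
      finally have le1: "M * exp 1 * \<sigma> * \<bar>t - t0\<bar> \<le> 1" .
      then have "\<bar>ln (deriv F t) - ln (phi y)\<bar> \<le> 1" using order_trans[OF dist[OF le1] le1] F0 by simp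
      then have "ln (phi y) \<le> ln (exp 1 * deriv F t)" "ln (deriv F t) \<le> ln (exp 1 * phi y)"
        using deriv_pos[OF FL, of t] phi_bounds[OF y] by (simp_all add: ln_mult_pos)
      then show ?thesis using deriv_pos[OF FL, of t] phi_bounds[OF y] by (simp add: dG)
    qed
    then show ?thesis using GL Gt0 by blast
  qed
  then show ?thesis using d by blast
qed

lemma nontrivial_stab: "\<exists>F\<in>L. F \<noteq> id \<and> F t0 = t0"
  using star[of t0] nonexp by blast

text \<open>The exit from \<open>t0\<close> multiplies \<open>phi p\<close> by at least
  \<open>1 / (C * (p - t0)^2)\<close>, and the result is again a value of \<open>phi\<close>, hence
  at most 1.\<close>

lemma phi_near_t0: "\<exists>e>0. \<exists>C\<ge>1. \<forall>p\<in>X. 0 < \<bar>p - t0\<bar> \<and> \<bar>p - t0\<bar> < e \<longrightarrow> phi p \<le> C * (p - t0)\<^sup>2"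
proof -
  obtain F where F: "F \<in> L" "F \<noteq> id" "F t0 = t0" using nontrivial_stab by blast
  obtain e C where e: "e > 0" "C \<ge> 1" and ex: "\<And>y. 0 < \<bar>y - t0\<bar> \<Longrightarrow> \<bar>y - t0\<bar> < e \<Longrightarrow>
    \<exists>K\<in>{F, finv F}. \<exists>n\<ge>1. 1 \<le> C * (y - t0)\<^sup>2 * deriv (K ^^ n) y \<and>
      (\<Sum>i=1..n. deriv (K ^^ i) y) \<le> C * deriv (K ^^ n) y"
    using parabolic_exit[OF F stab_deriv[OF F(1,3)]] unfolding exits_def by blast
  have "phi p \<le> C * (p - t0)\<^sup>2" if p: "p \<in> X" "0 < \<bar>p - t0\<bar>" "\<bar>p - t0\<bar> < e" for p
  proof -
    obtain K n where K: "K \<in> {F, finv F}" "1 \<le> C * (p - t0)\<^sup>2 * deriv (K ^^ n) p"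
      using ex[OF p(2,3)] by blast
    have KL: "K ^^ n \<in> L" using K(1) funpow_in F(1) inv_in(1)[OF F(1)] by blast
    have "1 * phi p \<le> C * (p - t0)\<^sup>2 * deriv (K ^^ n) p * phi p"
      using K(2) phi_bounds[OF p(1)] by (intro mult_right_mono) auto
    also have "\<dots> = C * (p - t0)\<^sup>2 * phi ((K ^^ n) p)" using phi_image(2)[OF KL p(1)] by simp
    also have "\<dots> \<le> C * (p - t0)\<^sup>2 * 1"
      using phi_bounds[OF phi_image(1)[OF KL p(1)]] e by (intro mult_left_mono) auto
    finally show ?thesis by simp
  qed
  then show ?thesis using e by blast
qed

text \<open>Let \<open>y\<close> have the larger weight and pull back by the normalized
  \<open>F\<close> with \<open>F t0 = y\<close>, which scales lengths near \<open>t0\<close> by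
  about \<open>phi y\<close>. If the preimage \<open>p\<close> of \<open>z\<close> is close to
  \<open>t0\<close>, then \<open>phi p\<close> is at most of order \<open>(p - t0)^2\<close> and
  \<open>phi z\<close> at most of order \<open>phi y\<close> times that. If \<open>p\<close> is far,
  then the distance from \<open>y\<close> to \<open>z\<close> is at least of order
  \<open>phi y\<close>, and \<open>phi z \<le> phi y\<close> suffices.\<close>

lemma separation: "\<exists>c>0. \<forall>y\<in>X. \<forall>z\<in>X. y \<noteq> z \<longrightarrow> c * (phi y * phi z) \<le> (y - z)\<^sup>2"
proof -
  obtain d where d: "d > 0" and norm: "\<And>y. y \<in> X \<Longrightarrow> \<exists>F\<in>L. F t0 = y \<and>
      (\<forall>t. \<bar>t - t0\<bar> \<le> d \<longrightarrow> phi y \<le> exp 1 * deriv F t \<and> deriv F t \<le> exp 1 * phi y)"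
    using normalization by blast
  obtain e C where e: "e > 0" "C \<ge> 1" and near: "\<And>p. p \<in> X \<Longrightarrow> 0 < \<bar>p - t0\<bar> \<Longrightarrow> \<bar>p - t0\<bar> < e \<Longrightarrow> phi p \<le> C * (p - t0)\<^sup>2"
    using phi_near_t0 by blast
  define r where "r = min d (e / 2)"
  have r: "r > 0" "r \<le> d" "r < e" using d e by (auto simp: r_def)
  \<comment> \<open>The first entry serves the far case. In the second, one factor
    \<open>exp 1\<close> comes from the upper bound for \<open>deriv F p\<close> and two from the
    squared lower bound for distances.\<close>
  define c where "c = min ((r / exp 1)\<^sup>2) (1 / (C * exp 1 ^ 3))"
  have c: "c > 0" using r e by (simp add: c_def)
  have main: "c * (phi y * phi z) \<le> (y - z)\<^sup>2" if yz: "y \<in> X" "z \<in> X" "y \<noteq> z" "phi z \<le> phi y" for y z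
  proof -
    note py = phi_bounds[OF yz(1)] and pz = phi_bounds[OF yz(2)]
    obtain F where F: "F \<in> L" "F t0 = y" and bd: "\<And>t. \<bar>t - t0\<bar> \<le> d \<Longrightarrow> phi y \<le> exp 1 * deriv F t"
      "\<And>t. \<bar>t - t0\<bar> \<le> d \<Longrightarrow> deriv F t \<le> exp 1 * phi y" using norm[OF yz(1)] by blast
    define p where "p = finv F z"
    have Fp: "F p = z" using inv_in(3)[OF F(1)] by (simp add: p_def)
    have p: "p \<in> X" "p \<noteq> t0" using phi_image(1)[OF inv_in(1)[OF F(1)] yz(2)] Fp F(2) yz(3) by (auto simp: p_def)
    have lower: "phi y * \<bar>s - t0\<bar> \<le> exp 1 * \<bar>F s - y\<bar>" if s: "\<bar>s - t0\<bar> \<le> d" for s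
    proof (cases s t0 rule: linorder_cases)
      case less
      then obtain u where u: "s < u" "u < t0" "F t0 - F s = (t0 - s) * deriv F u"
        using incr_diff_mvt[OF incr_diff[OF F(1)]] by blast
      then have "phi y * (t0 - s) \<le> exp 1 * deriv F u * (t0 - s)" using bd(1)[of u] s by (intro mult_right_mono) auto
      then show ?thesis using u less F(2) incr_diff_less_iff[OF incr_diff[OF F(1)], of s t0] by (simp add: ac_simps)
    next
      case greater
      then obtain u where u: "t0 < u" "u < s" "F s - F t0 = (s - t0) * deriv F u"
        using incr_diff_mvt[OF incr_diff[OF F(1)]] by blast
      then have "phi y * (s - t0) \<le> exp 1 * deriv F u * (s - t0)" using bd(1)[of u] s by (intro mult_right_mono) auto
      then show ?thesis using u greater F(2) incr_diff_less_iff[OF incr_diff[OF F(1)], of t0 s] by (simp add: ac_simps)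
    qed (use F in simp)
    show ?thesis
    proof (cases "\<bar>p - t0\<bar> \<le> r")
      case True
      have "phi z = deriv F p * phi p" using phi_image(2)[OF F(1) p(1)] Fp by simp
      also have "\<dots> \<le> (exp 1 * phi y) * (C * (p - t0)\<^sup>2)"
        using bd(2)[of p] near[OF p(1)] True r p(2) py phi_bounds[OF p(1)] by (intro mult_mono) auto
      finally have "phi y * phi z \<le> phi y * ((exp 1 * phi y) * (C * (p - t0)\<^sup>2))"
        using py by (intro mult_left_mono) auto
      also have "\<dots> = C * exp 1 * (phi y * \<bar>p - t0\<bar>)\<^sup>2" by (simp add: power2_eq_square)
      also have "\<dots> \<le> C * exp 1 * (exp 1 * \<bar>F p - y\<bar>)\<^sup>2"
        using lower[of p] True r e py by (intro mult_left_mono power_mono) auto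
      also have "\<dots> = (C * exp 1 ^ 3) * (y - z)\<^sup>2"
        by (simp only: Fp power_mult_distrib power2_abs) (simp add: power2_eq_square power3_eq_cube algebra_simps del: mult_exp_exp)
      finally have "phi y * phi z / (C * exp 1 ^ 3) \<le> (y - z)\<^sup>2" using e by (simp add: pos_divide_le_eq mult.commute)
      moreover have "c * (phi y * phi z) \<le> 1 / (C * exp 1 ^ 3) * (phi y * phi z)"
        using py pz by (intro mult_right_mono) (auto simp: c_def)
      ultimately show ?thesis by simp
    next
      case False
      have far: "phi y * r \<le> exp 1 * \<bar>z - y\<bar>"
      proof (cases "t0 < p")
        case True
        have "phi y * r \<le> exp 1 * \<bar>F (t0 + r) - y\<bar>" using lower[of "t0 + r"] r by simp
        also have "\<bar>F (t0 + r) - y\<bar> \<le> \<bar>z - y\<bar>"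
          using incr_diff_le_iff[OF incr_diff[OF F(1)], of "t0 + r" p] incr_diff_le_iff[OF incr_diff[OF F(1)], of t0 "t0 + r"] True False r Fp F(2) by auto
        finally show ?thesis by simp
      next
        case f: False
        have "phi y * r \<le> exp 1 * \<bar>F (t0 - r) - y\<bar>" using lower[of "t0 - r"] r by simp
        also have "\<bar>F (t0 - r) - y\<bar> \<le> \<bar>z - y\<bar>"
          using incr_diff_le_iff[OF incr_diff[OF F(1)], of p "t0 - r"] incr_diff_le_iff[OF incr_diff[OF F(1)], of "t0 - r" t0] f False r Fp F(2) by auto
        finally show ?thesis by simp
      qed
      have "c * (phi y * phi z) \<le> (r / exp 1)\<^sup>2 * (phi y * phi y)"
        using py pz yz(4) by (intro mult_mono) (auto simp: c_def)
      also have "\<dots> = (phi y * r / exp 1)\<^sup>2" by (simp add: power2_eq_square)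
      also have "\<dots> \<le> \<bar>z - y\<bar>\<^sup>2" using far py r by (intro power_mono) (auto simp: pos_divide_le_eq mult.commute)
      finally show ?thesis by (simp add: power2_commute)
    qed
  qed
  have "c * (phi y * phi z) \<le> (y - z)\<^sup>2" if "y \<in> X" "z \<in> X" "y \<noteq> z" for y z
    using main[of y z] main[of z y] that by (cases "phi z \<le> phi y") (auto simp: power2_commute mult.commute)
  then show ?thesis using c by blast
qed

end

section \<open>The stabilizer of the non-expandable point\<close>

context lift_group
begin

text \<open>The exponent is the order of contact of \<open>F\<close> with the identity at
  \<open>t0\<close>. The derivative clause has the form that \<open>real_analytic_order\<close>
  delivers.\<close>

definition tangency :: "(real \<Rightarrow> real) \<Rightarrow> nat \<Rightarrow> bool"
  where "tangency F k \<longleftrightarrow> (\<exists>a>0. \<exists>b>0. \<exists>e>0. \<forall>y. \<bar>y - t0\<bar> < e \<longrightarrow>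
    a * \<bar>y - t0\<bar> ^ k \<le> \<bar>F y - y\<bar> \<and> \<bar>F y - y\<bar> \<le> b * \<bar>y - t0\<bar> ^ k \<and>
    \<bar>y - t0\<bar> * \<bar>deriv F y - 1\<bar> \<le> b * \<bar>y - t0\<bar> ^ k)"

definition stab :: "(real \<Rightarrow> real) set"
  where "stab = {F \<in> L. F \<noteq> id \<and> F t0 = t0}"

lemma tangency_ex:
  assumes "F \<in> stab"
  shows "\<exists>k. tangency F k"
proof -
  have F: "F \<in> L" "F \<noteq> id" using assms by (auto simp: stab_def)
  have an: "real_analytic (\<lambda>x. F x - x)"
    by (rule real_analytic_diff[OF analytic[OF F(1)] real_analytic_ident])
  have nz: "\<not> (\<forall>\<^sub>F h in nhds 0. F (t0 + h) - (t0 + h) = 0)"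
  proof
    assume "\<forall>\<^sub>F h in nhds 0. F (t0 + h) - (t0 + h) = 0"
    then have "F y - y = 0" for y using real_analytic_continuation[OF an] by blast
    then show False using F(2) by auto
  qed
  have d: "deriv (\<lambda>x. F x - x) y = deriv F y - 1" for y
    by (intro DERIV_imp_deriv DERIV_diff has_deriv[OF F(1)] DERIV_ident)
  obtain k a b e where "0 < a" "0 < b" "0 < e"
    "\<And>y. \<bar>y - t0\<bar> < e \<Longrightarrow> a * \<bar>y - t0\<bar> ^ k \<le> \<bar>F y - y\<bar>"
    "\<And>y. \<bar>y - t0\<bar> < e \<Longrightarrow> \<bar>F y - y\<bar> \<le> b * \<bar>y - t0\<bar> ^ k"
    "\<And>y. \<bar>y - t0\<bar> < e \<Longrightarrow> \<bar>y - t0\<bar> * \<bar>deriv F y - 1\<bar> \<le> b * \<bar>y - t0\<bar> ^ k"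
    by (rule real_analytic_order[OF an nz, unfolded d]) (rule that)
  then show ?thesis unfolding tangency_def by (intro exI[of _ k] exI[of _ a] exI[of _ b] exI[of _ e] conjI) auto
qed

text \<open>The inverse moves points of the interval towards \<open>t0\<close>. The limit of the
  decreasing orbit is a fixed point, and only \<open>t0\<close> is available.\<close>

lemma finv_push:
  assumes "K \<in> L" "\<And>t. t0 < t \<Longrightarrow> t < t0 + e \<Longrightarrow> t < K t" "K t0 = t0"
    and q: "t0 < q" "q < t0 + e"
  shows "(\<lambda>n. (finv K ^^ n) q) \<longlonglongrightarrow> t0" "t0 < (finv K ^^ n) q" "(finv K ^^ n) q \<le> q"
proof -
  define R where "R = finv K"
  have R: "R \<in> L" "R t0 = t0" using inv_in(1)[OF assms(1)] inv_in(2)[OF assms(1), of t0] assms(3) by (auto simp: R_def)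
  have KR: "K (R t) = t" for t using inv_in(3)[OF assms(1)] by (simp add: R_def)
  note Rmono = incr_diff_less_iff[OF incr_diff[OF R(1)]]
  have dec: "R t < t" if "t0 < t" "t < t0 + e" for t
    using assms(2)[OF that] Rmono[of t "K t"] inv_in(2)[OF assms(1), of t] by (simp add: R_def)
  have gt: "t0 < (R ^^ n) q \<and> (R ^^ n) q \<le> q" for n
  proof (induction n)
    case (Suc n)
    then have "t0 < R ((R ^^ n) q)" using Rmono[of t0 "(R ^^ n) q"] R(2) by simp
    moreover have "R ((R ^^ n) q) < (R ^^ n) q" using dec Suc q by simp
    ultimately show ?case using Suc by simp
  qed (use q in simp)
  then show "t0 < (finv K ^^ n) q" "(finv K ^^ n) q \<le> q" by (simp_all add: R_def)
  have "decseq (\<lambda>n. (R ^^ n) q)"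
  proof (rule decseq_SucI)
    fix n show "(R ^^ Suc n) q \<le> (R ^^ n) q" using dec[of "(R ^^ n) q"] gt[of n] q by simp
  qed
  then obtain p where p: "(\<lambda>n. (R ^^ n) q) \<longlonglongrightarrow> p" "\<And>n. p \<le> (R ^^ n) q"
    using decseq_convergent[of "\<lambda>n. (R ^^ n) q" t0] gt less_imp_le by metis
  have "isCont R p" using has_deriv[OF R(1)] DERIV_isCont by blast
  then have "(\<lambda>n. R ((R ^^ n) q)) \<longlonglongrightarrow> R p" using p(1) isCont_tendsto_compose by blast
  moreover have "(\<lambda>n. R ((R ^^ n) q)) \<longlonglongrightarrow> p" using LIMSEQ_Suc[OF p(1)] by simp
  ultimately have "R p = p" using LIMSEQ_unique by blast
  moreover have "p \<le> q" using p(2)[of 0] by simp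
  moreover have "t0 \<le> p" using p(1) gt by (intro LIMSEQ_le_const[of _ p t0]) (auto intro: less_imp_le)
  ultimately have "p = t0" using dec[of p] q by force
  then show "(\<lambda>n. (finv K ^^ n) q) \<longlonglongrightarrow> t0" using p(1) by (simp add: R_def)
qed

lemma X_dense: "a < b \<Longrightarrow> \<exists>p\<in>X. a < p \<and> p < b"
  using dense XI by blast

text \<open>The backward orbit \<open>p n\<close> of an orbit point \<open>q\<close> under
  \<open>K\<close> tends to \<open>t0\<close>, and bounded distortion gives \<open>phi (p n)\<close>
  at least of order \<open>\<bar>p n - t0\<bar> ^ k0\<close>. An element with higher contact would
  move \<open>p n\<close> to a different orbit point of comparable weight that is closer than
  \<open>separation\<close> permits.\<close>

lemma tangency_bounded: "\<exists>k0. \<forall>F k. F \<in> stab \<longrightarrow> tangency F k \<longrightarrow> k \<le> k0"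
proof -
  obtain F0 where F0: "F0 \<in> L" "F0 \<noteq> id" "F0 t0 = t0" using nontrivial_stab by blast
  obtain e K where e: "e > 0" and K: "K \<in> {F0, finv F0}" and push: "\<And>t. t0 < t \<Longrightarrow> t < t0 + e \<Longrightarrow> t < K t"
    using pushes_right(1)[OF F0] by blast
  have KL: "K \<in> L" "K t0 = t0" using K F0 inv_in(1)[OF F0(1)] inv_in(2)[OF F0(1), of t0] by auto
  have "K \<noteq> id" using push[of "t0 + e / 2"] e by auto
  then have Kst: "K \<in> stab" using KL by (simp add: stab_def)
  obtain k0 where k0: "tangency K k0" using tangency_ex[OF Kst] by blast
  obtain M where M: "log_lipschitz M K" using log_lipschitz_ex[OF KL(1)] by blast
  obtain q where q: "q \<in> X" "t0 < q" "q < t0 + min e 1" using X_dense[of t0 "t0 + min e 1"] e by auto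
  define R where "R = finv K"
  have RL: "R \<in> L" "R ^^ n \<in> L" for n using inv_in(1)[OF KL(1)] funpow_in by (auto simp: R_def)
  define p where "p n = (R ^^ n) q" for n
  have p: "p \<longlonglongrightarrow> t0" "\<And>n. t0 < p n" "\<And>n. p n \<le> q"
    using finv_push[where q = q and e = e, OF KL(1) push KL(2)] q unfolding p_def R_def by auto
  have pX: "p n \<in> X" for n unfolding p_def using phi_image(1)[OF RL(2) q(1)] .
  have Kp: "(K ^^ n) (p n) = q" for n
  proof -
    have "finv R = K" unfolding R_def by (rule inv_inv_eq) (metis KL(1) inv_in(4,5) o_bij)
    then show ?thesis using finv_funpow[OF RL(1), of n n q] by (simp add: p_def)
  qed
  \<comment> \<open>Comes from comparing fundamental intervals: the \<open>n\<close>-th iterate of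
    \<open>K\<close> maps the one at \<open>p n\<close> onto the one at \<open>q\<close> and carries
    the weight \<open>phi (p n)\<close> to \<open>phi q\<close>.\<close>
  define c1 where "c1 = phi q / (exp M * (K q - q))"
  have Kq: "q < K q" using push q by simp
  have c1: "c1 > 0" using phi_bounds[OF q(1)] Kq by (simp add: c1_def)
  have phi_p: "c1 * (K (p n) - p n) \<le> phi (p n)" for n
  proof -
    have pK: "p n < K (p n)" using push[of "p n"] p q by (smt (verit) min_less_iff_conj)
    have "(K ^^ n) (p n) - p n \<le> 1" using Kp[of n] p(2)[of n] q by simp
    from iterate_deriv_bounds(2)[OF M pK this, of n]
    have "deriv (K ^^ n) (p n) \<le> exp M * ((K q - q) / (K (p n) - p n))" using Kp[of n] by simp
    then have "deriv (K ^^ n) (p n) * phi (p n) \<le> exp M * ((K q - q) / (K (p n) - p n)) * phi (p n)"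
      using phi_bounds[OF pX[of n]] by (intro mult_right_mono) auto
    moreover have "deriv (K ^^ n) (p n) * phi (p n) = phi q"
      using phi_image(2)[OF funpow_in[OF KL(1), of n] pX[of n]] Kp[of n] by simp
    ultimately have "phi q * (K (p n) - p n) \<le> exp M * (K q - q) * phi (p n)"
      using pK by (simp add: field_simps)
    then show ?thesis using Kq by (simp add: c1_def field_simps)
  qed
  obtain c where c: "c > 0" and sep: "\<And>y z. y \<in> X \<Longrightarrow> z \<in> X \<Longrightarrow> y \<noteq> z \<Longrightarrow> c * (phi y * phi z) \<le> (y - z)\<^sup>2"
    using separation by blast
  have "k \<le> k0" if F: "F \<in> stab" "tangency F k" for F k
  proof (rule ccontr)
    assume "\<not> k \<le> k0"
    then obtain i where i: "k = k0 + Suc i" using less_imp_Suc_add[of k0 k] by auto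
    have FL: "F \<in> L" "F t0 = t0" using F by (auto simp: stab_def)
    obtain a b e1 where ab: "a > 0" "b > 0" "e1 > 0" "\<And>y. \<bar>y - t0\<bar> < e1 \<Longrightarrow> a * \<bar>y - t0\<bar> ^ k \<le> \<bar>F y - y\<bar>"
      "\<And>y. \<bar>y - t0\<bar> < e1 \<Longrightarrow> \<bar>F y - y\<bar> \<le> b * \<bar>y - t0\<bar> ^ k" using F(2) unfolding tangency_def by blast
    obtain a' e2 where a': "a' > 0" "e2 > 0" "\<And>y. \<bar>y - t0\<bar> < e2 \<Longrightarrow> a' * \<bar>y - t0\<bar> ^ k0 \<le> \<bar>K y - y\<bar>"
      using k0 unfolding tangency_def by blast
    obtain D where D: "D > 0" "\<And>y. \<bar>y - t0\<bar> \<le> 1 \<Longrightarrow> \<bar>deriv F y - 1\<bar> \<le> D * \<bar>y - t0\<bar>"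
      using tangent_to_identity(2)[OF FL stab_deriv[OF FL]] by blast
    \<comment> \<open>The estimates below collapse to \<open>\<kappa> \<le> r ^ (k - k0)\<close>,
      which fails once \<open>r\<close> is below both 1 and \<open>\<kappa>\<close>. The half of
      \<open>c\<close> accounts for \<open>phi (F y)\<close> being at least half of
      \<open>phi y\<close>.\<close>
    define \<kappa> where "\<kappa> = sqrt (c / 2) * c1 * a' / b"
    have \<kappa>: "\<kappa> > 0" using c c1 a' ab by (simp add: \<kappa>_def)
    define \<epsilon> where "\<epsilon> = min (min e1 e2) (min (min 1 (1 / (2 * D))) \<kappa>)"
    have \<epsilon>: "\<epsilon> > 0" using ab a' D \<kappa> by (simp add: \<epsilon>_def)
    obtain n where n: "\<bar>p n - t0\<bar> < \<epsilon>" using p(1) \<epsilon> unfolding LIMSEQ_def dist_real_def by blast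
    define y where "y = p n"
    define r where "r = \<bar>y - t0\<bar>"
    have r: "0 < r" "r < e1" "r < e2" "r < 1" "r < 1 / (2 * D)" "r < \<kappa>"
      using n p(2)[of n] by (auto simp: r_def y_def \<epsilon>_def)
    have yX: "y \<in> X" "F y \<in> X" using pX phi_image(1)[OF FL(1)] by (auto simp: y_def)
    have "0 < a * r ^ k" using ab r by simp
    then have Fy: "F y \<noteq> y" using ab(4)[of y] r by (auto simp: r_def)
    have "D * r \<le> D * (1 / (2 * D))" using r D by (intro mult_left_mono) auto
    then have "D * r \<le> 1 / 2" using D by simp
    then have "\<bar>deriv F y - 1\<bar> \<le> 1 / 2" using D(2)[of y] r unfolding r_def by linarith
    then have "1 / 2 \<le> deriv F y" by linarith
    then have ph: "1 / 2 * phi y \<le> phi (F y)"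
      using phi_image(2)[OF FL(1) yX(1)] phi_bounds[OF yX(1)] by (simp add: mult_right_mono)
    have "(sqrt (c / 2) * phi y)\<^sup>2 = c * (1 / 2 * phi y * phi y)" using c by (simp add: power_mult_distrib power2_eq_square[of "phi y"])
    also have "\<dots> \<le> c * (phi (F y) * phi y)" using ph c phi_bounds[OF yX(1)] by (intro mult_left_mono mult_right_mono) auto
    also have "\<dots> \<le> \<bar>F y - y\<bar>\<^sup>2" using sep[OF yX(2,1) Fy] by simp
    finally have "sqrt (c / 2) * phi y \<le> \<bar>F y - y\<bar>" using power2_le_imp_le abs_ge_zero by blast
    also have "\<dots> \<le> b * r ^ k" using ab(5)[of y] r by (simp add: r_def)
    finally have 1: "sqrt (c / 2) * phi y \<le> b * r ^ k" .
    have "y < K y" using push[of y] p(2)[of n] p(3)[of n] q by (simp add: y_def)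
    then have "a' * r ^ k0 \<le> K y - y" using a'(3)[of y] r by (simp add: r_def)
    then have "c1 * (a' * r ^ k0) \<le> phi y" using phi_p[of n] c1 by (smt (verit) mult_left_mono y_def)
    then have "sqrt (c / 2) * (c1 * (a' * r ^ k0)) \<le> sqrt (c / 2) * phi y" using c by (intro mult_left_mono) auto
    then have "sqrt (c / 2) * c1 * a' * r ^ k0 \<le> b * r ^ Suc i * r ^ k0" using 1 unfolding i by (simp add: power_add ac_simps)
    then have "sqrt (c / 2) * c1 * a' \<le> b * r ^ Suc i" using r by (simp only: mult_le_cancel_right) simp
    then have "\<kappa> \<le> r ^ Suc i" using ab by (simp add: \<kappa>_def pos_divide_le_eq mult.commute)
    also have "\<dots> \<le> r" using r power_decreasing[of 1 "Suc i" r] by simp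
    finally show False using r by simp
  qed
  then show ?thesis by blast
qed

lemma max_tangency:
  "\<exists>h k. h \<in> stab \<and> tangency h k \<and> (\<forall>F j. F \<in> stab \<longrightarrow> tangency F j \<longrightarrow> j \<le> k)"
proof -
  obtain F0 where F0: "F0 \<in> stab" using nontrivial_stab by (auto simp: stab_def)
  obtain j0 where j0: "tangency F0 j0" using tangency_ex[OF F0] by blast
  obtain k0 where k0: "\<And>F k. F \<in> stab \<Longrightarrow> tangency F k \<Longrightarrow> k \<le> k0" using tangency_bounded by blast
  define P where "P k \<longleftrightarrow> (\<exists>F\<in>stab. tangency F k)" for k
  have "P j0" "\<And>k. P k \<Longrightarrow> k \<le> k0" using F0 j0 k0 by (auto simp: P_def)
  then obtain k where "P k" "\<And>j. P j \<Longrightarrow> j \<le> k" using Nat.ex_has_greatest_nat[of P j0 k0] by blast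
  then show ?thesis unfolding P_def by blast
qed

text \<open>The commutator of two germs tangent to the identity is more tangent to the identity than either
  of them.\<close>

lemma max_tangency_commutes:
  assumes h: "h \<in> stab" "tangency h k" and max: "\<And>F j. F \<in> stab \<Longrightarrow> tangency F j \<Longrightarrow> j \<le> k"
    and f: "f \<in> L" "f t0 = t0"
  shows "f (h y) = h (f y)"
proof -
  have hL: "h \<in> L" "h t0 = t0" using h by (auto simp: stab_def)
  have fh: "f \<circ> h \<in> L" "h \<circ> f \<in> L" using comp_in f hL by auto
  \<comment> \<open>The commutator, arranged to map \<open>h (f y)\<close> to
    \<open>f (h y)\<close>. If nontrivial, its order of contact is at most \<open>k\<close>, but it
    is shown to move a point at distance comparable to \<open>t\<close> from \<open>t0\<close> by at
    most \<open>O(t ^ (k + 1))\<close>.\<close>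
  define c where "c = (f \<circ> h) \<circ> finv (h \<circ> f)"
  have cL: "c \<in> L" using comp_in[OF fh(1) inv_in(1)[OF fh(2)]] by (simp add: c_def)
  have c_eq: "c (h (f y)) = f (h y)" for y using inv_in(2)[OF fh(2), of y] by (simp add: c_def)
  have ct0: "c t0 = t0" using c_eq[of t0] f hL by simp
  have "c = id"
  proof (rule ccontr)
    assume "c \<noteq> id"
    then have cst: "c \<in> stab" using cL ct0 by (simp add: stab_def)
    obtain j where j: "tangency c j" using tangency_ex[OF cst] by blast
    then have "j \<le> k" using max cst by blast
    obtain a e1 where a: "a > 0" "e1 > 0" "\<And>y. \<bar>y - t0\<bar> < e1 \<Longrightarrow> a * \<bar>y - t0\<bar> ^ j \<le> \<bar>c y - y\<bar>"
      using j unfolding tangency_def by blast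
    obtain b e2 where b: "b > 0" "e2 > 0" "\<And>y. \<bar>y - t0\<bar> < e2 \<Longrightarrow> \<bar>h y - y\<bar> \<le> b * \<bar>y - t0\<bar> ^ k"
      "\<And>y. \<bar>y - t0\<bar> < e2 \<Longrightarrow> \<bar>y - t0\<bar> * \<bar>deriv h y - 1\<bar> \<le> b * \<bar>y - t0\<bar> ^ k"
      using h(2) unfolding tangency_def by blast
    obtain D1 where D1: "D1 > 0" "\<And>y. \<bar>y - t0\<bar> \<le> 1 \<Longrightarrow> \<bar>f y - y\<bar> \<le> D1 * (y - t0)\<^sup>2"
      using tangent_to_identity(1)[OF f stab_deriv[OF f]] by blast
    obtain D2 where D2: "D2 > 0" "\<And>y. \<bar>y - t0\<bar> \<le> 1 \<Longrightarrow> \<bar>deriv f y - 1\<bar> \<le> D2 * \<bar>y - t0\<bar>"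
      using tangent_to_identity(2)[OF f stab_deriv[OF f]] by blast
    obtain D3 where D3: "D3 > 0" "\<And>y. \<bar>y - t0\<bar> \<le> 1 \<Longrightarrow> \<bar>h y - y\<bar> \<le> D3 * (y - t0)\<^sup>2"
      using tangent_to_identity(1)[OF hL stab_deriv[OF hL]] by blast
    define C where "C = D2 * 2 * b + b * 2 ^ k * 2 * D1"
    have C: "C > 0" using D1 D2 b unfolding C_def by (intro add_pos_pos mult_pos_pos) simp_all
    \<comment> \<open>Upper bounds for the distance \<open>t\<close>. They keep all points inside
      the domains of the estimates and at distances comparable to \<open>t\<close> from
      \<open>t0\<close>; the last one makes the final inequality contradictory.\<close>
    define U where "U = {e1 / 8, e2 / 4, 1 / 4, 1 / (2 * D1), 1 / (16 * D3), a / (2 * 4 ^ k * C)}"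
    have U: "finite U" "U \<noteq> {}" "\<forall>u\<in>U. 0 < u" unfolding U_def using a b D1 D3 C by simp_all
    define t where "t = Min U"
    have t_le: "t \<le> u" if "u \<in> U" for u using Min_le[OF U(1) that] by (simp add: t_def)
    have t: "0 < t" "t \<le> e1 / 8" "t \<le> e2 / 4" "t \<le> 1 / 4" "t \<le> 1 / (2 * D1)" "t \<le> 1 / (16 * D3)" "t \<le> a / (2 * 4 ^ k * C)"
      using U Min_in[OF U(1,2)] by (simp add: t_def) (rule t_le, simp add: U_def)+
    define y where "y = t0 + t"
    have small: "D3 * (2 * t)\<^sup>2 \<le> t / 4"
    proof -
      have "D3 * (2 * t)\<^sup>2 = (16 * D3 * t) * (t / 4)" by (simp add: power2_eq_square)
      also have "\<dots> \<le> 1 * (t / 4)" using t D3 by (intro mult_right_mono) (auto simp: field_simps)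
      finally show ?thesis by simp
    qed
    have uy: "\<bar>f y - y\<bar> \<le> D1 * t\<^sup>2" using D1(2)[of y] t by (simp add: y_def)
    also have "D1 * t\<^sup>2 = (D1 * t) * t" by (simp add: power2_eq_square)
    also have "\<dots> \<le> 1 / 2 * t" using t D1 by (intro mult_right_mono) (auto simp: field_simps)
    finally have fy: "\<bar>f y - y\<bar> \<le> t / 2" by simp
    have vy: "\<bar>h y - y\<bar> \<le> b * t ^ k" using b(3)[of y] t b by (simp add: y_def)
    have "\<bar>h y - y\<bar> \<le> D3 * t\<^sup>2" using D3(2)[of y] t by (simp add: y_def)
    also have "D3 * t\<^sup>2 = (D3 * t) * t" by (simp add: power2_eq_square)
    also have "\<dots> \<le> 1 / 4 * t" using t D3 by (intro mult_right_mono) (auto simp: field_simps)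
    finally have hy: "\<bar>h y - y\<bar> \<le> t / 4" by simp
    have uu: "\<bar>(f (h y) - h y) - (f y - y)\<bar> \<le> (D2 * (2 * t)) * \<bar>h y - y\<bar>"
    proof (rule field_differentiable_bound[of "closed_segment y (h y)" "\<lambda>t. f t - t" "\<lambda>t. deriv f t - 1", unfolded real_norm_def])
      show "((\<lambda>t. f t - t) has_real_derivative deriv f s - 1) (at s within closed_segment y (h y))" for s
        by (rule has_field_derivative_at_within, rule DERIV_diff[OF has_deriv[OF f(1)] DERIV_ident])
      fix s assume "s \<in> closed_segment y (h y)"
      then have "\<bar>s - y\<bar> \<le> t / 4" using hy by (auto simp: closed_segment_eq_real_ivl split: if_splits)
      then have "\<bar>s - t0\<bar> \<le> 2 * t" using t(1) unfolding y_def by linarith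
      moreover have "D2 * \<bar>s - t0\<bar> \<le> D2 * (2 * t)" using calculation D2 by (intro mult_left_mono) auto
      ultimately show "\<bar>deriv f s - 1\<bar> \<le> D2 * (2 * t)" using D2(2)[of s] t by linarith
    qed auto
    have vv: "\<bar>(h (f y) - f y) - (h y - y)\<bar> \<le> (b * (2 * t) ^ k * (2 / t)) * \<bar>f y - y\<bar>"
    proof (rule field_differentiable_bound[of "closed_segment y (f y)" "\<lambda>t. h t - t" "\<lambda>t. deriv h t - 1", unfolded real_norm_def])
      show "((\<lambda>t. h t - t) has_real_derivative deriv h s - 1) (at s within closed_segment y (f y))" for s
        by (rule has_field_derivative_at_within, rule DERIV_diff[OF has_deriv[OF hL(1)] DERIV_ident])
      fix s assume "s \<in> closed_segment y (f y)"
      then have "\<bar>s - y\<bar> \<le> t / 2" using fy by (auto simp: closed_segment_eq_real_ivl split: if_splits)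
      then have s: "\<bar>s - t0\<bar> \<le> 2 * t" "t / 2 \<le> \<bar>s - t0\<bar>" using t(1) unfolding y_def by linarith+
      have "t / 2 * \<bar>deriv h s - 1\<bar> \<le> \<bar>s - t0\<bar> * \<bar>deriv h s - 1\<bar>" using s by (intro mult_right_mono) auto
      also have "\<dots> \<le> b * \<bar>s - t0\<bar> ^ k" using b s t by auto
      also have "\<dots> \<le> b * (2 * t) ^ k" using b s by (intro mult_left_mono power_mono) auto
      finally show "\<bar>deriv h s - 1\<bar> \<le> b * (2 * t) ^ k * (2 / t)" using t by (simp add: field_simps)
    qed auto
    define z where "z = h (f y)"
    \<comment> \<open>The displacement of the commutator is the variation of \<open>f - id\<close>
      from \<open>y\<close> to \<open>h y\<close> minus that of \<open>h - id\<close> from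
      \<open>y\<close> to \<open>f y\<close>. The orders are \<open>1 + k\<close> for the first and
      \<open>(k - 1) + 2\<close> for the second.\<close>
    have "\<bar>c z - z\<bar> = \<bar>((f (h y) - h y) - (f y - y)) - ((h (f y) - f y) - (h y - y))\<bar>"
      using c_eq[of y] by (simp add: z_def)
    also have "\<dots> \<le> (D2 * (2 * t)) * \<bar>h y - y\<bar> + (b * (2 * t) ^ k * (2 / t)) * \<bar>f y - y\<bar>" using uu vv by linarith
    also have "\<dots> \<le> (D2 * (2 * t)) * (b * t ^ k) + (b * (2 * t) ^ k * (2 / t)) * (D1 * t\<^sup>2)"
      using vy uy D2 b t by (intro add_mono mult_left_mono) auto
    also have "\<dots> = C * t * t ^ k" using t by (simp add: C_def power2_eq_square power_mult_distrib field_simps)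
    finally have up: "\<bar>c z - z\<bar> \<le> C * t * t ^ k" .
    have fyt: "\<bar>f y - t0\<bar> \<le> 2 * t" "t / 2 \<le> \<bar>f y - t0\<bar>" using fy t(1) unfolding y_def by linarith+
    have "\<bar>h (f y) - f y\<bar> \<le> D3 * (f y - t0)\<^sup>2" using D3(2)[of "f y"] fyt t by simp
    also have "\<dots> \<le> D3 * (2 * t)\<^sup>2" using power_mono[OF fyt(1), of 2] D3 by (intro mult_left_mono) simp_all
    finally have hfy: "\<bar>h (f y) - f y\<bar> \<le> D3 * (2 * t)\<^sup>2" .
    then have z_close: "\<bar>z - f y\<bar> \<le> t / 4" using small by (simp add: z_def)
    then have z_up: "\<bar>z - t0\<bar> < e1" "\<bar>z - t0\<bar> \<le> 1" using fyt t a(2) by linarith+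
    have z_low: "t / 4 \<le> \<bar>z - t0\<bar>" using z_close fyt by linarith
    have "a * (t / 4) ^ k \<le> a * \<bar>z - t0\<bar> ^ k" using a z_low t by (intro mult_left_mono power_mono) auto
    also have "\<dots> \<le> a * \<bar>z - t0\<bar> ^ j" using a z_up \<open>j \<le> k\<close> by (intro mult_left_mono power_decreasing) auto
    also have "\<dots> \<le> C * t * t ^ k" using a(3)[OF z_up(1)] up by linarith
    finally have "a / 4 ^ k \<le> C * t" using t by (simp add: power_divide field_simps)
    also have "\<dots> \<le> C * (a / (2 * 4 ^ k * C))" using t C by (intro mult_left_mono) auto
    also have "\<dots> = (a / 4 ^ k) / 2" using C by simp
    finally have "a / 4 ^ k \<le> (a / 4 ^ k) / 2" .
    moreover have "x \<le> 0" if "x \<le> x / 2" for x :: real using that by simp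
    ultimately have "a / 4 ^ k \<le> 0" by blast
    moreover have "0 < a / 4 ^ k" using a by simp
    ultimately show False by simp
  qed
  then show ?thesis using c_eq[of y] by simp
qed

text \<open>\<open>K\<close> is a stabilizing element of maximal contact or its inverse. An element
  fixing \<open>t0\<close> commutes with it, so if it also fixes \<open>t1\<close> it fixes the
  backward orbit of \<open>t1\<close> under \<open>K\<close>, which accumulates at
  \<open>t0\<close>; by analyticity it is trivial. \<open>K\<close> itself serves as
  \<open>E\<close>.\<close>

lemma base_pair:
  assumes "d > 0"
  shows "\<exists>t1\<in>X. t0 < t1 \<and> t1 < t0 + d \<and> (\<forall>F\<in>L. F t0 = t0 \<longrightarrow> F t1 = t1 \<longrightarrow> F = id) \<and>
    (\<exists>E\<in>L. E t0 = t0 \<and> t1 < E t1)"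
proof -
  obtain h k where h: "h \<in> stab" "tangency h k" and max: "\<And>F j. F \<in> stab \<Longrightarrow> tangency F j \<Longrightarrow> j \<le> k"
    using max_tangency by blast
  have hL: "h \<in> L" "h \<noteq> id" "h t0 = t0" using h by (auto simp: stab_def)
  obtain e K where e: "e > 0" and K: "K \<in> {h, finv h}" and push: "\<And>t. t0 < t \<Longrightarrow> t < t0 + e \<Longrightarrow> t < K t"
    using pushes_right(1)[OF hL] by blast
  have KL: "K \<in> L" "K t0 = t0" using K hL inv_in(1)[OF hL(1)] inv_in(2)[OF hL(1), of t0] by auto
  obtain t1 where t1: "t1 \<in> X" "t0 < t1" "t1 < t0 + min d e" using X_dense[of t0 "t0 + min d e"] e assms by auto
  have "F = id" if F: "F \<in> L" "F t0 = t0" "F t1 = t1" for F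
  proof -
    have com: "F (h y) = h (F y)" for y using max_tangency_commutes[OF h max F(1,2)] .
    have comi: "F (finv h y) = finv h (F y)" for y
      using com[of "finv h y"] inv_in(2,3)[OF hL(1)] by metis
    have comK: "F (K y) = K (F y)" for y using K com comi by auto
    have comR: "F (finv K y) = finv K (F y)" for y
      using comK[of "finv K y"] inv_in(2,3)[OF KL(1)] by metis
    have fixn: "F ((finv K ^^ n) t1) = (finv K ^^ n) t1" for n
      by (induction n) (simp_all add: F comR)
    have lim: "(\<lambda>n. (finv K ^^ n) t1) \<longlonglongrightarrow> t0" and gt: "\<And>n. t0 < (finv K ^^ n) t1"
      using finv_push[where q = t1 and e = e, OF KL(1) push KL(2)] t1 by auto
    show "F = id"
    proof (rule eq_id_if_fixed_points_accumulate[OF F(1), of t0])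
      fix \<epsilon> :: real assume "\<epsilon> > 0"
      then obtain n where "\<bar>(finv K ^^ n) t1 - t0\<bar> < \<epsilon>" using lim unfolding LIMSEQ_def dist_real_def by blast
      then show "\<exists>y. y \<noteq> t0 \<and> \<bar>y - t0\<bar> < \<epsilon> \<and> F y = y"
        using fixn[of n] gt[of n] by (intro exI[of _ "(finv K ^^ n) t1"]) auto
    qed
  qed
  moreover have "t1 < K t1" using push t1 by simp
  ultimately show ?thesis using t1 KL by auto
qed

end

section \<open>Summation over the orbit\<close>

text \<open>Every weight except the last fits into the gap to the next point, so these add up to at
  most \<open>b - a\<close>; the last one is covered by \<open>W\<close>.\<close>

lemma packing_sum:
  fixes w :: "real \<Rightarrow> real"
  assumes "finite P" "\<And>p. p \<in> P \<Longrightarrow> a \<le> p \<and> p \<le> b" "\<And>p q. p \<in> P \<Longrightarrow> q \<in> P \<Longrightarrow> p < q \<Longrightarrow> w p \<le> q - p"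
    "\<And>p. p \<in> P \<Longrightarrow> w p \<le> W" "0 \<le> W" "a \<le> b"
  shows "sum w P \<le> b - a + W"
  using assms
proof (induction P arbitrary: a rule: finite_linorder_min_induct)
  case empty
  then show ?case by simp
next
  case (insert p A)
  have pA: "p \<notin> A" using insert.hyps(2) by blast
  show ?case
  proof (cases "A = {}")
    case True
    then show ?thesis using insert.prems(3)[of p] insert.prems(5) by simp
  next
    case False
    then obtain q where q: "q \<in> A" by blast
    have gap: "p + w p \<le> q" if "q \<in> A" for q
      using insert.prems(2)[of p q] insert.hyps(2) that by auto
    have "sum w A \<le> b - (p + w p) + W"
    proof (rule insert.IH)
      show "p + w p \<le> q \<and> q \<le> b" if "q \<in> A" for q using gap[OF that] insert.prems(1)[of q] that by simp
      show "w p' \<le> q - p'" if "p' \<in> A" "q \<in> A" "p' < q" for p' q using insert.prems(2) that by simp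
      show "w q \<le> W" if "q \<in> A" for q using insert.prems(3) that by simp
      show "0 \<le> W" by fact
      show "p + w p \<le> b" using gap[OF q] insert.prems(1)[of q] q by simp
    qed
    moreover have "sum w (insert p A) = w p + sum w A" using insert.hyps(1) pA by simp
    ultimately show ?thesis using insert.prems(1)[of p] by simp
  qed
qed

context lift_group
begin

text \<open>Sort the points by the dyadic size of \<open>phi\<close>. By \<open>separation\<close>
  the points at level \<open>n\<close> have gaps of order at least \<open>2^-n\<close>, so there are
  \<open>O(2^n)\<close> of them, each contributing at most \<open>4^-n\<close>; the levels sum like
  a geometric series.\<close>

lemma phi_square_sum:
  assumes "u \<le> v"
  shows "\<exists>C. \<forall>A. finite A \<longrightarrow> A \<subseteq> X \<longrightarrow> (\<forall>y\<in>A. u \<le> y \<and> y \<le> v) \<longrightarrow> (\<Sum>y\<in>A. (phi y)\<^sup>2) \<le> C"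
proof -
  obtain c where c: "c > 0" and sep: "\<And>y z. y \<in> X \<Longrightarrow> z \<in> X \<Longrightarrow> y \<noteq> z \<Longrightarrow> c * (phi y * phi z) \<le> (y - z)\<^sup>2"
    using separation by blast
  define lev where "lev y = (LEAST n. (1/2::real) ^ Suc n < phi y)" for y
  have lev: "(1/2) ^ Suc (lev y) < phi y" "phi y \<le> (1/2) ^ lev y" if y: "y \<in> X" for y
  proof -
    obtain m where m: "(1/2) ^ m < phi y" using real_arch_pow_inv[of "phi y" "1/2"] phi_bounds[OF y] by auto
    moreover have "(1/2::real) ^ Suc m \<le> (1/2) ^ m" by (intro power_decreasing) auto
    ultimately have "(1/2::real) ^ Suc m < phi y" by linarith
    then show "(1/2) ^ Suc (lev y) < phi y" unfolding lev_def by (rule LeastI)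
    show "phi y \<le> (1/2) ^ lev y"
    proof (cases "lev y")
      case 0
      then show ?thesis using phi_bounds[OF y] by simp
    next
      case (Suc n)
      then have "\<not> (1/2) ^ Suc n < phi y" using not_less_Least[of n "\<lambda>n. (1/2::real) ^ Suc n < phi y"] by (simp add: lev_def)
      then show ?thesis using Suc by simp
    qed
  qed
  define D where "D = (v - u + sqrt c) * 2 / sqrt c"
  have D: "D \<ge> 0" using assms c by (simp add: D_def)
  have level: "(\<Sum>y\<in>{y \<in> A. lev y = n}. (phi y)\<^sup>2) \<le> D * (1/2) ^ n"
    if A: "finite A" "A \<subseteq> X" "\<forall>y\<in>A. u \<le> y \<and> y \<le> v" for A n
  proof -
    define B where "B = {y \<in> A. lev y = n}"
    define w where "w = sqrt c * (1/2) ^ Suc n"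
    have w: "w > 0" "w \<le> sqrt c"
      using c by (auto simp: w_def power_le_one mult_le_cancel_left1 simp del: power_Suc intro!: mult_left_le)
    have B: "finite B" "B \<subseteq> X" "B \<subseteq> A" using A by (auto simp: B_def)
    have "(\<Sum>y\<in>B. w) \<le> v - u + w"
    proof (rule packing_sum[OF B(1)])
      show "u \<le> p \<and> p \<le> v" if "p \<in> B" for p using that A B by blast
      show "w \<le> q - p" if "p \<in> B" "q \<in> B" "p < q" for p q
      proof -
        have "(1/2) ^ Suc n \<le> phi p" "(1/2) ^ Suc n \<le> phi q" using lev(1)[of p] lev(1)[of q] that B(2) by (auto simp: B_def)
        then have "(1/2) ^ Suc n * (1/2) ^ Suc n \<le> phi p * phi q"
          using phi_bounds(1) that B(2) by (intro mult_mono) (auto intro: less_imp_le)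
        then have "c * ((1/2) ^ Suc n * (1/2) ^ Suc n) \<le> c * (phi p * phi q)" using c by (intro mult_left_mono) auto
        also have "\<dots> \<le> (p - q)\<^sup>2" using sep that B(2) by blast
        finally have "w\<^sup>2 \<le> (q - p)\<^sup>2"
          using c by (simp only: w_def power_mult_distrib power2_commute[of q p]) (simp add: power2_eq_square)
        then show ?thesis using that(3) by (intro power2_le_imp_le[of w "q - p"]) auto
      qed
    qed (use w assms in auto)
    then have cw: "real (card B) * w \<le> v - u + sqrt c" using w by simp
    have "(\<Sum>y\<in>B. (phi y)\<^sup>2) \<le> (\<Sum>y\<in>B. ((1/2) ^ n)\<^sup>2)"
      using lev(2) B phi_bounds by (intro sum_mono power_mono) (auto simp: B_def intro: less_imp_le)
    also have "\<dots> = (real (card B) * w) * ((1/2) ^ n * 2 / sqrt c)"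
      using c by (simp add: w_def power2_eq_square)
    also have "\<dots> \<le> (v - u + sqrt c) * ((1/2) ^ n * 2 / sqrt c)"
      using cw c by (intro mult_right_mono) auto
    also have "\<dots> = D * (1/2) ^ n" by (simp add: D_def)
    finally show ?thesis by (simp add: B_def)
  qed
  have "(\<Sum>y\<in>A. (phi y)\<^sup>2) \<le> D * 2"
    if A: "finite A" "A \<subseteq> X" "\<forall>y\<in>A. u \<le> y \<and> y \<le> v" for A
  proof -
    have "(\<Sum>y\<in>A. (phi y)\<^sup>2) = (\<Sum>n\<in>lev ` A. \<Sum>y\<in>{y \<in> A. lev y = n}. (phi y)\<^sup>2)"
      using A(1) by (rule sum.image_gen)
    also have "\<dots> \<le> (\<Sum>n\<in>lev ` A. D * (1/2) ^ n)" using level[OF A] by (intro sum_mono)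
    also have "\<dots> = D * (\<Sum>n\<in>lev ` A. (1/2) ^ n)" by (simp add: sum_distrib_left)
    also have "(\<Sum>n\<in>lev ` A. (1/2::real) ^ n) \<le> (\<Sum>n. (1/2) ^ n)"
      using A(1) by (intro sum_le_suminf summable_geometric) auto
    also have "\<dots> = 2" by (simp add: suminf_geometric)
    finally show ?thesis using D by (simp add: mult_left_mono)
  qed
  then show ?thesis by blast
qed

lemma finite_large_phi:
  assumes "\<epsilon> > 0" "u \<le> v"
  shows "finite {y \<in> X. u \<le> y \<and> y \<le> v \<and> \<epsilon> \<le> phi y}"
proof (rule ccontr)
  assume inf: "infinite {y \<in> X. u \<le> y \<and> y \<le> v \<and> \<epsilon> \<le> phi y}"
  obtain C where C: "\<And>A. finite A \<Longrightarrow> A \<subseteq> X \<Longrightarrow> (\<forall>y\<in>A. u \<le> y \<and> y \<le> v) \<Longrightarrow> (\<Sum>y\<in>A. (phi y)\<^sup>2) \<le> C"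
    using phi_square_sum[OF assms(2)] by blast
  obtain n :: nat where n: "C < of_nat n * \<epsilon>\<^sup>2" using reals_Archimedean3[of "\<epsilon>\<^sup>2"] assms(1) by auto
  obtain A where A: "finite A" "card A = n" "A \<subseteq> {y \<in> X. u \<le> y \<and> y \<le> v \<and> \<epsilon> \<le> phi y}"
    using infinite_arbitrarily_large[OF inf] by blast
  have "of_nat n * \<epsilon>\<^sup>2 = (\<Sum>y\<in>A. \<epsilon>\<^sup>2)" using A by simp
  also have "\<dots> \<le> (\<Sum>y\<in>A. (phi y)\<^sup>2)" using A(3) assms(1) by (intro sum_mono power_mono) auto
  also have "\<dots> \<le> C" using A by (intro C) auto
  finally show False using n by simp
qed

text \<open>For points at distances \<open>r < r'\<close> from \<open>y\<close>, separation and
  nearness together give \<open>r' - r \<ge> \<kappa> * r * r' / phi y\<close>. So the weights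
  \<open>\<kappa> * r^2 / phi y\<close> satisfy the gap condition of \<open>packing_sum\<close> on
  an interval of length \<open>sqrt C * phi y\<close>. Being on one side of \<open>y\<close> makes
  differences of distances equal to distances.\<close>

lemma one_sided_fiber_sum:
  assumes "C > 0"
  shows "\<exists>C'. \<forall>y\<in>X. \<forall>Z. finite Z \<longrightarrow> Z \<subseteq> X \<longrightarrow> (\<forall>z\<in>Z. y < z) \<or> (\<forall>z\<in>Z. z < y) \<longrightarrow>
    (\<forall>z\<in>Z. phi z \<le> phi y \<and> (z - y)\<^sup>2 \<le> C * (phi y * phi z)) \<longrightarrow> (\<Sum>z\<in>Z. (z - y)\<^sup>2) \<le> C' * (phi y)\<^sup>2"
proof -
  obtain c where c: "c > 0" and sep: "\<And>y z. y \<in> X \<Longrightarrow> z \<in> X \<Longrightarrow> y \<noteq> z \<Longrightarrow> c * (phi y * phi z) \<le> (y - z)\<^sup>2"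
    using separation by blast
  define \<kappa> where "\<kappa> = sqrt c / C"
  have \<kappa>: "\<kappa> > 0" using c assms by (simp add: \<kappa>_def)
  define C' where "C' = (sqrt C + \<kappa> * C) / \<kappa>"
  have "(\<Sum>z\<in>Z. (z - y)\<^sup>2) \<le> C' * (phi y)\<^sup>2"
    if y: "y \<in> X" and Z: "finite Z" "Z \<subseteq> X" "(\<forall>z\<in>Z. y < z) \<or> (\<forall>z\<in>Z. z < y)"
      and near: "\<forall>z\<in>Z. phi z \<le> phi y \<and> (z - y)\<^sup>2 \<le> C * (phi y * phi z)" for y Z
  proof -
    note py = phi_bounds[OF y]
    have inj: "inj_on (\<lambda>z. \<bar>z - y\<bar>) Z" using Z(3) unfolding inj_on_def by (smt (verit))
    define w where "w r = \<kappa> * r\<^sup>2 / phi y" for r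
    have sq: "(z - y)\<^sup>2 \<le> C * (phi y)\<^sup>2" if "z \<in> Z" for z
    proof -
      have "C * (phi y * phi z) \<le> C * (phi y * phi y)" using near that py assms by (intro mult_left_mono) auto
      then show ?thesis using near that by (auto simp: power2_eq_square[of "phi y"])
    qed
    have "sum w ((\<lambda>z. \<bar>z - y\<bar>) ` Z) \<le> sqrt C * phi y - 0 + \<kappa> * C * phi y"
    proof (rule packing_sum)
      show "finite ((\<lambda>z. \<bar>z - y\<bar>) ` Z)" using Z(1) by simp
      show "0 \<le> r \<and> r \<le> sqrt C * phi y" if "r \<in> (\<lambda>z. \<bar>z - y\<bar>) ` Z" for r
      proof -
        have "r\<^sup>2 \<le> (sqrt C * phi y)\<^sup>2" using sq that assms by (auto simp: power_mult_distrib)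
        then show ?thesis using that assms py power2_le_imp_le[of r "sqrt C * phi y"] by auto
      qed
      show "w r \<le> \<kappa> * C * phi y" if "r \<in> (\<lambda>z. \<bar>z - y\<bar>) ` Z" for r
      proof -
        have "r\<^sup>2 \<le> C * (phi y)\<^sup>2" using sq that by auto
        then have "\<kappa> * r\<^sup>2 \<le> \<kappa> * (C * (phi y)\<^sup>2)" using \<kappa> by (intro mult_left_mono) auto
        then show ?thesis using py by (simp add: w_def power2_eq_square field_simps)
      qed
      show "w r \<le> r' - r" if rr: "r \<in> (\<lambda>z. \<bar>z - y\<bar>) ` Z" "r' \<in> (\<lambda>z. \<bar>z - y\<bar>) ` Z" "r < r'" for r r'
      proof -
        obtain z z' where z: "z \<in> Z" "r = \<bar>z - y\<bar>" "z' \<in> Z" "r' = \<bar>z' - y\<bar>" using rr by auto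
        have diff: "\<bar>z - z'\<bar> = r' - r" using z rr(3) Z(3) by (smt (verit))
        have pz: "0 < phi z" "0 < phi z'" using phi_bounds z Z(2) by blast+
        have "\<kappa> * r\<^sup>2 / phi y \<le> \<kappa> * (r * r') / phi y"
        proof -
          have "r * r \<le> r * r'" using rr(3) z(2) by (intro mult_left_mono) auto
          then show ?thesis using \<kappa> py by (intro divide_right_mono mult_left_mono) (auto simp: power2_eq_square)
        qed
        moreover have "(\<kappa> * (r * r') / phi y)\<^sup>2 \<le> (r' - r)\<^sup>2"
        proof -
          have "r\<^sup>2 \<le> C * (phi y * phi z)" "r'\<^sup>2 \<le> C * (phi y * phi z')" using near z by auto
          then have "r\<^sup>2 * r'\<^sup>2 \<le> (C * (phi y * phi z)) * (C * (phi y * phi z'))"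
            using assms py pz by (intro mult_mono) auto
          then have "\<kappa>\<^sup>2 * (r\<^sup>2 * r'\<^sup>2) / (phi y)\<^sup>2 \<le> \<kappa>\<^sup>2 * ((C * (phi y * phi z)) * (C * (phi y * phi z'))) / (phi y)\<^sup>2"
            by (intro divide_right_mono mult_left_mono) auto
          also have "\<dots> = (\<kappa> * C)\<^sup>2 * (phi z * phi z')" using py by (simp add: power2_eq_square)
          also have "\<dots> = c * (phi z * phi z')" using c assms by (simp add: \<kappa>_def)
          also have "\<dots> \<le> (z - z')\<^sup>2" using sep[of z z'] z rr(3) Z(2) by auto
          also have "\<dots> = (r' - r)\<^sup>2" using diff by (metis power2_abs)
          finally show ?thesis by (simp add: power_mult_distrib power_divide)
        qed
        then have "\<kappa> * (r * r') / phi y \<le> r' - r" by (rule power2_le_imp_le) (use rr(3) in simp)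
        ultimately show ?thesis by (simp add: w_def)
      qed
    qed (use assms \<kappa> py in auto)
    then have "(\<Sum>z\<in>Z. w \<bar>z - y\<bar>) \<le> sqrt C * phi y - 0 + \<kappa> * C * phi y"
      by (simp only: sum.reindex[OF inj] comp_def)
    also have "\<dots> = (sqrt C + \<kappa> * C) * phi y" by (simp add: distrib_right)
    finally have "(\<Sum>z\<in>Z. w \<bar>z - y\<bar>) \<le> (sqrt C + \<kappa> * C) * phi y" .
    moreover have "(\<Sum>z\<in>Z. w \<bar>z - y\<bar>) = \<kappa> / phi y * (\<Sum>z\<in>Z. (z - y)\<^sup>2)"
      by (simp add: w_def sum_distrib_left)
    ultimately have "\<kappa> * (\<Sum>z\<in>Z. (z - y)\<^sup>2) \<le> (sqrt C + \<kappa> * C) * phi y * phi y"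
      using py by (simp add: pos_divide_le_eq)
    then show ?thesis using \<kappa> by (simp add: C'_def power2_eq_square pos_le_divide_eq mult_ac)
  qed
  then show ?thesis by blast
qed

text \<open>Group the pairs by the heavier point \<open>y\<close>: each fiber contributes
  \<open>O((phi y)^2)\<close>, which is summable by \<open>phi_square_sum\<close>.\<close>

lemma near_pairs_sum:
  assumes "C > 0" "u \<le> v"
  shows "\<exists>C'. \<forall>Q. finite Q \<longrightarrow> Q \<subseteq> X \<times> X \<longrightarrow> (\<forall>(y, z)\<in>Q. y < z) \<or> (\<forall>(y, z)\<in>Q. z < y) \<longrightarrow>
    (\<forall>(y, z)\<in>Q. u \<le> y \<and> y \<le> v \<and> phi z \<le> phi y \<and> (z - y)\<^sup>2 \<le> C * (phi y * phi z)) \<longrightarrow>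
    (\<Sum>(y, z)\<in>Q. (z - y)\<^sup>2) \<le> C'"
proof -
  obtain C1 where C1: "\<forall>y\<in>X. \<forall>Z. finite Z \<longrightarrow> Z \<subseteq> X \<longrightarrow> (\<forall>z\<in>Z. y < z) \<or> (\<forall>z\<in>Z. z < y) \<longrightarrow>
    (\<forall>z\<in>Z. phi z \<le> phi y \<and> (z - y)\<^sup>2 \<le> C * (phi y * phi z)) \<longrightarrow> (\<Sum>z\<in>Z. (z - y)\<^sup>2) \<le> C1 * (phi y)\<^sup>2"
    using one_sided_fiber_sum[OF assms(1)] by (rule exE)
  obtain C2 where C2: "\<And>A. finite A \<Longrightarrow> A \<subseteq> X \<Longrightarrow> (\<forall>y\<in>A. u \<le> y \<and> y \<le> v) \<Longrightarrow> (\<Sum>y\<in>A. (phi y)\<^sup>2) \<le> C2"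
    using phi_square_sum[OF assms(2)] by blast
  have "(\<Sum>(y, z)\<in>Q. (z - y)\<^sup>2) \<le> \<bar>C1\<bar> * C2"
    if Q: "finite Q" "Q \<subseteq> X \<times> X" "(\<forall>(y, z)\<in>Q. y < z) \<or> (\<forall>(y, z)\<in>Q. z < y)"
      "\<forall>(y, z)\<in>Q. u \<le> y \<and> y \<le> v \<and> phi z \<le> phi y \<and> (z - y)\<^sup>2 \<le> C * (phi y * phi z)" for Q
  proof -
    have "(\<Sum>(y, z)\<in>Q. (z - y)\<^sup>2) = (\<Sum>q\<in>Q. (snd q - fst q)\<^sup>2)" by (simp add: case_prod_beta)
    also have "\<dots> = (\<Sum>y\<in>fst ` Q. \<Sum>q\<in>{q \<in> Q. fst q = y}. (snd q - fst q)\<^sup>2)"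
      using Q(1) by (rule sum.image_gen)
    also have "\<dots> \<le> (\<Sum>y\<in>fst ` Q. \<bar>C1\<bar> * (phi y)\<^sup>2)"
    proof (rule sum_mono)
      fix y assume "y \<in> fst ` Q"
      then have y: "y \<in> X" using Q(2) by auto
      define Z where "Z = snd ` {q \<in> Q. fst q = y}"
      have inj: "inj_on snd {q \<in> Q. fst q = y}" by (auto simp: inj_on_def)
      have "(\<Sum>z\<in>Z. (z - y)\<^sup>2) \<le> C1 * (phi y)\<^sup>2"
        by (rule C1[THEN bspec, OF y, THEN spec, THEN mp, THEN mp, THEN mp, THEN mp])
          (use Q in \<open>auto simp: Z_def\<close>)
      also have "\<dots> \<le> \<bar>C1\<bar> * (phi y)\<^sup>2" by (intro mult_right_mono) auto
      finally show "(\<Sum>q\<in>{q \<in> Q. fst q = y}. (snd q - fst q)\<^sup>2) \<le> \<bar>C1\<bar> * (phi y)\<^sup>2"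
        unfolding Z_def sum.reindex[OF inj] by simp
    qed
    also have "\<dots> = \<bar>C1\<bar> * (\<Sum>y\<in>fst ` Q. (phi y)\<^sup>2)" by (simp add: sum_distrib_left)
    also have "\<dots> \<le> \<bar>C1\<bar> * C2" using Q by (intro mult_left_mono C2) auto
    finally show ?thesis .
  qed
  then show ?thesis by blast
qed

end

section \<open>The two-point Schwarzian cocycle\<close>

text \<open>Logarithm of an infinitesimal cross-ratio distortion. It vanishes on Moebius maps, and
  for \<open>b\<close> near \<open>a\<close> it is to leading order \<open>(b - a)^2 / 6\<close>
  times the Schwarzian derivative.\<close>

definition schwarz :: "(real \<Rightarrow> real) \<Rightarrow> real \<Rightarrow> real \<Rightarrow> real"
  where "schwarz F a b = ln (deriv F a * deriv F b * (b - a)\<^sup>2 / (F b - F a)\<^sup>2)"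

context lift_group
begin

lemma diff_pos: "F \<in> L \<Longrightarrow> a < b \<Longrightarrow> 0 < F b - F a"
  using incr_diff_less_iff[OF incr_diff] by simp

lemma schwarz_comp:
  assumes "F \<in> L" "H \<in> L" "a < b"
  shows "schwarz (F \<circ> H) a b = schwarz F (H a) (H b) + schwarz H a b"
proof -
  have H: "0 < H b - H a" using diff_pos assms by blast
  have F: "0 < F (H b) - F (H a)" using diff_pos assms(1) H by simp
  have pos: "0 < deriv F t" "0 < deriv H t" for t using deriv_pos assms by blast+
  have "schwarz F (H a) (H b) + schwarz H a b =
    ln ((deriv F (H a) * deriv F (H b) * (H b - H a)\<^sup>2 / (F (H b) - F (H a))\<^sup>2) *
      (deriv H a * deriv H b * (b - a)\<^sup>2 / (H b - H a)\<^sup>2))"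
    unfolding schwarz_def using pos H F assms(3) by (subst ln_mult_pos) auto
  also have "(deriv F (H a) * deriv F (H b) * (H b - H a)\<^sup>2 / (F (H b) - F (H a))\<^sup>2) *
      (deriv H a * deriv H b * (b - a)\<^sup>2 / (H b - H a)\<^sup>2) =
    deriv (F \<circ> H) a * deriv (F \<circ> H) b * (b - a)\<^sup>2 / ((F \<circ> H) b - (F \<circ> H) a)\<^sup>2"
    using H by (simp add: deriv_comp[OF assms(1,2)] field_simps)
  finally show ?thesis by (simp add: schwarz_def)
qed

lemma schwarz_shift: "F \<in> L \<Longrightarrow> schwarz (\<lambda>t. F t + of_int n) a b = schwarz F a b"
  unfolding schwarz_def by (simp add: deriv_shift_right)

text \<open>With \<open>p = s1 b\<close>, Taylor expansion at \<open>b\<close> gives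
  \<open>s1 a = p - s2 b * \<delta> + r\<close> and the difference quotient
  \<open>q = p - s2 b * \<delta> / 2 + \<rho>\<close>, with remainders of order
  \<open>\<delta>^2\<close>. In \<open>s1 a * s1 b - q^2\<close> the terms of order 0 and 1 cancel.
  The lower bound \<open>m\<close> for the derivative carries the estimate over to the
  logarithm.\<close>

lemma schwarz_bound:
  assumes s: "s \<in> L"
  shows "\<exists>C>0. \<forall>a b. a < b \<longrightarrow> b < a + 1 \<longrightarrow> \<bar>schwarz s a b\<bar> \<le> C * (b - a)\<^sup>2"
proof -
  define s1 s2 s3 where "s1 = deriv s" and "s2 = deriv s1" and "s3 = deriv s2"
  note an = analytic_derivs[OF s, folded s1_def, folded s2_def, folded s3_def]
  have d: "(s has_real_derivative s1 t) (at t)" "(s1 has_real_derivative s2 t) (at t)"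
    "(s2 has_real_derivative s3 t) (at t)" for t
    unfolding s1_def s2_def s3_def
    using real_analytic_deriv(1)[OF analytic[OF s]] real_analytic_deriv(1)[OF an(1)] real_analytic_deriv(1)[OF an(2)]
    by (simp_all add: s1_def s2_def)
  have per: "s1 (t + 1) = s1 t" "s2 (t + 1) = s2 t" "s3 (t + 1) = s3 t" for t
    using deriv_periodic[OF s, of t 1] higher_deriv_periodic[OF s, of t] by (simp_all add: s1_def s2_def s3_def)
  obtain M1 where M1: "M1 \<ge> 0" "\<And>t. \<bar>s1 t\<bar> \<le> M1"
    using periodic_bounded[OF real_analytic_continuous[OF an(1)] per(1)] by blast
  obtain M2 where M2: "M2 \<ge> 0" "\<And>t. \<bar>s2 t\<bar> \<le> M2"
    using periodic_bounded[OF real_analytic_continuous[OF an(2)] per(2)] by blast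
  obtain M3 where M3: "M3 \<ge> 0" "\<And>t. \<bar>s3 t\<bar> \<le> M3"
    using periodic_bounded[OF real_analytic_continuous[OF an(3)] per(3)] by blast
  obtain m where m: "m > 0" "\<And>t. m \<le> s1 t" using deriv_lower_bound[OF s] by (auto simp: s1_def)
  \<comment> \<open>Sum of the bounds for the four terms in the expansion of
    \<open>s1 a * s1 b - q^2\<close>; higher powers of \<open>\<delta>\<close> are absorbed using
    \<open>\<delta> < 1\<close>.\<close>
  define K where "K = M1 * M3 + M2\<^sup>2 / 4 + M3\<^sup>2 + 2 * M3 * (M1 + M2 / 2)"
  have K: "K \<ge> 0" using M1 M2 M3 by (simp add: K_def)
  have bound: "\<bar>schwarz s a b\<bar> \<le> (K / m\<^sup>2 + 1) * (b - a)\<^sup>2" if ab: "a < b" "b < a + 1" for a b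
  proof -
    define \<delta> where "\<delta> = b - a"
    have \<delta>: "0 < \<delta>" "\<delta> < 1" using ab by (auto simp: \<delta>_def)
    have R2: "\<bar>(s1 t - s2 b * t) - (s1 b - s2 b * b)\<bar> \<le> (M3 * \<delta>) * \<bar>t - b\<bar>" if t: "t \<in> {a..b}" for t
    proof (rule field_differentiable_bound[of "{a..b}" "\<lambda>t. s1 t - s2 b * t" "\<lambda>t. s2 t - s2 b", unfolded real_norm_def])
      show "((\<lambda>t. s1 t - s2 b * t) has_real_derivative s2 u - s2 b) (at u within {a..b})" for u
        by (rule has_field_derivative_at_within) (auto intro!: derivative_eq_intros d(2))
      fix u assume u: "u \<in> {a..b}"
      have "\<bar>s2 u - s2 b\<bar> \<le> M3 * \<bar>u - b\<bar>"
        using field_differentiable_bound[of UNIV s2 s3 M3 u b] d(3) M3 by auto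
      also have "\<dots> \<le> M3 * \<delta>" using u M3 by (intro mult_left_mono) (auto simp: \<delta>_def)
      finally show "\<bar>s2 u - s2 b\<bar> \<le> M3 * \<delta>" .
    qed (use t ab in auto)
    have R2': "\<bar>s1 t - s1 b - s2 b * (t - b)\<bar> \<le> M3 * \<delta>\<^sup>2" if t: "t \<in> {a..b}" for t
    proof -
      have "\<bar>s1 t - s1 b - s2 b * (t - b)\<bar> \<le> (M3 * \<delta>) * \<bar>t - b\<bar>"
        using R2[OF t] by (simp add: algebra_simps)
      also have "\<dots> \<le> (M3 * \<delta>) * \<delta>" using t M3 \<delta> by (intro mult_left_mono) (auto simp: \<delta>_def)
      finally show ?thesis by (simp add: power2_eq_square mult.assoc)
    qed
    have "\<bar>(s a - s1 b * a - s2 b * (a - b)\<^sup>2 / 2) - (s b - s1 b * b - s2 b * (b - b)\<^sup>2 / 2)\<bar> \<le> (M3 * \<delta>\<^sup>2) * \<bar>a - b\<bar>"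
    proof (rule field_differentiable_bound[of "{a..b}" "\<lambda>t. s t - s1 b * t - s2 b * (t - b)\<^sup>2 / 2"
        "\<lambda>t. s1 t - s1 b - s2 b * (t - b)", unfolded real_norm_def])
      show "((\<lambda>t. s t - s1 b * t - s2 b * (t - b)\<^sup>2 / 2) has_real_derivative s1 u - s1 b - s2 b * (u - b)) (at u within {a..b})" for u
        by (rule has_field_derivative_at_within) (auto intro!: derivative_eq_intros d(1))
    qed (use R2' ab in auto)
    then have R: "\<bar>(s b - s a) - s1 b * \<delta> + s2 b * \<delta>\<^sup>2 / 2\<bar> \<le> M3 * \<delta>\<^sup>2 * \<delta>"
    proof -
      have "(s a - s1 b * a - s2 b * (a - b)\<^sup>2 / 2) - (s b - s1 b * b - s2 b * (b - b)\<^sup>2 / 2) =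
        - ((s b - s a) - s1 b * \<delta> + s2 b * \<delta>\<^sup>2 / 2)"
        by (simp add: \<delta>_def power2_commute[of a b]) (simp add: algebra_simps)
      moreover have "\<bar>a - b\<bar> = \<delta>" using ab by (simp add: \<delta>_def)
      ultimately show ?thesis
        using \<open>\<bar>(s a - s1 b * a - s2 b * (a - b)\<^sup>2 / 2) - (s b - s1 b * b - s2 b * (b - b)\<^sup>2 / 2)\<bar> \<le> (M3 * \<delta>\<^sup>2) * \<bar>a - b\<bar>\<close>
        by (metis abs_minus_cancel)
    qed
    define q where "q = (s b - s a) / \<delta>"
    define p where "p = s1 b"
    define \<rho> where "\<rho> = q - (p - s2 b * \<delta> / 2)"
    define r where "r = s1 a - (p - s2 b * \<delta>)"
    have "\<bar>\<rho>\<bar> * \<delta> = \<bar>(s b - s a) - s1 b * \<delta> + s2 b * \<delta>\<^sup>2 / 2\<bar>"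
    proof -
      have "\<rho> * \<delta> = (s b - s a) - s1 b * \<delta> + s2 b * \<delta>\<^sup>2 / 2"
        using \<delta> by (simp add: \<rho>_def q_def p_def power2_eq_square field_simps)
      then show ?thesis using \<delta> by (metis abs_mult abs_of_pos)
    qed
    then have "\<bar>\<rho>\<bar> * \<delta> \<le> (M3 * \<delta>\<^sup>2) * \<delta>" using R by simp
    then have \<rho>: "\<bar>\<rho>\<bar> \<le> M3 * \<delta>\<^sup>2" by (rule mult_right_le_imp_le) (use \<delta> in simp)
    have r: "\<bar>r\<bar> \<le> M3 * \<delta>\<^sup>2" using R2'[of a] ab by (simp add: r_def p_def \<delta>_def algebra_simps)
    have \<delta>2: "\<delta>\<^sup>2 \<le> 1" using \<delta> by (simp add: power_le_one)
    have "s1 a * s1 b - q\<^sup>2 = p * r - (s2 b)\<^sup>2 * \<delta>\<^sup>2 / 4 - \<rho>\<^sup>2 - 2 * \<rho> * (p - s2 b * \<delta> / 2)"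
    proof -
      have e: "s1 a = r + (p - s2 b * \<delta>)" "s1 b = p" "q = \<rho> + (p - s2 b * \<delta> / 2)"
        by (simp_all add: r_def p_def \<rho>_def)
      show ?thesis unfolding e by (simp add: power2_eq_square field_simps)
    qed
    also have "\<bar>\<dots>\<bar> \<le> \<bar>p * r\<bar> + \<bar>(s2 b)\<^sup>2 * \<delta>\<^sup>2 / 4\<bar> + \<bar>\<rho>\<^sup>2\<bar> + \<bar>2 * \<rho> * (p - s2 b * \<delta> / 2)\<bar>" by linarith
    also have "\<dots> \<le> M1 * (M3 * \<delta>\<^sup>2) + M2\<^sup>2 * \<delta>\<^sup>2 / 4 + M3\<^sup>2 * \<delta>\<^sup>2 + 2 * (M3 * \<delta>\<^sup>2) * (M1 + M2 / 2)"
    proof (intro add_mono)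
      show "\<bar>p * r\<bar> \<le> M1 * (M3 * \<delta>\<^sup>2)" unfolding abs_mult p_def using M1 r by (intro mult_mono) auto
      have "(s2 b)\<^sup>2 \<le> M2\<^sup>2" using power_mono[OF M2(2)[of b], of 2] by simp
      then show "\<bar>(s2 b)\<^sup>2 * \<delta>\<^sup>2 / 4\<bar> \<le> M2\<^sup>2 * \<delta>\<^sup>2 / 4" by (simp add: mult_right_mono)
      have "\<rho>\<^sup>2 \<le> (M3 * \<delta>\<^sup>2)\<^sup>2" using power_mono[OF \<rho>, of 2] by simp
      also have "\<dots> = M3\<^sup>2 * \<delta>\<^sup>2 * \<delta>\<^sup>2" by (simp add: power2_eq_square)
      also have "\<dots> \<le> M3\<^sup>2 * \<delta>\<^sup>2 * 1" using \<delta>2 by (intro mult_left_mono) auto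
      finally show "\<bar>\<rho>\<^sup>2\<bar> \<le> M3\<^sup>2 * \<delta>\<^sup>2" by simp
      have "\<bar>s2 b * \<delta>\<bar> \<le> M2 * 1" unfolding abs_mult using M2 \<delta> by (intro mult_mono) auto
      then have "\<bar>p - s2 b * \<delta> / 2\<bar> \<le> M1 + M2 / 2" using M1(2)[of b] unfolding p_def by linarith
      then show "\<bar>2 * \<rho> * (p - s2 b * \<delta> / 2)\<bar> \<le> 2 * (M3 * \<delta>\<^sup>2) * (M1 + M2 / 2)"
        unfolding abs_mult using \<rho> M3 by (intro mult_mono) auto
    qed
    also have "\<dots> = K * \<delta>\<^sup>2" by (simp add: K_def algebra_simps)
    finally have main: "\<bar>s1 a * s1 b - q\<^sup>2\<bar> \<le> K * \<delta>\<^sup>2" .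
    obtain x where x: "a < x" "x < b" "s b - s a = (b - a) * s1 x"
      using MVT2[OF ab(1), of s s1] d(1) by blast
    then have "q = s1 x" using \<delta> by (simp add: q_def \<delta>_def)
    then have q: "m \<le> q" using m by simp
    then have q2: "m\<^sup>2 \<le> q\<^sup>2" using m by (intro power_mono) auto
    have pp: "m\<^sup>2 \<le> s1 a * s1 b" unfolding power2_eq_square using m by (intro mult_mono) (auto intro: order_trans less_imp_le)
    have m2: "m\<^sup>2 > 0" using m by simp
    have p0: "0 < s1 a * s1 b" "0 < q\<^sup>2" using less_le_trans[OF m2 pp] less_le_trans[OF m2 q2] .
    have eq: "schwarz s a b = ln (s1 a * s1 b) - ln (q\<^sup>2)"
    proof -
      have "deriv s a * deriv s b * (b - a)\<^sup>2 / (s b - s a)\<^sup>2 = (s1 a * s1 b) / q\<^sup>2"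
        by (simp add: s1_def q_def \<delta>_def power_divide)
      then show ?thesis unfolding schwarz_def by (simp only: ln_divide_pos[OF p0])
    qed
    have "ln (s1 a * s1 b) - ln (q\<^sup>2) \<le> (s1 a * s1 b - q\<^sup>2) / q\<^sup>2"
      using p0 by (intro ln_diff_le)
    also have "\<dots> \<le> \<bar>s1 a * s1 b - q\<^sup>2\<bar> / m\<^sup>2" using q2 m2 by (intro frac_le) auto
    also have "\<dots> \<le> K * \<delta>\<^sup>2 / m\<^sup>2" using main m2 by (intro divide_right_mono) auto
    finally have up: "schwarz s a b \<le> K / m\<^sup>2 * \<delta>\<^sup>2" using eq by simp
    have "ln (q\<^sup>2) - ln (s1 a * s1 b) \<le> (q\<^sup>2 - s1 a * s1 b) / (s1 a * s1 b)"
      using p0 by (intro ln_diff_le)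
    also have "\<dots> \<le> \<bar>s1 a * s1 b - q\<^sup>2\<bar> / m\<^sup>2" using pp m2 by (intro frac_le) auto
    also have "\<dots> \<le> K * \<delta>\<^sup>2 / m\<^sup>2" using main m2 by (intro divide_right_mono) auto
    finally have "- schwarz s a b \<le> K / m\<^sup>2 * \<delta>\<^sup>2" using eq by simp
    with up have "\<bar>schwarz s a b\<bar> \<le> K / m\<^sup>2 * \<delta>\<^sup>2" by linarith
    also have "\<dots> \<le> (K / m\<^sup>2 + 1) * \<delta>\<^sup>2" by (intro mult_right_mono) auto
    finally show ?thesis by (simp add: \<delta>_def)
  qed
  have "K / m\<^sup>2 + 1 > 0" using K m by (simp add: add_nonneg_pos)
  then show ?thesis using bound by blast
qed

lemma schwarz_bound_finite:
  assumes "finite S" "S \<subseteq> L"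
  shows "\<exists>C>0. \<forall>s\<in>S. \<forall>a b. a < b \<longrightarrow> b < a + 1 \<longrightarrow> \<bar>schwarz s a b\<bar> \<le> C * (b - a)\<^sup>2"
  using assms
proof (induction S)
  case empty
  then show ?case using zero_less_one by blast
next
  case (insert s S)
  then obtain C1 where C1: "C1 > 0" "\<forall>s\<in>S. \<forall>a b. a < b \<longrightarrow> b < a + 1 \<longrightarrow> \<bar>schwarz s a b\<bar> \<le> C1 * (b - a)\<^sup>2"
    by auto
  obtain C2 where C2: "C2 > 0" "\<forall>a b. a < b \<longrightarrow> b < a + 1 \<longrightarrow> \<bar>schwarz s a b\<bar> \<le> C2 * (b - a)\<^sup>2"
    using schwarz_bound insert.prems by blast
  have mono: "C * x\<^sup>2 \<le> max C1 C2 * x\<^sup>2" if "C = C1 \<or> C = C2" for C x :: real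
    using that by (intro mult_right_mono) auto
  have "\<forall>s\<in>insert s S. \<forall>a b. a < b \<longrightarrow> b < a + 1 \<longrightarrow> \<bar>schwarz s a b\<bar> \<le> max C1 C2 * (b - a)\<^sup>2"
  proof (intro ballI allI impI)
    fix r and a b :: real assume r: "r \<in> insert s S" and ab: "a < b" "b < a + 1"
    show "\<bar>schwarz r a b\<bar> \<le> max C1 C2 * (b - a)\<^sup>2"
    proof (cases "r = s")
      case True
      then have "\<bar>schwarz r a b\<bar> \<le> C2 * (b - a)\<^sup>2" using C2(2) ab by blast
      then show ?thesis using mono[of C2 "b - a"] by simp
    next
      case False
      then have "\<bar>schwarz r a b\<bar> \<le> C1 * (b - a)\<^sup>2" using C1(2) r ab by blast
      then show ?thesis using mono[of C1 "b - a"] by simp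
    qed
  qed
  then show ?case using C1(1) by (intro exI[of _ "max C1 C2"]) auto
qed

text \<open>One representative for each class modulo integer translations, hence one lift for each
  circle map.\<close>

definition normalized :: "(real \<Rightarrow> real) set"
  where "normalized = {F \<in> L. 0 \<le> F t0 \<and> F t0 < 1}"

text \<open>A lower bound for the cocycle reads
  \<open>(F t1 - F t0)^2 \<le> C * (phi (F t0) * phi (F t1))\<close>. By \<open>free\<close> an
  element is determined by the images of \<open>t0\<close> and \<open>t1\<close>, so the sum runs
  over distinct near pairs. They are split by which end is heavier, because
  \<open>near_pairs_sum\<close> wants that end first.\<close>

lemma bounded_schwarz_sum:
  assumes t1: "t1 \<in> X" "t0 < t1" "t1 < t0 + 1"
    and free: "\<And>F. F \<in> L \<Longrightarrow> F t0 = t0 \<Longrightarrow> F t1 = t1 \<Longrightarrow> F = id"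
  shows "\<exists>C. \<forall>A. finite A \<longrightarrow> A \<subseteq> {F \<in> normalized. T \<le> schwarz F t0 t1} \<longrightarrow> (\<Sum>F\<in>A. (F t1 - F t0)\<^sup>2) \<le> C"
proof -
  \<comment> \<open>The division by \<open>phi t1\<close> converts \<open>deriv F t1\<close> into
    \<open>phi (F t1)\<close>.\<close>
  define C where "C = exp (- T) * (t1 - t0)\<^sup>2 / phi t1"
  have C: "C > 0" using phi_bounds[OF t1(1)] t1(2) by (simp add: C_def)
  \<comment> \<open>The range up to 2 covers the case that the heavier end is \<open>F t1\<close>,
    which is below \<open>F t0 + 1\<close>.\<close>
  obtain C1 where C1: "\<forall>Q. finite Q \<longrightarrow> Q \<subseteq> X \<times> X \<longrightarrow> (\<forall>(y, z)\<in>Q. y < z) \<or> (\<forall>(y, z)\<in>Q. z < y) \<longrightarrow>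
    (\<forall>(y, z)\<in>Q. 0 \<le> y \<and> y \<le> 2 \<and> phi z \<le> phi y \<and> (z - y)\<^sup>2 \<le> C * (phi y * phi z)) \<longrightarrow>
    (\<Sum>(y, z)\<in>Q. (z - y)\<^sup>2) \<le> C1"
    using near_pairs_sum[OF C, of 0 2] by auto
  have eqI: "F = H" if "F \<in> L" "H \<in> L" "F t0 = H t0" "F t1 = H t1" for F H
  proof -
    have "finv H \<circ> F = id" using that inv_in(1,2)[OF that(2)] comp_in by (intro free) auto
    then have "H \<circ> (finv H \<circ> F) = H" by simp
    then show ?thesis using inv_in(3)[OF that(2)] by (auto simp: fun_eq_iff)
  qed
  have "(\<Sum>F\<in>A. (F t1 - F t0)\<^sup>2) \<le> C1 + C1"
    if A: "finite A" "A \<subseteq> {F \<in> normalized. T \<le> schwarz F t0 t1}" for A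
  proof -
    have AL: "F \<in> L" "0 \<le> F t0" "F t0 < 1" "T \<le> schwarz F t0 t1" if "F \<in> A" for F
      using A that by (auto simp: normalized_def)
    have near: "(F t1 - F t0)\<^sup>2 \<le> C * (phi (F t0) * phi (F t1))" if "F \<in> A" for F
    proof -
      have d: "0 < F t1 - F t0" using diff_pos AL(1)[OF that] t1(2) by blast
      have pos: "0 < deriv F t0" "0 < deriv F t1" using deriv_pos AL(1)[OF that] by blast+
      define E where "E = deriv F t0 * deriv F t1 * (t1 - t0)\<^sup>2 / (F t1 - F t0)\<^sup>2"
      have E: "E > 0" using pos d t1(2) by (simp add: E_def)
      have "exp T \<le> exp (ln E)" using AL(4)[OF that] unfolding schwarz_def E_def[symmetric] by simp
      then have "exp T \<le> E" using E by simp
      then have "exp T * (F t1 - F t0)\<^sup>2 \<le> deriv F t0 * deriv F t1 * (t1 - t0)\<^sup>2"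
        using d by (simp add: E_def field_simps)
      then have "(F t1 - F t0)\<^sup>2 \<le> exp (- T) * (deriv F t0 * deriv F t1 * (t1 - t0)\<^sup>2)"
        by (simp add: exp_minus field_simps)
      also have "\<dots> = C * (phi (F t0) * phi (F t1))"
        using phi_eq[OF AL(1)[OF that]] phi_image(2)[OF AL(1)[OF that] t1(1)] phi_bounds[OF t1(1)]
        by (simp add: C_def)
      finally show ?thesis .
    qed
    have lt: "F t0 < F t1" "F t1 < F t0 + 1" if "F \<in> A" for F
      using incr_diff_less_iff[OF incr_diff[OF AL(1)[OF that]]] t1 periodic[OF AL(1)[OF that], of t0] by metis+
    have FX: "F t0 \<in> X" "F t1 \<in> X" if "F \<in> A" for F
      using XI phi_image(1) t1(1) AL(1)[OF that] by blast+
    define A1 where "A1 = {F \<in> A. phi (F t1) \<le> phi (F t0)}"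
    define A2 where "A2 = A - A1"
    have A12: "A1 \<subseteq> A" "A2 \<subseteq> A" by (auto simp: A1_def A2_def)
    have inj1: "inj_on (\<lambda>F. (F t0, F t1)) A1" and inj2: "inj_on (\<lambda>F. (F t1, F t0)) A2"
      using A12 by (auto intro!: inj_onI eqI AL(1))
    have "(\<Sum>(y, z)\<in>(\<lambda>F. (F t0, F t1)) ` A1. (z - y)\<^sup>2) \<le> C1"
    proof (rule C1[THEN spec, THEN mp, THEN mp, THEN mp, THEN mp])
      show "finite ((\<lambda>F. (F t0, F t1)) ` A1)" using A(1) A12 finite_subset by blast
      show "(\<lambda>F. (F t0, F t1)) ` A1 \<subseteq> X \<times> X" using FX A12 by auto
      show "(\<forall>(y, z)\<in>(\<lambda>F. (F t0, F t1)) ` A1. y < z) \<or> (\<forall>(y, z)\<in>(\<lambda>F. (F t0, F t1)) ` A1. z < y)" using lt A12 by auto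
      show "\<forall>(y, z)\<in>(\<lambda>F. (F t0, F t1)) ` A1. 0 \<le> y \<and> y \<le> 2 \<and> phi z \<le> phi y \<and> (z - y)\<^sup>2 \<le> C * (phi y * phi z)"
        using AL near by (force simp: A1_def)
    qed
    then have 1: "(\<Sum>F\<in>A1. (F t1 - F t0)\<^sup>2) \<le> C1" by (simp add: sum.reindex[OF inj1])
    have "(\<Sum>(y, z)\<in>(\<lambda>F. (F t1, F t0)) ` A2. (z - y)\<^sup>2) \<le> C1"
    proof (rule C1[THEN spec, THEN mp, THEN mp, THEN mp, THEN mp])
      show "finite ((\<lambda>F. (F t1, F t0)) ` A2)" using A(1) A12 finite_subset by blast
      show "(\<lambda>F. (F t1, F t0)) ` A2 \<subseteq> X \<times> X" using FX A12 by auto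
      show "(\<forall>(y, z)\<in>(\<lambda>F. (F t1, F t0)) ` A2. y < z) \<or> (\<forall>(y, z)\<in>(\<lambda>F. (F t1, F t0)) ` A2. z < y)" using lt A12 by auto
      have "0 \<le> F t1 \<and> F t1 \<le> 2 \<and> phi (F t0) \<le> phi (F t1) \<and> (F t0 - F t1)\<^sup>2 \<le> C * (phi (F t1) * phi (F t0))" if "F \<in> A2" for F
      proof -
        have FA: "F \<in> A" "phi (F t0) \<le> phi (F t1)" using that by (auto simp: A1_def A2_def)
        then show ?thesis using lt[OF FA(1)] AL[OF FA(1)] near[OF FA(1)]
          by (auto simp: power2_commute mult.commute[of "phi (F t1)"])
      qed
      then show "\<forall>(y, z)\<in>(\<lambda>F. (F t1, F t0)) ` A2. 0 \<le> y \<and> y \<le> 2 \<and> phi z \<le> phi y \<and> (z - y)\<^sup>2 \<le> C * (phi y * phi z)"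
        by auto
    qed
    then have 2: "(\<Sum>F\<in>A2. (F t1 - F t0)\<^sup>2) \<le> C1" by (simp add: sum.reindex[OF inj2] power2_commute)
    have "(\<Sum>F\<in>A. (F t1 - F t0)\<^sup>2) = (\<Sum>F\<in>A1. (F t1 - F t0)\<^sup>2) + (\<Sum>F\<in>A2. (F t1 - F t0)\<^sup>2)"
      using sum.subset_diff[OF A12(1) A(1), of "\<lambda>F. (F t1 - F t0)\<^sup>2"] by (simp add: A2_def)
    then show ?thesis using 1 2 by linarith
  qed
  then show ?thesis by blast
qed

end

section \<open>Choice of a level with finite boundary\<close>

lemma summable_tail_small:
  fixes w :: "'a \<Rightarrow> real"
  assumes bd: "\<And>A. finite A \<Longrightarrow> A \<subseteq> I \<Longrightarrow> sum w A \<le> C" and "\<epsilon> > 0"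
  obtains B where "finite B" "B \<subseteq> I" "\<And>A. finite A \<Longrightarrow> A \<subseteq> I - B \<Longrightarrow> sum w A \<le> \<epsilon>"
proof -
  define V where "V = sum w ` {A. finite A \<and> A \<subseteq> I}"
  have ne: "V \<noteq> {}" by (auto simp: V_def)
  have bdd: "bdd_above V" using bd by (auto simp: V_def bdd_above_def)
  have "Sup V - \<epsilon> < Sup V" using assms(2) by simp
  then obtain x where "x \<in> V" "Sup V - \<epsilon> < x" using less_cSup_iff[OF ne bdd] by blast
  then obtain B where B: "finite B" "B \<subseteq> I" "Sup V - \<epsilon> < sum w B" by (auto simp: V_def)
  have "sum w A \<le> \<epsilon>" if A: "finite A" "A \<subseteq> I - B" for A
  proof -
    have "sum w (A \<union> B) \<le> Sup V" using A B by (intro cSup_upper[OF _ bdd]) (auto simp: V_def)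
    moreover have "sum w (A \<union> B) = sum w A + sum w B" using A B by (intro sum.union_disjoint) auto
    ultimately show ?thesis using B(3) by linarith
  qed
  then show thesis using that B by blast
qed

lemma finite_cover_length:
  fixes c r :: "'a \<Rightarrow> real"
  assumes "finite I" "{a..b} \<subseteq> (\<Union>i\<in>I. ball (c i) (r i))" "\<And>i. i \<in> I \<Longrightarrow> 0 \<le> r i" "a \<le> b"
  shows "b - a \<le> (\<Sum>i\<in>I. 2 * r i)"
proof -
  have "ennreal (b - a) = emeasure lborel {a..b}" using assms(4) by simp
  also have "\<dots> \<le> emeasure lborel (\<Union>i\<in>I. ball (c i) (r i))" using assms(1,2) by (intro emeasure_mono) auto
  also have "\<dots> \<le> (\<Sum>i\<in>I. emeasure lborel (ball (c i) (r i)))"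
    using assms(1) by (intro emeasure_subadditive_finite) auto
  also have "\<dots> = (\<Sum>i\<in>I. ennreal (2 * r i))"
    using assms(3) by (intro sum.cong refl) (simp add: ball_eq_greaterThanLessThan)
  also have "\<dots> = ennreal (\<Sum>i\<in>I. 2 * r i)" using assms(3) by (intro sum_ennreal) auto
  finally show ?thesis using assms(3) by (subst (asm) ennreal_le_iff) (auto intro: sum_nonneg)
qed

context lift_group
begin

text \<open>A coarea argument: the values of the cocycle along an edge of the Cayley graph differ by a summable
  amount, so almost every level is crossed by finitely many edges only.\<close>

lemma level_with_finite_boundary:
  assumes t1: "t1 \<in> X" "t0 < t1" "t1 < t0 + 1"
    and free: "\<And>F. F \<in> L \<Longrightarrow> F t0 = t0 \<Longrightarrow> F t1 = t1 \<Longrightarrow> F = id"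
    and S: "finite S" "S \<subseteq> L"
  shows "\<exists>t. T < t \<and> t < T + 1 \<and>
    (\<forall>s\<in>S. finite {F \<in> normalized. (t < schwarz F t0 t1) \<noteq> (t < schwarz (s \<circ> F) t0 t1)})"
proof -
  obtain C0 where C0: "C0 > 0" "\<forall>s\<in>S. \<forall>a b. a < b \<longrightarrow> b < a + 1 \<longrightarrow> \<bar>schwarz s a b\<bar> \<le> C0 * (b - a)\<^sup>2"
    using schwarz_bound_finite[OF S] by blast
  define d where "d F = F t1 - F t0" for F :: "real \<Rightarrow> real"
  have d: "0 < d F" "d F < 1" if "F \<in> normalized" for F
  proof -
    have "F \<in> L" using that by (simp add: normalized_def)
    then have "F t0 < F t1" "F t1 < F (t0 + 1)"
      unfolding incr_diff_less_iff[OF incr_diff[OF \<open>F \<in> L\<close>]] using t1 by auto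
    moreover have "F (t0 + 1) = F t0 + 1" using periodic[OF \<open>F \<in> L\<close>] .
    ultimately show "0 < d F" "d F < 1" by (simp_all add: d_def)
  qed
  have step: "\<bar>schwarz (s \<circ> F) t0 t1 - schwarz F t0 t1\<bar> \<le> C0 * (d F)\<^sup>2" if "F \<in> normalized" "s \<in> S" for F s
  proof -
    have "F \<in> L" "s \<in> L" using that S by (auto simp: normalized_def)
    then have "schwarz (s \<circ> F) t0 t1 - schwarz F t0 t1 = schwarz s (F t0) (F t1)"
      using schwarz_comp[of s F t0 t1] t1 by simp
    moreover have "\<bar>schwarz s (F t0) (F t1)\<bar> \<le> C0 * (d F)\<^sup>2"
      using C0(2) that d[OF that(1)] by (auto simp: d_def)
    ultimately show ?thesis by simp
  qed
  \<comment> \<open>The margin \<open>C0\<close> keeps every crossing edge inside \<open>I\<close>: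
    if \<open>t\<close> separates the value at \<open>F\<close> from that at a neighbour, then the
    value at \<open>F\<close> is within \<open>C0\<close> of \<open>t\<close>.\<close>
  define I where "I = {F \<in> normalized. T - C0 \<le> schwarz F t0 t1}"
  obtain C where C: "\<And>A. finite A \<Longrightarrow> A \<subseteq> I \<Longrightarrow> (\<Sum>F\<in>A. (d F)\<^sup>2) \<le> C"
    using bounded_schwarz_sum[OF t1 free, of "T - C0"] unfolding I_def d_def by blast
  \<comment> \<open>The tail is so small that any finite family of the balls below has total length
    at most 1/4, less than the length 1/2 of the interval in which \<open>t\<close> is
    sought.\<close>
  obtain B where B: "finite B" "B \<subseteq> I" "\<And>A. finite A \<Longrightarrow> A \<subseteq> I - B \<Longrightarrow> (\<Sum>F\<in>A. (d F)\<^sup>2) \<le> 1 / (16 * C0)"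
    using summable_tail_small[of I "\<lambda>F. (d F)\<^sup>2" C "1 / (16 * C0)"] C C0(1) by auto
  \<comment> \<open>The radius is twice the possible jump, so that a level at distance exactly
    \<open>C0 * (d F)^2\<close> still lies in the open ball.\<close>
  define J where "J F = ball (schwarz F t0 t1) (2 * C0 * (d F)\<^sup>2)" for F
  have "\<not> {T + 1/4..T + 3/4} \<subseteq> (\<Union>F\<in>I - B. J F)"
  proof
    assume "{T + 1/4..T + 3/4} \<subseteq> (\<Union>F\<in>I - B. J F)"
    then obtain A where A: "A \<subseteq> I - B" "finite A" "{T + 1/4..T + 3/4} \<subseteq> (\<Union>F\<in>A. J F)"
      using compactE_image[of "{T + 1/4..T + 3/4}" "I - B" J] by (auto simp: J_def)
    have "(T + 3/4) - (T + 1/4) \<le> (\<Sum>F\<in>A. 2 * (2 * C0 * (d F)\<^sup>2))"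
      using A C0 by (intro finite_cover_length[of A _ _ "\<lambda>F. schwarz F t0 t1"]) (auto simp: J_def)
    also have "\<dots> = 4 * C0 * (\<Sum>F\<in>A. (d F)\<^sup>2)" by (simp add: sum_distrib_left mult.assoc)
    also have "\<dots> \<le> 4 * C0 * (1 / (16 * C0))" using B(3)[OF A(2,1)] C0 by (intro mult_left_mono) auto
    also have "\<dots> = 1 / 4" using C0 by simp
    finally show False by simp
  qed
  then obtain t where "t \<in> {T + 1/4..T + 3/4}" "t \<notin> (\<Union>F\<in>I - B. J F)" by blast
  then have t: "T + 1/4 \<le> t" "t \<le> T + 3/4" "\<And>F. F \<in> I - B \<Longrightarrow> t \<notin> J F" by auto
  have "{F \<in> normalized. (t < schwarz F t0 t1) \<noteq> (t < schwarz (s \<circ> F) t0 t1)} \<subseteq> B" if s: "s \<in> S" for s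
  proof
    fix F assume "F \<in> {F \<in> normalized. (t < schwarz F t0 t1) \<noteq> (t < schwarz (s \<circ> F) t0 t1)}"
    then have F: "F \<in> normalized" "(t < schwarz F t0 t1) \<noteq> (t < schwarz (s \<circ> F) t0 t1)" by auto
    note st = step[OF F(1) s]
    have dd: "0 < (d F)\<^sup>2" "(d F)\<^sup>2 \<le> 1" using d[OF F(1)] by (auto simp: power_le_one)
    have C0d: "0 < C0 * (d F)\<^sup>2" "C0 * (d F)\<^sup>2 \<le> C0" using dd C0 by auto
    have close: "\<bar>schwarz F t0 t1 - t\<bar> \<le> C0 * (d F)\<^sup>2" using F(2) st by linarith
    then have "F \<in> I" using F(1) C0d t(1) unfolding I_def by (simp; linarith)
    moreover have "t \<in> J F" using close C0d by (simp add: J_def dist_real_def)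
    ultimately show "F \<in> B" using t(3) by blast
  qed
  then have "\<forall>s\<in>S. finite {F \<in> normalized. (t < schwarz F t0 t1) \<noteq> (t < schwarz (s \<circ> F) t0 t1)}"
    using B(1) finite_subset by blast
  then show ?thesis using t by (intro exI[of _ t]) auto
qed

lemma X_infinite: "infinite (X \<inter> {0<..<1})"
proof
  assume fin: "finite (X \<inter> {0<..<1})"
  obtain p where p: "p \<in> X \<inter> {0<..<1}" using X_dense[of 0 1] by auto
  define q where "q = Min (X \<inter> {0<..<1})"
  have "q \<in> X \<inter> {0<..<1}" unfolding q_def using fin p by (intro Min_in) auto
  moreover obtain r where "r \<in> X" "0 < r" "r < q" using X_dense[of 0 q] calculation by auto
  ultimately have "q \<le> r" unfolding q_def using fin by (intro Min_le) auto
  then show False using \<open>r < q\<close> by simp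
qed

text \<open>The images \<open>z j\<close> of \<open>t1\<close> are distinct orbit points in a
  bounded interval, so some of their weights are arbitrarily small. The derivative at
  \<open>t0\<close> does not change along the sequence and the length of the image interval does not
  drop below \<open>d0\<close>, so the quotient inside the logarithm becomes small.\<close>

lemma schwarz_unbounded_below:
  assumes t1: "t1 \<in> X" "t0 < t1" "t1 < t0 + 1" and E: "E \<in> L" "E t0 = t0" "t1 < E t1"
    and F: "F \<in> L" and N: "N \<ge> 1"
  shows "\<exists>j. schwarz (F \<circ> (E ^^ (N * j))) t0 t1 \<le> t"
proof -
  define z where "z j = F ((E ^^ (N * j)) t1)" for j
  have EL: "E ^^ n \<in> L" "(E ^^ n) t0 = t0" for n
    using funpow_in[OF E(1)] by (auto, induction n) (simp_all add: E(2))
  have inc: "strict_mono (\<lambda>n. (E ^^ n) t1)"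
    using orbit_sum(2)[OF incr_diff[OF E(1)] E(3)] by (simp add: strict_mono_Suc_iff)
  have zmono: "strict_mono z"
  proof (rule strict_monoI)
    fix i j :: nat assume "i < j"
    then have "(E ^^ (N * i)) t1 < (E ^^ (N * j)) t1" using N strict_monoD[OF inc] by simp
    then show "z i < z j" using incr_diff_less_iff[OF incr_diff[OF F]] by (simp add: z_def)
  qed
  have zX: "z j \<in> X" for j unfolding z_def using phi_image(1) F EL t1(1) by blast
  have zle: "F t1 \<le> z j" for j
    using strict_mono_less_eq[OF zmono, of 0 j] by (simp add: z_def)
  have zup: "z j \<le> F t0 + 1" for j
  proof -
    have "(E ^^ (N * j)) t1 < (E ^^ (N * j)) (t0 + 1)" using incr_diff_less_iff[OF incr_diff[OF EL(1)]] t1 by blast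
    also have "\<dots> = t0 + 1" using periodic[OF EL(1)] EL(2) by simp
    finally have "z j < F (t0 + 1)" using incr_diff_less_iff[OF incr_diff[OF F]] by (simp add: z_def)
    then show ?thesis using periodic[OF F] by simp
  qed
  define d0 where "d0 = F t1 - F t0"
  have d0: "d0 > 0" using diff_pos[OF F t1(2)] by (simp add: d0_def)
  \<comment> \<open>The weight of \<open>z j\<close> below which the quotient inside the logarithm
    is at most \<open>exp t\<close>.\<close>
  define \<epsilon> where "\<epsilon> = exp t * phi t1 * d0\<^sup>2 / (deriv F t0 * (t1 - t0)\<^sup>2)"
  have F0: "0 < deriv F t0" using deriv_pos[OF F] .
  have \<epsilon>: "\<epsilon> > 0" using phi_bounds[OF t1(1)] d0 F0 t1(2) by (simp add: \<epsilon>_def)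
  have "\<exists>j. phi (z j) < \<epsilon>"
  proof (rule ccontr)
    assume "\<not> ?thesis"
    then have "range z \<subseteq> {y \<in> X. F t1 \<le> y \<and> y \<le> F t0 + 1 \<and> \<epsilon> \<le> phi y}"
      using zX zle zup by (auto simp: not_less)
    moreover have "F t1 \<le> F t0 + 1" using zup[of 0] by (simp add: z_def)
    ultimately have "finite (range z)" using finite_large_phi[OF \<epsilon>] finite_subset by blast
    moreover have "inj z" using zmono by (rule strict_mono_imp_inj_on)
    ultimately show False using finite_imageD infinite_UNIV_nat by blast
  qed
  then obtain j where j: "phi (z j) < \<epsilon>" by blast
  define H where "H = F \<circ> (E ^^ (N * j))"
  have HL: "H \<in> L" using comp_in[OF F EL(1)] by (simp add: H_def)
  have H0: "H t0 = F t0" "deriv H t0 = deriv F t0"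
    using EL(2) deriv_comp[OF F EL(1)] stab_deriv[OF EL] by (auto simp: H_def)
  have H1: "H t1 = z j" "deriv H t1 * phi t1 = phi (z j)"
    using phi_image(2)[OF HL t1(1)] by (auto simp: H_def z_def)
  have "d0 \<le> H t1 - H t0" using zle[of j] H0 H1 by (simp add: d0_def)
  then have dd: "d0\<^sup>2 \<le> (H t1 - H t0)\<^sup>2" using d0 by (intro power_mono) auto
  have pos: "0 < deriv H t1" using deriv_pos[OF HL] .
  have "deriv H t1 < \<epsilon> / phi t1" using j H1 phi_bounds[OF t1(1)] by (simp add: pos_less_divide_eq)
  then have "deriv F t0 * deriv H t1 * (t1 - t0)\<^sup>2 \<le> deriv F t0 * (\<epsilon> / phi t1) * (t1 - t0)\<^sup>2"
    using F0 by (intro mult_right_mono mult_left_mono) auto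
  also have "\<dots> = exp t * d0\<^sup>2" using F0 t1(2) phi_bounds[OF t1(1)] by (simp add: \<epsilon>_def)
  also have "\<dots> \<le> exp t * (H t1 - H t0)\<^sup>2" using dd by (intro mult_left_mono) auto
  finally have "deriv H t0 * deriv H t1 * (t1 - t0)\<^sup>2 / (H t1 - H t0)\<^sup>2 \<le> exp t"
    using dd d0 H0 by (subst pos_divide_le_eq) (auto intro: less_le_trans[of 0 "d0\<^sup>2"])
  moreover have "0 < deriv H t0 * deriv H t1 * (t1 - t0)\<^sup>2 / (H t1 - H t0)\<^sup>2"
    using pos H0 F0 t1(2) diff_pos[OF HL t1(2)] by simp
  ultimately have "schwarz H t0 t1 \<le> ln (exp t)" unfolding schwarz_def by (simp only: ln_le_cancel_iff exp_gt_zero)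
  then show ?thesis unfolding H_def by auto
qed

text \<open>The infinite difference comes from the infinitely many \<open>y\<close> in
  \<open>X \<inter> {0<..<1}\<close>. Among the elements sending \<open>t0\<close> to
  \<open>y\<close> one satisfies \<open>P\<close>, and some power \<open>E ^^ (N * j)\<close>
  destroys this; an index where \<open>P\<close> holds but fails one step later gives a member of
  the difference. Different \<open>y\<close> give different members.\<close>

theorem almost_invariant_predicate:
  assumes S: "finite S" "S \<subseteq> L"
  shows "\<exists>P E. E \<in> L \<and> (\<forall>F\<in>L. \<forall>n. P (\<lambda>t. F t + of_int n) = P F) \<and>
    (\<forall>s\<in>S. finite {F \<in> normalized. P F \<noteq> P (s \<circ> F)}) \<and>
    (\<forall>N\<ge>1. infinite {F \<in> normalized. P F \<and> \<not> P (F \<circ> (E ^^ N))})"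
proof -
  obtain d where d: "d > 0" and norm: "\<And>y. y \<in> X \<Longrightarrow> \<exists>F\<in>L. F t0 = y \<and>
      (\<forall>t. \<bar>t - t0\<bar> \<le> d \<longrightarrow> phi y \<le> exp 1 * deriv F t \<and> deriv F t \<le> exp 1 * phi y)"
    using normalization by blast
  obtain t1 E where t1: "t1 \<in> X" "t0 < t1" "t1 < t0 + min d 1" and
    free: "\<And>F. F \<in> L \<Longrightarrow> F t0 = t0 \<Longrightarrow> F t1 = t1 \<Longrightarrow> F = id" and E: "E \<in> L" "E t0 = t0" "t1 < E t1"
    using base_pair[of "min d 1"] d by auto
  have t1': "t1 < t0 + 1" "t1 < t0 + d" using t1 by auto
  \<comment> \<open>The normalized representatives in \<open>base\<close> have cocycle at least -3,
    so any level below -3 would serve; this one lies between -6 and -5.\<close>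
  obtain t where t: "-6 < t" "t < -6 + 1" and
    bd: "\<And>s. s \<in> S \<Longrightarrow> finite {F \<in> normalized. (t < schwarz F t0 t1) \<noteq> (t < schwarz (s \<circ> F) t0 t1)}"
    using level_with_finite_boundary[OF t1(1,2) t1'(1) free S, of "-6"] by blast
  define P where "P F \<longleftrightarrow> t < schwarz F t0 t1" for F
  have base: "\<exists>F\<in>L. F t0 = y \<and> P F" if y: "y \<in> X" for y
  proof -
    obtain F where F: "F \<in> L" "F t0 = y" and Fd: "\<And>t. \<bar>t - t0\<bar> \<le> d \<Longrightarrow> phi y \<le> exp 1 * deriv F t"
      "\<And>t. \<bar>t - t0\<bar> \<le> d \<Longrightarrow> deriv F t \<le> exp 1 * phi y" using norm[OF y] by blast
    note py = phi_bounds[OF y]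
    obtain x where x: "t0 < x" "x < t1" "F t1 - F t0 = (t1 - t0) * deriv F x"
      using incr_diff_mvt[OF incr_diff[OF F(1)] t1(2)] by blast
    have F0: "deriv F t0 = phi y" using phi_eq[OF F(1)] F(2) by simp
    have up: "F t1 - F t0 \<le> (t1 - t0) * (exp 1 * phi y)"
      unfolding x(3) using Fd(2)[of x] x t1' by (intro mult_left_mono) auto
    have pos: "0 < F t1 - F t0" using diff_pos[OF F(1) t1(2)] .
    \<comment> \<open>Two of the three factors \<open>exp 1\<close> come from the squared length and
      one from \<open>deriv F t1\<close>.\<close>
    have "exp (-3) * (F t1 - F t0)\<^sup>2 \<le> exp (-3) * ((t1 - t0) * (exp 1 * phi y))\<^sup>2"
      using up pos by (intro mult_left_mono power_mono) auto
    also have "\<dots> = phi y * (phi y / exp 1) * (t1 - t0)\<^sup>2"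
    proof -
      have "exp (-3) * (exp 1 * exp 1) = (1 / exp 1 :: real)"
        by (simp add: exp_minus[symmetric] divide_inverse flip: exp_add)
      then show ?thesis by (simp add: power2_eq_square divide_inverse)
    qed
    also have "\<dots> \<le> phi y * deriv F t1 * (t1 - t0)\<^sup>2"
      using Fd(1)[of t1] t1' t1(2) py by (intro mult_right_mono mult_left_mono) (auto simp: pos_divide_le_eq mult.commute)
    finally have "exp (-3) \<le> deriv F t0 * deriv F t1 * (t1 - t0)\<^sup>2 / (F t1 - F t0)\<^sup>2"
      using pos F0 by (simp add: pos_le_divide_eq)
    then have "ln (exp (-3)) \<le> schwarz F t0 t1" unfolding schwarz_def
      by (subst ln_le_cancel_iff) (auto intro: less_le_trans[OF exp_gt_zero])
    then have "P F" using t by (simp add: P_def)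
    then show ?thesis using F by blast
  qed
  have EL: "(E ^^ n) t0 = t0" for n by (induction n) (simp_all add: E(2))
  have "infinite {F \<in> normalized. P F \<and> \<not> P (F \<circ> (E ^^ N))}" if N: "N \<ge> 1" for N
  proof
    assume fin: "finite {F \<in> normalized. P F \<and> \<not> P (F \<circ> (E ^^ N))}"
    have "X \<inter> {0<..<1} \<subseteq> (\<lambda>F. F t0) ` {F \<in> normalized. P F \<and> \<not> P (F \<circ> (E ^^ N))}"
    proof
      fix y assume y: "y \<in> X \<inter> {0<..<1}"
      then obtain F where F: "F \<in> L" "F t0 = y" "P F" using base by blast
      define Q where "Q j \<longleftrightarrow> \<not> P (F \<circ> (E ^^ (N * j)))" for j
      obtain j where "Q j"
        using schwarz_unbounded_below[OF t1(1,2) t1'(1) E F(1) N, of t] by (auto simp: Q_def P_def not_less)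
      moreover have "\<not> Q 0" using F(3) by (simp add: Q_def)
      ultimately obtain i where i: "\<not> Q i" "Q (Suc i)"
        using dec_induct[of 0 j "\<lambda>j. \<not> Q j"] by blast
      define H where "H = F \<circ> (E ^^ (N * i))"
      have "H \<in> L" using comp_in F(1) funpow_in[OF E(1)] by (simp add: H_def)
      moreover have "H t0 = y" using EL F(2) by (simp add: H_def)
      moreover have "P H" using i(1) by (simp add: Q_def H_def)
      moreover have "\<not> P (H \<circ> (E ^^ N))"
      proof -
        have "E ^^ (N * Suc i) = E ^^ (N * i) \<circ> E ^^ N" by (simp add: funpow_add[symmetric] add.commute)
        then have eq: "H \<circ> (E ^^ N) = F \<circ> (E ^^ (N * Suc i))" by (simp only: H_def comp_assoc)
        show ?thesis using i(2) unfolding Q_def eq .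
      qed
      ultimately show "y \<in> (\<lambda>F. F t0) ` {F \<in> normalized. P F \<and> \<not> P (F \<circ> (E ^^ N))}"
        using y by (intro image_eqI[of _ _ H]) (auto simp: normalized_def)
    qed
    then show False using fin X_infinite finite_subset finite_imageI by blast
  qed
  moreover have "P (\<lambda>t. F t + of_int n) = P F" if "F \<in> L" for F n
    using schwarz_shift[OF that] by (simp add: P_def)
  moreover have "finite {F \<in> normalized. P F \<noteq> P (s \<circ> F)}" if "s \<in> S" for s
    using bd[OF that] by (simp add: P_def)
  ultimately show ?thesis using E(1) by (intro exI[of _ P] exI[of _ E]) auto
qed

end

section \<open>From the circle to the line\<close>

lemma circle_lift_add_int:
  assumes "circle_lift F g"
  shows "circle_lift (\<lambda>t. F t + of_int n) g"
proof -
  have "proj (F t + of_int n) = proj (F t)" for t by (simp add: proj_eq_iff)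
  then show ?thesis using assms by (auto simp: circle_lift_def intro!: continuous_intros)
qed

lemma circle_lift_unique_map: "circle_lift F g \<Longrightarrow> circle_lift F h \<Longrightarrow> g = h"
  unfolding circle_lift_def by (metis ext proj_surj)

lemma circle_lift_diff_int:
  assumes "circle_lift F g" "circle_lift H g"
  obtains n :: int where "H = (\<lambda>t. F t + of_int n)"
  using circle_lift_diff_const[OF assms] by (auto elim!: Ints_cases simp: fun_eq_iff)

lemma real_analytic_add_const: "real_analytic f \<Longrightarrow> real_analytic (\<lambda>t. f t + c)"
  using real_analytic_diff[of f "\<lambda>_. - c"] has_fps_expansion_const by (auto simp: real_analytic_def)

text \<open>Analyticity and monotonicity are each required of some lift. Lifts of one map differ by
  integers, so every lift has both properties.\<close>

lemma Diff_omega_lift: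
  assumes "g \<in> carrier Diff_omega" "circle_lift F g"
  shows "real_analytic F" "strict_mono F"
proof -
  obtain F1 where F1: "circle_lift F1 g" "real_analytic F1"
    using assms(1) by (auto simp: Diff_omega_def circle_analytic_def)
  obtain n where "F = (\<lambda>t. F1 t + of_int n)" using circle_lift_diff_int[OF F1(1) assms(2)] .
  then show "real_analytic F" using real_analytic_add_const F1(2) by simp
  obtain F2 where F2: "circle_lift F2 g" "strict_mono F2"
    using assms(1) by (auto simp: Diff_omega_def orientation_preserving_def)
  obtain n where "F = (\<lambda>t. F2 t + of_int n)" using circle_lift_diff_int[OF F2(1) assms(2)] .
  then show "strict_mono F" using F2(2) by (simp add: strict_mono_def)
qed

lemma Diff_omega_inv:
  assumes "g \<in> carrier Diff_omega"
  shows "inv_into UNIV g \<in> carrier Diff_omega" "inv_into UNIV g \<circ> g = id" "g \<circ> inv_into UNIV g = id"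
    "inv\<^bsub>Diff_omega\<^esub> g = inv_into UNIV g"
proof -
  interpret group Diff_omega by (rule group_Diff_omega)
  have bij: "bij g" using assms by (simp add: Diff_omega_def)
  show *: "inv_into UNIV g \<in> carrier Diff_omega"
    using assms by (auto simp: Diff_omega_def bij_imp_bij_inv inv_inv_eq orientation_preserving_inv)
  show 1: "inv_into UNIV g \<circ> g = id" using bij by (simp add: bij_is_inj)
  show "g \<circ> inv_into UNIV g = id" using bij by (simp add: bij_is_surj surj_iff[symmetric])
  show "inv\<^bsub>Diff_omega\<^esub> g = inv_into UNIV g"
    using inv_equality[OF _ assms *] 1 by (simp add: Diff_omega_def)
qed

text \<open>Lifts of \<open>g\<close> and of its inverse have positive integer degrees, whose
  product is the degree 1 of a lift of the identity.\<close>

lemma lift_degree_one: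
  assumes g: "g \<in> carrier Diff_omega" "circle_lift F g"
  shows "F (t + 1) = F t + 1"
proof -
  have step: "\<exists>m::int. 0 < m \<and> (\<forall>t. F (t + 1) = F t + of_int m)"
    if gF: "g \<in> carrier Diff_omega" "circle_lift F g" for g F
  proof -
    have "circle_lift (\<lambda>t. F (t + 1)) g" using circle_lift_shift[OF gF(2), of 1] by simp
    then obtain m where m: "(\<lambda>t. F (t + 1)) = (\<lambda>t. F t + of_int m)" using circle_lift_diff_int[OF gF(2)] by blast
    have "F 0 < F (0 + 1)" using Diff_omega_lift(2)[OF gF] by (simp add: strict_mono_def)
    then have "0 < m" using fun_cong[OF m, of 0] by simp
    then show ?thesis using m by (auto simp: fun_eq_iff)
  qed
  note gi = Diff_omega_inv[OF g(1)]
  obtain H where H: "circle_lift H (inv_into UNIV g)"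
    using gi(1) by (auto simp: Diff_omega_def circle_analytic_def)
  obtain m where m: "0 < m" "\<And>t. F (t + 1) = F t + of_int m" using step[OF g] by blast
  obtain k where k: "0 < k" "\<And>t. H (t + 1) = H t + of_int k" using step[OF gi(1) H] by blast
  have "circle_lift (H \<circ> F) id" using circle_lift_compose[OF H g(2)] gi(2) by simp
  then obtain e where e: "H \<circ> F = (\<lambda>t. t + of_int e)" using circle_lift_diff_int[OF circle_lift_id] by blast
  have "H (F (0 + 1)) = H (F 0) + of_int m * of_int k"
    using periodic_int[of H "of_int k" "F 0" m] k(2) m(2)[of 0] by simp
  then have "(of_int (m * k) :: real) = of_int 1" using fun_cong[OF e, of 0] fun_cong[OF e, of "0 + 1"] by simp
  then have "m * k = 1" by (simp only: of_int_eq_iff)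
  then have "m = 1" using m(1) k(1) by (simp add: zmult_eq_1_iff)
  then show ?thesis using m(2) by simp
qed

lemma Diff_omega_lift_ex: "g \<in> carrier Diff_omega \<Longrightarrow> \<exists>F. circle_lift F g"
  by (auto simp: Diff_omega_def circle_analytic_def)

lemma lift_group_of_circle_group:
  assumes sub: "subgroup G Diff_omega" and min: "minimal_action G" and star: "property_star G"
    and x0: "proj t0 \<in> NE G"
  shows "lift_group {F. \<exists>g\<in>G. circle_lift F g} t0"
proof -
  have GD: "g \<in> carrier Diff_omega" if "g \<in> G" for g using subgroup.mem_carrier[OF sub that] .
  have Gid: "id \<in> G" using subgroup.one_closed[OF sub] by (simp add: Diff_omega_def)
  have Gcomp: "g \<circ> h \<in> G" if "g \<in> G" "h \<in> G" for g h
    using subgroup.m_closed[OF sub that] by (simp add: Diff_omega_def)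
  have Ginv: "inv_into UNIV g \<in> G" if "g \<in> G" for g
    using subgroup.m_inv_closed[OF sub that] Diff_omega_inv(4)[OF GD[OF that]] by simp
  have deriv: "circle_deriv g (proj t) = deriv F t" if "g \<in> G" "circle_lift F g" for g F t
    by (rule circle_deriv_eq[OF that(2) real_analytic_deriv(1)[OF Diff_omega_lift(1)[OF GD[OF that(1)] that(2)]]])
  have lift_through: "\<exists>F. circle_lift F g \<and> F t = s" if g: "g \<in> G" "g (proj t) = proj s" for g t s
  proof -
    obtain F where F: "circle_lift F g" using Diff_omega_lift_ex[OF GD[OF g(1)]] by blast
    then have "proj s = proj (F t)" using g(2) by (simp add: circle_lift_def)
    then obtain n where "s - F t = of_int n" by (auto simp: proj_eq_iff elim: Ints_cases)
    then show ?thesis using circle_lift_add_int[OF F, of n] by (intro exI[of _ "\<lambda>t. F t + of_int n"]) simp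
  qed
  show ?thesis
  proof
    show "id \<in> {F. \<exists>g\<in>G. circle_lift F g}" using Gid circle_lift_id by (auto simp: id_def)
    show "F \<circ> H \<in> {F. \<exists>g\<in>G. circle_lift F g}"
      if "F \<in> {F. \<exists>g\<in>G. circle_lift F g}" "H \<in> {F. \<exists>g\<in>G. circle_lift F g}" for F H
      using that Gcomp circle_lift_compose by blast
    show "(\<lambda>t. t + 1) \<in> {F. \<exists>g\<in>G. circle_lift F g}"
      using Gid circle_lift_add_int[OF circle_lift_id, of 1] by auto
    show "\<exists>H\<in>{F. \<exists>g\<in>G. circle_lift F g}. H \<circ> F = id \<and> F \<circ> H = id"
      if F: "F \<in> {F. \<exists>g\<in>G. circle_lift F g}" for F
    proof -
      obtain g where g: "g \<in> G" "circle_lift F g" using F by blast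
      obtain H where H: "circle_lift H (inv_into UNIV g)" using Diff_omega_lift_ex GD Ginv g(1) by blast
      note gi = Diff_omega_inv[OF GD[OF g(1)]]
      have "circle_lift (H \<circ> F) id" using circle_lift_compose[OF H g(2)] gi(2) by simp
      then obtain n where n: "H \<circ> F = (\<lambda>t. t + of_int n)" using circle_lift_diff_int[OF circle_lift_id] by blast
      define K where "K = (\<lambda>t. H t + of_int (- n))"
      have K: "circle_lift K (inv_into UNIV g)" unfolding K_def by (rule circle_lift_add_int[OF H])
      have KF: "K \<circ> F = id" using n by (auto simp: K_def fun_eq_iff)
      have "circle_lift (F \<circ> K) id" using circle_lift_compose[OF g(2) K] gi(3) by simp
      then obtain m where m: "F \<circ> K = (\<lambda>t. t + of_int m)" using circle_lift_diff_int[OF circle_lift_id] by blast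
      have "F (K (F 0)) = F 0" using fun_cong[OF KF, of 0] by simp
      then have "m = 0" using fun_cong[OF m, of "F 0"] by simp
      then have "F \<circ> K = id" using m by auto
      then show ?thesis using K KF Ginv[OF g(1)] by blast
    qed
    show "real_analytic F" "strict_mono F" "F (t + 1) = F t + 1"
      if "F \<in> {F. \<exists>g\<in>G. circle_lift F g}" for F t
      using that Diff_omega_lift lift_degree_one GD by blast+
    show "deriv F t0 \<le> 1" if "F \<in> {F. \<exists>g\<in>G. circle_lift F g}" for F
      using that deriv x0 by (auto simp: NE_def)
    show "\<exists>F\<in>{F. \<exists>g\<in>G. circle_lift F g}. a < F t \<and> F t < b" if "a < b" for a b t
    proof -
      define U where "U = proj ` {a<..<b}"
      \<comment> \<open>Openness in the quotient topology means openness of the preimage, which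
        consists of all integer translates of the interval.\<close>
      have "proj -` U = (\<Union>n. {a + of_int n<..<b + of_int n})"
      proof (intro equalityI subsetI)
        fix s assume "s \<in> proj -` U"
        then obtain r where r: "a < r" "r < b" "proj s = proj r" by (auto simp: U_def)
        then obtain n where "s - r = of_int n" by (auto simp: proj_eq_iff elim: Ints_cases)
        then show "s \<in> (\<Union>n. {a + of_int n<..<b + of_int n})" using r by (intro UN_I[of n]) auto
      next
        fix s assume "s \<in> (\<Union>n. {a + of_int n<..<b + of_int n})"
        then obtain n where n: "a + of_int n < s" "s < b + of_int n" by auto
        have "proj s = proj (s - of_int n)" by (simp add: proj_eq_iff)
        then show "s \<in> proj -` U" using n unfolding U_def by (auto intro!: image_eqI[of _ _ "s - of_int n"])
      qed
      then have "open U" unfolding open_circle_def by (auto intro!: open_UN)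
      moreover have "proj ((a + b) / 2) \<in> U" using that by (auto simp: U_def)
      moreover have "closure (orbit G (proj t)) = UNIV" using min by (simp add: minimal_action_def)
      ultimately have "U \<inter> orbit G (proj t) \<noteq> {}"
        using open_Int_closure_eq_empty[of U "orbit G (proj t)"] by auto
      then obtain g where "g \<in> G" "g (proj t) \<in> U" by (auto simp: orbit_def)
      moreover from this obtain s where "a < s" "s < b" "g (proj t) = proj s" by (auto simp: U_def)
      ultimately have g: "g \<in> G" "g (proj t) = proj s" "a < s" "s < b" by auto
      then show ?thesis using lift_through[OF g(1,2)] by blast
    qed
    show "\<exists>F\<in>{F. \<exists>g\<in>G. circle_lift F g}. F \<noteq> id \<and> F z = z"
      if le: "\<And>F. F \<in> {F. \<exists>g\<in>G. circle_lift F g} \<Longrightarrow> deriv F z \<le> 1" for z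
    proof -
      have "circle_deriv g (proj z) \<le> 1" if g: "g \<in> G" for g
      proof -
        obtain F where F: "circle_lift F g" using Diff_omega_lift_ex[OF GD[OF g]] by blast
        then show ?thesis using deriv[OF g F] le[of F] g by auto
      qed
      then have "proj z \<in> NE G \<inter> UNIV" by (simp add: NE_def)
      \<comment> \<open>Minimality makes the whole circle a minimal set, so property (star) applies
        to every non-expandable point.\<close>
      moreover have "minimal_set G UNIV" using minimal_set_eq_UNIV[OF min] by simp
      ultimately obtain g where g: "g \<in> G" "g \<noteq> id" "g (proj z) = proj z"
        using star unfolding property_star_def by blast
      obtain F where F: "circle_lift F g" "F z = z" using lift_through[OF g(1,3)] by blast
      have "F \<noteq> id" using F(1) g(2) circle_lift_unique_map[OF F(1), of id] circle_lift_id by (auto simp: id_def)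
      then show ?thesis using F g(1) by blast
    qed
  qed
qed

theorem theorem4:
  fixes G :: "(circle \<Rightarrow> circle) set" and x0 :: circle
  assumes "subgroup G Diff_omega"
    and "finitely_generated (Diff_omega\<lparr>carrier := G\<rparr>)"
    and "minimal_action G"
    and "property_star G"
    and "x0 \<in> NE G"
  shows "has_number_of_ends (Diff_omega\<lparr>carrier := G\<rparr>) \<infinity>"
proof -
  define \<Gamma> where "\<Gamma> = Diff_omega\<lparr>carrier := G\<rparr>"
  have car: "carrier \<Gamma> = G" and mult: "g \<otimes>\<^bsub>\<Gamma>\<^esub> h = g \<circ> h" for g h
    by (simp_all add: \<Gamma>_def Diff_omega_def)
  have \<Gamma>: "group \<Gamma>"
    unfolding \<Gamma>_def by (rule subgroup.subgroup_is_group[OF assms(1) group_Diff_omega])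
  have GD: "g \<in> carrier Diff_omega" if "g \<in> G" for g using subgroup.mem_carrier[OF assms(1) that] .
  have Gid: "id \<in> G" using subgroup.one_closed[OF assms(1)] by (simp add: Diff_omega_def)
  have Gcomp: "g \<circ> h \<in> G" if "g \<in> G" "h \<in> G" for g h
    using subgroup.m_closed[OF assms(1) that] by (simp add: Diff_omega_def)
  define iv :: "(circle \<Rightarrow> circle) \<Rightarrow> circle \<Rightarrow> circle" where "iv = inv_into UNIV"
  have iv: "iv g \<in> G" "iv g \<circ> g = id" "g \<circ> iv g = id" if "g \<in> G" for g
    using subgroup.m_inv_closed[OF assms(1) that] Diff_omega_inv[OF GD[OF that]] by (simp_all add: iv_def)
  have bijG: "bij g" if "g \<in> G" for g using GD[OF that] by (simp add: Diff_omega_def)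
  have iv_comp: "iv (g \<circ> h) = iv h \<circ> iv g" if "g \<in> G" "h \<in> G" for g h
    unfolding iv_def using bijG that by (intro o_inv_distrib)
  have iv_iv: "iv (iv g) = g" if "g \<in> G" for g unfolding iv_def using bijG[OF that] by (rule inv_inv_eq)
  obtain t0 where t0: "proj t0 = x0" using proj_surj by blast
  interpret lift_group "{F. \<exists>g\<in>G. circle_lift F g}" t0
    using lift_group_of_circle_group assms t0 by blast
  have "graph_ends (carrier \<Gamma>) (cayley_edges \<Gamma> S) = \<infinity>" if S: "finite_generating_set \<Gamma> S" for S
  proof -
    have SG: "finite S" "S \<subseteq> G" using S by (auto simp: finite_generating_set_def car)
    define lft where "lft g = (SOME F. circle_lift F g)" for g
    have lft: "circle_lift (lft g) g" if "g \<in> G" for g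
      unfolding lft_def using someI_ex[OF Diff_omega_lift_ex[OF GD[OF that]]] .
    have ex: "\<exists>P E. E \<in> {F. \<exists>g\<in>G. circle_lift F g} \<and>
      (\<forall>F\<in>{F. \<exists>g\<in>G. circle_lift F g}. \<forall>n. P (\<lambda>t. F t + of_int n) = P F) \<and>
      (\<forall>s\<in>(\<lambda>s. lft (iv s)) ` S. finite {F \<in> normalized. P F \<noteq> P (s \<circ> F)}) \<and>
      (\<forall>N\<ge>1. infinite {F \<in> normalized. P F \<and> \<not> P (F \<circ> (E ^^ N))})"
      by (rule almost_invariant_predicate) (use SG lft iv in auto)
    obtain P E where PE: "E \<in> {F. \<exists>g\<in>G. circle_lift F g}"
      "\<forall>F\<in>{F. \<exists>g\<in>G. circle_lift F g}. \<forall>n. P (\<lambda>t. F t + of_int n) = P F"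
      "\<forall>s\<in>(\<lambda>s. lft (iv s)) ` S. finite {F \<in> normalized. P F \<noteq> P (s \<circ> F)}"
      "\<forall>N\<ge>1. infinite {F \<in> normalized. P F \<and> \<not> P (F \<circ> (E ^^ N))}"
      using ex by (elim exE conjE)
    have Pshift: "P (\<lambda>t. F t + of_int n) = P F" if "g \<in> G" "circle_lift F g" for F g n
      using PE(2) that by blast
    have Pbd: "finite {F \<in> normalized. P F \<noteq> P (lft (iv s) \<circ> F)}" if "s \<in> S" for s
      using bspec[OF PE(3) imageI[OF that]] .
    have Pinf: "infinite {F \<in> normalized. P F \<and> \<not> P (F \<circ> (E ^^ N))}" if "N \<ge> 1" for N
      using PE(4) that by simp
    have E: "\<exists>g\<in>G. circle_lift E g" using PE(1) by simp
    obtain e where e: "e \<in> G" "circle_lift E e" using E by blast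
    \<comment> \<open>Invariance of \<open>P\<close> under integer translations makes the choice of
      the lift irrelevant.\<close>
    define Q where "Q g \<longleftrightarrow> P (lft g)" for g
    have Q: "Q g = P F" if g: "g \<in> G" "circle_lift F g" for g F
    proof -
      obtain n where n: "F = (\<lambda>t. lft g t + of_int n)" using circle_lift_diff_int[OF lft[OF g(1)] g(2)] .
      show ?thesis unfolding Q_def n using Pshift[OF g(1) lft[OF g(1)]] by simp
    qed
    have norm_ex: "\<exists>F\<in>normalized. circle_lift F g" if "g \<in> G" for g
    proof (intro bexI)
      show *: "circle_lift (\<lambda>t. lft g t + of_int (- \<lfloor>lft g t0\<rfloor>)) g"
        by (rule circle_lift_add_int[OF lft[OF that]])
      show "(\<lambda>t. lft g t + of_int (- \<lfloor>lft g t0\<rfloor>)) \<in> normalized"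
        using * that floor_correct[of "lft g t0"] unfolding normalized_def by (auto; linarith)
    qed
    have norm_unique: "F = H" if nu: "circle_lift F g" "circle_lift H g" "F \<in> normalized" "H \<in> normalized" for F H g
    proof -
      obtain n where n: "H = (\<lambda>t. F t + of_int n)" using circle_lift_diff_int[OF nu(1,2)] .
      then have "n = 0" using nu(3,4) by (auto simp: normalized_def)
      then show ?thesis using n by simp
    qed
    have epow: "e ^^ n \<in> G" "circle_lift (E ^^ n) (e ^^ n)" for n
      by (induction n) (simp_all only: funpow.simps Gid Gcomp e circle_lift_compose circle_lift_id[folded id_def])
    have Qbd: "finite {g \<in> G. Q g \<noteq> Q (iv s \<circ> g)}" if s: "s \<in> S" for s
    proof -
      have ivs: "iv s \<in> G" using iv(1) s SG by blast
      define f where "f g = (SOME F. F \<in> normalized \<and> circle_lift F g)" for g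
      have f: "f g \<in> normalized" "circle_lift (f g) g" if "g \<in> G" for g
        unfolding f_def using someI_ex[of "\<lambda>F. F \<in> normalized \<and> circle_lift F g"] norm_ex[OF that] by blast+
      have "f ` {g \<in> G. Q g \<noteq> Q (iv s \<circ> g)} \<subseteq> {F \<in> normalized. P F \<noteq> P (lft (iv s) \<circ> F)}"
      proof (rule image_subsetI)
        fix g assume "g \<in> {g \<in> G. Q g \<noteq> Q (iv s \<circ> g)}"
        then have g: "g \<in> G" "Q g \<noteq> Q (iv s \<circ> g)" by auto
        have "Q g = P (f g)" using Q f g by blast
        moreover have "Q (iv s \<circ> g) = P (lft (iv s) \<circ> f g)"
          using Q[OF Gcomp[OF ivs g(1)] circle_lift_compose[OF lft[OF ivs] f(2)[OF g(1)]]] .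
        ultimately show "f g \<in> {F \<in> normalized. P F \<noteq> P (lft (iv s) \<circ> F)}" using f(1) g by simp
      qed
      then have "finite (f ` {g \<in> G. Q g \<noteq> Q (iv s \<circ> g)})" using Pbd[OF s] finite_subset by blast
      moreover have "inj_on f {g \<in> G. Q g \<noteq> Q (iv s \<circ> g)}"
      proof (rule inj_onI)
        fix g h assume "g \<in> {g \<in> G. Q g \<noteq> Q (iv s \<circ> g)}" "h \<in> {g \<in> G. Q g \<noteq> Q (iv s \<circ> g)}" "f g = f h"
        then show "g = h" using f(2)[of g] f(2)[of h] circle_lift_unique_map by auto
      qed
      ultimately show ?thesis using finite_imageD by blast
    qed
    have Qinf: "infinite {g \<in> G. Q g \<and> \<not> Q (g \<circ> e ^^ N)}" if N: "N \<ge> 1" for N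
    proof
      assume fin: "finite {g \<in> G. Q g \<and> \<not> Q (g \<circ> e ^^ N)}"
      define f where "f F = (SOME g. g \<in> G \<and> circle_lift F g)" for F
      have f: "f F \<in> G" "circle_lift F (f F)" if "F \<in> normalized" for F
        unfolding f_def using someI_ex[of "\<lambda>g. g \<in> G \<and> circle_lift F g"] that by (auto simp: normalized_def)
      have "f ` {F \<in> normalized. P F \<and> \<not> P (F \<circ> (E ^^ N))} \<subseteq> {g \<in> G. Q g \<and> \<not> Q (g \<circ> e ^^ N)}"
      proof (rule image_subsetI)
        fix F assume "F \<in> {F \<in> normalized. P F \<and> \<not> P (F \<circ> (E ^^ N))}"
        then have F: "F \<in> normalized" "P F" "\<not> P (F \<circ> E ^^ N)" by auto
        have "Q (f F) = P F" using Q f F by blast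
        moreover have "Q (f F \<circ> e ^^ N) = P (F \<circ> E ^^ N)"
          using Q[OF Gcomp[OF f(1)[OF F(1)] epow(1)] circle_lift_compose[OF f(2)[OF F(1)] epow(2)]] .
        ultimately show "f F \<in> {g \<in> G. Q g \<and> \<not> Q (g \<circ> e ^^ N)}" using f(1) F by simp
      qed
      then have "finite (f ` {F \<in> normalized. P F \<and> \<not> P (F \<circ> (E ^^ N))})" using fin finite_subset by blast
      moreover have "inj_on f {F \<in> normalized. P F \<and> \<not> P (F \<circ> (E ^^ N))}"
      proof (rule inj_onI)
        fix F H assume "F \<in> {F \<in> normalized. P F \<and> \<not> P (F \<circ> (E ^^ N))}"
          "H \<in> {F \<in> normalized. P F \<and> \<not> P (F \<circ> (E ^^ N))}" "f F = f H"
        then show "F = H" using norm_unique[of F "f F" H] f(2)[of F] f(2)[of H] by simp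
      qed
      ultimately show False using Pinf[OF N] finite_imageD by blast
    qed
    \<comment> \<open>Cayley edges compose with \<open>s\<close> on the right, whereas
      \<open>Q\<close> has finite boundary for composition on the left. Inversion moves
      \<open>s\<close> to the left as \<open>iv s\<close>, while the powers of \<open>e\<close>
      remain on the right; this is why the lifted generators are those of
      \<open>iv s\<close>.\<close>
    define B where "B i = {g \<in> G. Q (iv g \<circ> e ^^ i)}" for i
    have cancel: "iv g \<circ> h = iv g' \<circ> h \<Longrightarrow> g = g'" if "g \<in> G" "g' \<in> G" "h \<in> G" for g g' h
    proof -
      assume "iv g \<circ> h = iv g' \<circ> h"
      then have "iv g \<circ> (h \<circ> iv h) = iv g' \<circ> (h \<circ> iv h)" by (simp only: comp_assoc[symmetric])
      then have "iv g = iv g'" using iv(3)[OF that(3)] by simp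
      then show ?thesis using iv_iv that by metis
    qed
    show ?thesis
    proof (rule graph_ends_infinite_if_almost_invariant_sets[OF \<Gamma> S, of B])
      show "B i \<subseteq> carrier \<Gamma>" for i by (auto simp: B_def car)
      show "finite {g \<in> carrier \<Gamma>. (g \<in> B i) \<noteq> (g \<otimes>\<^bsub>\<Gamma>\<^esub> s \<in> B i)}" if s: "s \<in> S" for i s
      proof -
        have sG: "s \<in> G" using s SG by blast
        define k where "k g = iv g \<circ> e ^^ i" for g
        have kG: "k g \<in> G" if "g \<in> G" for g using Gcomp iv(1) epow(1) that by (simp add: k_def)
        have "k ` {g \<in> G. (g \<in> B i) \<noteq> (g \<circ> s \<in> B i)} \<subseteq> {g \<in> G. Q g \<noteq> Q (iv s \<circ> g)}"
        proof (rule image_subsetI)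
          fix g assume "g \<in> {g \<in> G. (g \<in> B i) \<noteq> (g \<circ> s \<in> B i)}"
          then have g: "g \<in> G" "(g \<in> B i) \<noteq> (g \<circ> s \<in> B i)" by auto
          have "g \<in> B i \<longleftrightarrow> Q (k g)" using g by (simp add: B_def k_def)
          moreover have "g \<circ> s \<in> B i \<longleftrightarrow> Q (iv s \<circ> k g)"
            using Gcomp[OF g(1) sG] iv_comp[OF g(1) sG] by (simp add: B_def k_def comp_assoc)
          ultimately show "k g \<in> {g \<in> G. Q g \<noteq> Q (iv s \<circ> g)}" using g kG by auto
        qed
        then have "finite (k ` {g \<in> G. (g \<in> B i) \<noteq> (g \<circ> s \<in> B i)})" using Qbd[OF s] finite_subset by blast
        moreover have "inj_on k {g \<in> G. (g \<in> B i) \<noteq> (g \<circ> s \<in> B i)}"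
          unfolding inj_on_def k_def using cancel epow(1) by blast
        ultimately show ?thesis unfolding car mult using finite_imageD by blast
      qed
      show "infinite (B i - B j)" if "i < j" for i j
      proof
        assume fin: "finite (B i - B j)"
        \<comment> \<open>Solves \<open>iv (k g) \<circ> e ^^ i = g\<close>, so that membership of
          \<open>k g\<close> in \<open>B i\<close> and in \<open>B j\<close> tests \<open>Q\<close>
          at \<open>g\<close> and at \<open>g \<circ> e ^^ (j - i)\<close>.\<close>
        define k where "k g = e ^^ i \<circ> iv g" for g
        have kG: "k g \<in> G" if "g \<in> G" for g using Gcomp iv(1) epow(1) that by (simp add: k_def)
        have ivk: "iv (k g) \<circ> e ^^ i = g" if "g \<in> G" for g
        proof -
          have "iv (k g) \<circ> e ^^ i = g \<circ> (iv (e ^^ i) \<circ> e ^^ i)"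
            using iv_comp[OF epow(1) iv(1)[OF that]] iv_iv[OF that] by (simp only: k_def comp_assoc)
          then show ?thesis using iv(2)[OF epow(1)] by simp
        qed
        have ivk': "iv (k g) \<circ> e ^^ j = g \<circ> e ^^ (j - i)" if "g \<in> G" for g
        proof -
          have "e ^^ j = e ^^ i \<circ> e ^^ (j - i)" using \<open>i < j\<close> by (simp add: funpow_add[symmetric])
          then have "iv (k g) \<circ> e ^^ j = (iv (k g) \<circ> e ^^ i) \<circ> e ^^ (j - i)" by (simp only: comp_assoc)
          then show ?thesis using ivk[OF that] by simp
        qed
        have "k ` {g \<in> G. Q g \<and> \<not> Q (g \<circ> e ^^ (j - i))} \<subseteq> B i - B j"
          using kG ivk ivk' by (auto simp: B_def)
        then have "finite (k ` {g \<in> G. Q g \<and> \<not> Q (g \<circ> e ^^ (j - i))})" using fin finite_subset by blast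
        moreover have "inj_on k {g \<in> G. Q g \<and> \<not> Q (g \<circ> e ^^ (j - i))}"
          using ivk by (intro inj_onI) (metis (no_types, lifting) mem_Collect_eq)
        ultimately show False using Qinf[of "j - i"] \<open>i < j\<close> finite_imageD by fastforce
      qed
    qed
  qed
  then show ?thesis using assms(2) unfolding has_number_of_ends_def \<Gamma>_def by blast
qed

end
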